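(* Let $(\mathcal C,\circ,I)$ be a finitely complete monoidal category, with binary product $\times$ and terminal object $\mathsf 1$. If there is a reversion on the $\times$-braided duoidal category $(\mathcal C,\circ,I,\times,\mathsf 1)$, then the category $\mathrm{Grp}^{\mathrm m}(\mathcal C,\circ,I)$ of internal groups $G$ in $(\mathcal C,\circ,I)$ whose unit morphism $u_G:I\to G$ is a monomorphism in $\mathcal C$ is protomodular.
   Context: Conventions: composition is juxtaposition (right to left), an object also denotes its identity morphism, associativity constraints are suppressed. Duoidal category $(\mathcal C,\circ,I,\bullet,J)$: a category with monoidal structures $(\mathcal C,\circ,I)$, $(\mathcal C,\bullet,J)$ (left/right unit constraints $l^\circ,r^\circ$, resp. $l^\bullet,r^\bullet$), a natural transformation $\zeta_{A,B,C,D}:(A\bullet B)\circ(C\bullet D)\to(A\circ C)\bullet(B\circ D)$ and morphisms $\Delta_I:I\to I\bullet I$, $m_J:J\circ J\to J$, $\varepsilon_I=u_J:I\to J$ satisfying the standard axioms ($(J,m_J,u_J)$ a monoid in $(\mathcal C,\circ)$, $(I,\Delta_I,\varepsilon_I)$ a comonoid in $(\mathcal C,\bullet)$, associativity and unitality of $\zeta$ with respect to both structures). Every monoidal category $(\mathcal C,\circ,I)$ with finite products is a duoidal category with $\bullet=\times$, $J=\mathsf 1$, $\zeta_{A,B,C,D}=\langle p_A\circ p_C,\ p_B\circ p_D\rangle$ ($p$ the product projections), $\Delta_I$ the diagonal, $m_J$ and $\varepsilon_I=u_J$ the unique morphisms to $\mathsf 1$; it is $\times$-braided by the symmetry of $\times$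 (i.e. the symmetry $\sigma$ satisfies $\sigma_{A\circ C,B\circ D}\zeta_{A,B,C,D}=\zeta_{B,A,D,C}(\sigma_{A,B}\circ\sigma_{C,D})$, $\sigma_{I,I}\Delta_I=\Delta_I$). Below take $\bullet=\times$, $J=\mathsf 1$ with these data. Bimonoid: $(H,m_H,u_H,\Delta_H,\varepsilon_H)$ with $(H,m_H,u_H)$ a monoid in $(\mathcal C,\circ,I)$, $(H,\Delta_H,\varepsilon_H)$ a comonoid in $(\mathcal C,\bullet,J)$ and $\Delta_Hm_H=(m_H\bullet m_H)\zeta_{H,H,H,H}(\Delta_H\circ\Delta_H)$, $\varepsilon_Hm_H=m_J(\varepsilon_H\circ\varepsilon_H)$, $\Delta_Hu_H=(u_H\bullet u_H)\Delta_I$, $\varepsilon_Hu_H=\varepsilon_I$; morphisms are morphisms of monoids and comonoids. (For $\bullet=\times$, necessarily $\Delta_H$ is the diagonal and $\varepsilon_H$ the map to $\mathsf 1$.) Reversion: a functor $(-)^-:\mathcal C\to\mathcal C$ with lax monoidal structures $(\phi^\circ_{X,Y}:X^-\circ Y^-\to(Y\circ X)^-,\ \phi^\circ_0:I\to I^-)$ from $(\mathcal C,\circ^{\mathrm{rev}})$ to $(\mathcal C,\circ)$ and $(\phi^\bullet_{X,Y}:X^-\bullet Y^-\to(Y\bullet X)^-,\ \phi^\bullet_0:J\to J^-)$ from $(\mathcal C,\bullet^{\mathrm{rev}})$ to $(\mathcal C,\bullet)$ ($\mathrm{rev}$ = reversed tensor product), forming a double lax monoidal functor $(\mathcal C,\circ^{\mathrm{rev}},\bullet^{\mathrm{rev}})\to(\mathcal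 C,\circ,\bullet)$, i.e. $\phi^\bullet_{C\circ A,D\circ B}(\phi^\circ_{A,C}\bullet\phi^\circ_{B,D})\zeta_{A^-,B^-,C^-,D^-}=(\zeta_{D,C,B,A})^-\phi^\circ_{B\bullet A,D\bullet C}(\phi^\bullet_{A,B}\circ\phi^\bullet_{C,D})$, $\phi^\bullet_{I,I}(\phi^\circ_0\bullet\phi^\circ_0)\Delta_I=(\Delta_I)^-\phi^\circ_0$, $(m_J)^-\phi^\circ_{J,J}(\phi^\bullet_0\circ\phi^\bullet_0)=\phi^\bullet_0m_J$, $\phi^\bullet_0\varepsilon_I=(\varepsilon_I)^-\phi^\circ_0$; together with natural transformations $\gamma_{X,Y,Z,T}:((X\bullet Y^-)\circ Z)\bullet T\to X\circ(Z\bullet(Y\circ T))$, $\delta_{X,Y,Z,T}:X\bullet(Y\circ(Z^-\bullet T))\to((X\circ Z)\bullet Y)\circ T$, $\widetilde\gamma_{X,Y,Z,T}:X^-\bullet((Y\bullet Z)\circ T)\to Z\circ((X\circ Y)^-\bullet T)$, $\widetilde\delta_{X,Y,Z,T}:(X\circ(Y\bullet Z))\bullet T^-\to(X\bullet(Z\circ T)^-)\circ Y$. Put $\psi_{X,Y}=\gamma_{J,X,I,Y}(((l^\bullet_{X^-})^{-1}\circ I)\bullet Y)((r^\circ_{X^-})^{-1}\bullet Y):X^-\bullet Y\to J\circ(I\bullet(X\circ Y))$, $\varphi_{X,Y}=\delta_{X,I,Y,J}(X\bullet(I\circ(r^\bullet_{Y^-})^{-1}))(X\bullet(l^\circ_{Y^-})^{-1}):X\bullet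 Y^-\to((X\circ Y)\bullet I)\circ J$, $\widetilde\psi_{X,Y}=l^\circ_{(X\circ Y)^-}(I\circ r^\bullet_{(X\circ Y)^-})\widetilde\gamma_{X,Y,I,J}:X^-\bullet((Y\bullet I)\circ J)\to(X\circ Y)^-$, $\widetilde\varphi_{X,Y}=r^\circ_{(X\circ Y)^-}(l^\bullet_{(X\circ Y)^-}\circ I)\widetilde\delta_{J,I,X,Y}:(J\circ(I\bullet X))\bullet Y^-\to(X\circ Y)^-$. Axioms, for all objects ($\Delta_J:J\to J\bullet J$ is the inverse unit constraint): (R1) $\gamma_{X,Y,Z\circ U,T\circ V}\zeta_{(X\bullet Y^-)\circ Z,T,U,V}=(X\circ\zeta_{Z,Y\circ T,U,V})(\gamma_{X,Y,Z,T}\circ(U\bullet V))$. (R2) $((X\circ T)\bullet\gamma_{Y,Z,U,V})(\zeta_{X,Y\bullet Z^-,T,U}\bullet V)=\zeta_{X,Y,T,U\bullet(Z\circ V)}\gamma_{X\bullet Y,Z,T\bullet U,V}$. (R3) $\delta_{X\circ Z,Y\circ T,U,V}\zeta_{X,Y,Z,T\circ(U^-\bullet V)}=(\zeta_{X,Y,Z\circ U,T}\circ V)((X\bullet Y)\circ\delta_{Z,T,U,V})$. (R4) $(\delta_{X,Y,T,U}\bullet(Z\circ V))(X\bullet\zeta_{Y,Z,T^-\bullet U,V})=\zeta_{(X\circ T)\bullet Y,Z,U,V}\delta_{X,Y\bullet Z,T,U\bullet V}$. (R5) $\delta_{X,Y,T,U\bullet(Z\circ V)}(X\bullet\gamma_{Y,Z,T^-\bullet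 U,V})=\gamma_{(X\circ T)\bullet Y,Z,U,V}(\delta_{X,Y\bullet Z^-,T,U}\bullet V)$. (R6) $l^\circ_{I\bullet I}(I\circ(I\bullet l^\circ_I))\gamma_{I,I,I,I}(((I\bullet\phi^\circ_0)\Delta_I\circ I)\bullet I)=l^\circ_I\bullet I$. (R7) $r^\circ_{I\bullet I}((r^\circ_I\bullet I)\circ I)\delta_{I,I,I,I}(I\bullet(I\circ(\phi^\circ_0\bullet I)\Delta_I))=I\bullet r^\circ_I$. (R8) $\gamma_{X\circ Z,Y,J\circ J,U}((\delta_{X,Y^-,Z,J}\circ J)\bullet U)(((X\bullet(Y^-\circ(r^\bullet_{Z^-})^{-1}))\circ J)\bullet U)=(X\circ Z\circ\zeta_{J,Y,J,U})(X\circ Z\circ(l^\bullet_Y)^{-1}\circ(l^\bullet_U)^{-1})(X\circ l^\bullet_{Z\circ Y\circ U})\gamma_{X,Z\circ Y,J,U}(((X\bullet\phi^\circ_{Y,Z})\circ J)\bullet U)$. (R9) $\delta_{X,J\circ J,Z,Y\circ U}(X\bullet(J\circ\gamma_{J,Y,Z^-,U}))(X\bullet(J\circ(((l^\bullet_{Y^-})^{-1}\circ Z^-)\bullet U)))=(\zeta_{X,J,Z,J}\circ Y\circ U)((r^\bullet_X)^{-1}\circ(r^\bullet_Z)^{-1}\circ Y\circ U)(r^\bullet_{X\circ Z\circ Y}\circ U)\delta_{X,J,Z\circ Y,U}(X\bullet(J\circ(\phi^\circ_{Y,Z}\bullet U)))$. (R10) $\widetilde\varphi_{X\circ Y,Z}(\psi_{X,Y}\bullet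 Z^-)=\widetilde\psi_{X,Y\circ Z}(X^-\bullet\varphi_{Y,Z})$. (R11) $(r^\circ_X)^-l^\circ_{(X\circ I)^-}(I\circ r^\bullet_{(X\circ I)^-})\widetilde\gamma_{X,I,I,J}(X^-\bullet(\Delta_I\circ J))=r^\bullet_{X^-}(X^-\bullet l^\circ_J)$. (R12) $(l^\circ_X)^-r^\circ_{(I\circ X)^-}(l^\bullet_{(I\circ X)^-}\circ I)\widetilde\delta_{J,I,I,X}((J\circ\Delta_I)\bullet X^-)=l^\bullet_{X^-}(r^\circ_J\bullet X^-)$. (R13) $\gamma_{X,Y,T\bullet(Z\circ U),V}(\gamma_{X\bullet Y^-,Z,T,U}\bullet V)=(X\circ(T\bullet\zeta_{Z,Y,U,V}))\gamma_{X,Z\bullet Y,T,U\bullet V}(((X\bullet\phi^\bullet_{Y,Z})\circ T)\bullet U\bullet V)$. (R14) $\delta_{X,(Y\circ T)\bullet Z,U,V}(X\bullet\delta_{Y,Z,T,U^-\bullet V})=((\zeta_{X,Y,U,T}\bullet Z)\circ V)\delta_{X\bullet Y,Z,U\bullet T,V}(X\bullet Y\bullet(Z\circ(\phi^\bullet_{T,U}\bullet V)))$. (R15) $(X\circ\gamma_{Z,T,U,Y\circ V})\gamma_{X,Y,(Z\bullet T^-)\circ U,V}=\gamma_{X\circ Z,T\circ Y,U,V}((((X\circ Z)\bullet\phi^\circ_{Y,T})\circ U)\bullet V)((\zeta_{X,Y^-,Z,T^-}\circ U)\bullet V)$. (R16) $(\delta_{X\circ U,Y,Z,T}\circ V)\delta_{X,Y\circ(Z^-\bullet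 T),U,V}=\delta_{X,Y,U\circ Z,T\circ V}(X\bullet(Y\circ(\phi^\circ_{Z,U}\bullet(T\circ V))))(X\bullet(Y\circ\zeta_{Z^-,T,U^-,V}))$. (R17) $r^\circ_J(J\circ r^\bullet_I)(J\circ(I\bullet m_J))\gamma_{J,J,I,J}(((J\bullet\phi^\bullet_0)\Delta_J\circ I)\bullet J)=r^\bullet_J(r^\circ_J\bullet J)$. (R18) $l^\circ_J(l^\bullet_I\circ J)((m_J\bullet I)\circ J)\delta_{J,I,J,J}(J\bullet(I\circ(\phi^\bullet_0\bullet J)\Delta_J))=l^\bullet_J(J\bullet l^\circ_J)$. Hopf monoid: a bimonoid $H$ with an antipode, i.e. a morphism $\Sigma_H:H\to H^-$ in $\mathcal C$ such that $((m_H\bullet I)\circ J)\varphi_{H,H}(H\bullet\Sigma_H)\Delta_H=((u_H\bullet I)\circ J)(\Delta_I\circ J)(l^\circ_J)^{-1}\varepsilon_H$ and $(J\circ(I\bullet m_H))\psi_{H,H}(\Sigma_H\bullet H)\Delta_H=(J\circ(I\bullet u_H))(J\circ\Delta_I)(r^\circ_J)^{-1}\varepsilon_H$. When there is a reversion on $(\mathcal C,\circ,I,\times,\mathsf 1)$, the category $\mathrm{Grp}(\mathcal C,\circ,I)$ of internal groups in $(\mathcal C,\circ,I)$ is the category of Hopf monoids in $(\mathcal C,\circ,I,\times,\mathsf 1)$, with bimonoid morphisms; $\mathrm{Grp}^{\mathrm m}$ is the full subcategory described in the claim. Protomodular: a category with pullbacks of split epimorphisms along any morphism, such that all inverse image (change-of-base)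 functors of the fibration of points (split epimorphisms with chosen section, mapped to their codomain) reflect isomorphisms. *)

theory Defs
  imports Main
begin

text \<open>
  Categories are single-sorted: an object is the same thing as its identity arrow. Tensor products
  and functors are therefore single operations on arrows, and \<open>X \<otimes> f\<close> with an object \<open>X\<close>
  is the whiskering by \<open>X\<close>. In the usual formulas below, all associativity constraints that
  are commonly suppressed are inserted explicitly (by coherence, there is only one way to do so).
\<close>

record 'a cat =
  Arr :: "'a set"
  Dom :: "'a \<Rightarrow> 'a"
  Cod :: "'a \<Rightarrow> 'a"
  Comp :: "'a \<Rightarrow> 'a \<Rightarrow> 'a"

definition Obj :: "'a cat \<Rightarrow> 'a set" where
  "Obj C = {X \<in> Arr C. Dom C X = X}"

definition Hom :: "'a cat \<Rightarrow> 'a \<Rightarrow> 'a \<Rightarrow> 'a set" where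
  "Hom C X Y = {f \<in> Arr C. Dom C f = X \<and> Cod C f = Y}"

locale category =
  fixes C :: "'a cat"
  assumes dom_in: "f \<in> Arr C \<Longrightarrow> Dom C f \<in> Arr C"
    and cod_in: "f \<in> Arr C \<Longrightarrow> Cod C f \<in> Arr C"
    and dom_dom: "f \<in> Arr C \<Longrightarrow> Dom C (Dom C f) = Dom C f"
    and cod_dom: "f \<in> Arr C \<Longrightarrow> Cod C (Dom C f) = Dom C f"
    and dom_cod: "f \<in> Arr C \<Longrightarrow> Dom C (Cod C f) = Cod C f"
    and cod_cod: "f \<in> Arr C \<Longrightarrow> Cod C (Cod C f) = Cod C f"
    and comp_in: "\<lbrakk>f \<in> Hom C X Y; g \<in> Hom C Y Z\<rbrakk> \<Longrightarrow> Comp C g f \<in> Hom C X Z"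
    and comp_dom: "f \<in> Arr C \<Longrightarrow> Comp C f (Dom C f) = f"
    and comp_cod: "f \<in> Arr C \<Longrightarrow> Comp C (Cod C f) f = f"
    and comp_assoc: "\<lbrakk>f \<in> Hom C W X; g \<in> Hom C X Y; h \<in> Hom C Y Z\<rbrakk>
      \<Longrightarrow> Comp C (Comp C h g) f = Comp C h (Comp C g f)"

definition inverse_arrows :: "'a cat \<Rightarrow> 'a \<Rightarrow> 'a \<Rightarrow> bool" where
  "inverse_arrows C f g \<longleftrightarrow> f \<in> Arr C \<and> g \<in> Hom C (Cod C f) (Dom C f) \<and>
     Comp C g f = Dom C f \<and> Comp C f g = Cod C f"

definition is_iso :: "'a cat \<Rightarrow> 'a \<Rightarrow> bool" where
  "is_iso C f \<longleftrightarrow> (\<exists>g. inverse_arrows C f g)"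

definition inverse_of :: "'a cat \<Rightarrow> 'a \<Rightarrow> 'a" where
  "inverse_of C f = (THE g. inverse_arrows C f g)"

definition monic :: "'a cat \<Rightarrow> 'a \<Rightarrow> bool" where
  "monic C f \<longleftrightarrow> f \<in> Arr C \<and>
     (\<forall>X. \<forall>g \<in> Hom C X (Dom C f). \<forall>h \<in> Hom C X (Dom C f). Comp C f g = Comp C f h \<longrightarrow> g = h)"

definition full_subcategory :: "'a cat \<Rightarrow> ('a \<Rightarrow> bool) \<Rightarrow> 'a cat" where
  "full_subcategory C P = C\<lparr>Arr := {f \<in> Arr C. P (Dom C f) \<and> P (Cod C f)}\<rparr>"

definition is_functor :: "'a cat \<Rightarrow> 'b cat \<Rightarrow> ('a \<Rightarrow> 'b) \<Rightarrow> bool" where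
  "is_functor C D F \<longleftrightarrow>
     (\<forall>f \<in> Arr C. F f \<in> Arr D \<and> Dom D (F f) = F (Dom C f) \<and> Cod D (F f) = F (Cod C f)) \<and>
     (\<forall>f \<in> Arr C. \<forall>g \<in> Arr C. Dom C g = Cod C f \<longrightarrow> F (Comp C g f) = Comp D (F g) (F f))"

definition reflects_isos :: "'a cat \<Rightarrow> 'b cat \<Rightarrow> ('a \<Rightarrow> 'b) \<Rightarrow> bool" where
  "reflects_isos C D F \<longleftrightarrow> (\<forall>f \<in> Arr C. is_iso D (F f) \<longrightarrow> is_iso C f)"

text \<open>A finite diagram is given by a finite graph with vertex set \<open>V\<close>; an element \<open>(v, f, w)\<close>
  of \<open>E\<close> is an edge from \<open>v\<close> to \<open>w\<close> labelled by an arrow \<open>f\<close> from \<open>D v\<close> to \<open>D w\<close>.\<close>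

definition finite_diagram :: "'a cat \<Rightarrow> nat set \<Rightarrow> (nat \<Rightarrow> 'a) \<Rightarrow> (nat \<times> 'a \<times> nat) set \<Rightarrow> bool" where
  "finite_diagram C V D E \<longleftrightarrow> finite V \<and> finite E \<and> (\<forall>v \<in> V. D v \<in> Obj C) \<and>
     (\<forall>(v, f, w) \<in> E. v \<in> V \<and> w \<in> V \<and> f \<in> Hom C (D v) (D w))"

definition cone ::
  "'a cat \<Rightarrow> nat set \<Rightarrow> (nat \<Rightarrow> 'a) \<Rightarrow> (nat \<times> 'a \<times> nat) set \<Rightarrow> 'a \<Rightarrow> (nat \<Rightarrow> 'a) \<Rightarrow> bool" where
  "cone C V D E X \<pi> \<longleftrightarrow> X \<in> Obj C \<and> (\<forall>v \<in> V. \<pi> v \<in> Hom C X (D v)) \<and>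
     (\<forall>(v, f, w) \<in> E. Comp C f (\<pi> v) = \<pi> w)"

definition limit_cone ::
  "'a cat \<Rightarrow> nat set \<Rightarrow> (nat \<Rightarrow> 'a) \<Rightarrow> (nat \<times> 'a \<times> nat) set \<Rightarrow> 'a \<Rightarrow> (nat \<Rightarrow> 'a) \<Rightarrow> bool" where
  "limit_cone C V D E X \<pi> \<longleftrightarrow> cone C V D E X \<pi> \<and>
     (\<forall>Y \<rho>. cone C V D E Y \<rho> \<longrightarrow> (\<exists>!h. h \<in> Hom C Y X \<and> (\<forall>v \<in> V. Comp C (\<pi> v) h = \<rho> v)))"

definition finitely_complete :: "'a cat \<Rightarrow> bool" where
  "finitely_complete C \<longleftrightarrow> (\<forall>V D E. finite_diagram C V D E \<longrightarrow> (\<exists>X \<pi>. limit_cone C V D E X \<pi>))"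

definition pullback :: "'a cat \<Rightarrow> 'a \<Rightarrow> 'a \<Rightarrow> 'a \<Rightarrow> 'a \<Rightarrow> bool" where
  "pullback C f g p q \<longleftrightarrow> f \<in> Arr C \<and> g \<in> Arr C \<and> Cod C f = Cod C g \<and>
     p \<in> Hom C (Dom C p) (Dom C f) \<and> q \<in> Hom C (Dom C p) (Dom C g) \<and> Comp C f p = Comp C g q \<and>
     (\<forall>X. \<forall>a \<in> Hom C X (Dom C f). \<forall>b \<in> Hom C X (Dom C g). Comp C f a = Comp C g b \<longrightarrow>
        (\<exists>!h. h \<in> Hom C X (Dom C p) \<and> Comp C p h = a \<and> Comp C q h = b))"

definition points :: "'a cat \<Rightarrow> 'a \<Rightarrow> ('a \<times> 'a) set" where
  "points C B = {(p, s). \<exists>A. p \<in> Hom C A B \<and> s \<in> Hom C B A \<and> Comp C p s = B}"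

text \<open>The fibre over \<open>B\<close> of the fibration of points.\<close>

definition Pt :: "'a cat \<Rightarrow> 'a \<Rightarrow> (('a \<times> 'a) \<times> 'a \<times> ('a \<times> 'a)) cat" where
  "Pt C B = \<lparr>
     Arr = {((p, s), f, (p', s')). (p, s) \<in> points C B \<and> (p', s') \<in> points C B \<and>
              f \<in> Hom C (Dom C p) (Dom C p') \<and> Comp C p' f = p \<and> Comp C f s = s'},
     Dom = (\<lambda>(X, f, Y). (X, Dom C f, X)),
     Cod = (\<lambda>(X, f, Y). (Y, Cod C f, Y)),
     Comp = (\<lambda>(Y, g, Z) (X, f, Y'). (X, Comp C g f, Z))\<rparr>"

text \<open>Inverse image functors along \<open>v\<close> depend on a choice of pullbacks. A functor is one of them
  iff it arises from some choice, \<open>\<kappa> X\<close> being the projection from the pullback of the point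
  \<open>X\<close> along \<open>v\<close> to the domain of \<open>X\<close>.\<close>

definition inverse_image_functor ::
  "'a cat \<Rightarrow> 'a \<Rightarrow> (('a \<times> 'a) \<times> 'a \<times> ('a \<times> 'a) \<Rightarrow> ('a \<times> 'a) \<times> 'a \<times> ('a \<times> 'a)) \<Rightarrow> bool" where
  "inverse_image_functor C v F \<longleftrightarrow>
     is_functor (Pt C (Cod C v)) (Pt C (Dom C v)) F \<and>
     (\<exists>\<kappa>. \<forall>p s f p' s' q t g q' t'.
        ((p, s), f, (p', s')) \<in> Arr (Pt C (Cod C v)) \<and>
        F ((p, s), f, (p', s')) = ((q, t), g, (q', t')) \<longrightarrow>
          pullback C p v (\<kappa> (p, s)) q \<and>
          Comp C (\<kappa> (p, s)) t = Comp C s v \<and>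
          Comp C (\<kappa> (p', s')) g = Comp C f (\<kappa> (p, s)))"

definition protomodular :: "'a cat \<Rightarrow> bool" where
  "protomodular C \<longleftrightarrow> category C \<and>
     (\<forall>v \<in> Arr C. \<forall>(p, s) \<in> points C (Cod C v). \<exists>k q. pullback C p v k q) \<and>
     (\<forall>v \<in> Arr C. \<forall>F. inverse_image_functor C v F \<longrightarrow>
        reflects_isos (Pt C (Cod C v)) (Pt C (Dom C v)) F)"

record 'a monoidal =
  Tensor :: "'a \<Rightarrow> 'a \<Rightarrow> 'a" (infix "\<otimes>\<index>" 70)
  Unit :: 'a ("\<one>\<index>")
  Assoc :: "'a \<Rightarrow> 'a \<Rightarrow> 'a \<Rightarrow> 'a"
  LUnit :: "'a \<Rightarrow> 'a"
  RUnit :: "'a \<Rightarrow> 'a"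

locale monoidal_category = category C for C :: "'a cat" +
  fixes M :: "'a monoidal" (structure)
  assumes tensor_hom: "\<lbrakk>f \<in> Hom C X Y; g \<in> Hom C Z T\<rbrakk> \<Longrightarrow> f \<otimes> g \<in> Hom C (X \<otimes> Z) (Y \<otimes> T)"
    and interchange: "\<lbrakk>f \<in> Hom C X Y; g \<in> Hom C Y Z; f' \<in> Hom C X' Y'; g' \<in> Hom C Y' Z'\<rbrakk>
      \<Longrightarrow> Comp C g f \<otimes> Comp C g' f' = Comp C (g \<otimes> g') (f \<otimes> f')"
    and unit_obj: "\<one> \<in> Obj C"
    and assoc_hom: "\<lbrakk>X \<in> Obj C; Y \<in> Obj C; Z \<in> Obj C\<rbrakk>
      \<Longrightarrow> Assoc M X Y Z \<in> Hom C ((X \<otimes> Y) \<otimes> Z) (X \<otimes> (Y \<otimes> Z))"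
    and assoc_iso: "\<lbrakk>X \<in> Obj C; Y \<in> Obj C; Z \<in> Obj C\<rbrakk> \<Longrightarrow> is_iso C (Assoc M X Y Z)"
    and assoc_natural: "\<lbrakk>f \<in> Hom C X X'; g \<in> Hom C Y Y'; h \<in> Hom C Z Z'\<rbrakk>
      \<Longrightarrow> Comp C (Assoc M X' Y' Z') ((f \<otimes> g) \<otimes> h) = Comp C (f \<otimes> (g \<otimes> h)) (Assoc M X Y Z)"
    and lunit_hom: "X \<in> Obj C \<Longrightarrow> LUnit M X \<in> Hom C (\<one> \<otimes> X) X"
    and lunit_iso: "X \<in> Obj C \<Longrightarrow> is_iso C (LUnit M X)"
    and lunit_natural: "f \<in> Hom C X Y \<Longrightarrow> Comp C (LUnit M Y) (\<one> \<otimes> f) = Comp C f (LUnit M X)"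
    and runit_hom: "X \<in> Obj C \<Longrightarrow> RUnit M X \<in> Hom C (X \<otimes> \<one>) X"
    and runit_iso: "X \<in> Obj C \<Longrightarrow> is_iso C (RUnit M X)"
    and runit_natural: "f \<in> Hom C X Y \<Longrightarrow> Comp C (RUnit M Y) (f \<otimes> \<one>) = Comp C f (RUnit M X)"
    and pentagon: "\<lbrakk>X \<in> Obj C; Y \<in> Obj C; Z \<in> Obj C; T \<in> Obj C\<rbrakk>
      \<Longrightarrow> Comp C (X \<otimes> Assoc M Y Z T) (Comp C (Assoc M X (Y \<otimes> Z) T) (Assoc M X Y Z \<otimes> T))
        = Comp C (Assoc M X Y (Z \<otimes> T)) (Assoc M (X \<otimes> Y) Z T)"
    and triangle: "\<lbrakk>X \<in> Obj C; Y \<in> Obj C\<rbrakk>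
      \<Longrightarrow> Comp C (X \<otimes> LUnit M Y) (Assoc M X \<one> Y) = RUnit M X \<otimes> Y"

definition reverse_monoidal :: "'a cat \<Rightarrow> 'a monoidal \<Rightarrow> 'a monoidal" where
  "reverse_monoidal C M = \<lparr>
     Tensor = (\<lambda>f g. Tensor M g f),
     Unit = Unit M,
     Assoc = (\<lambda>X Y Z. inverse_of C (Assoc M Z Y X)),
     LUnit = RUnit M,
     RUnit = LUnit M\<rparr>"

text \<open>\<open>M\<close> is the source and \<open>N\<close> the target monoidal structure.\<close>

definition lax_monoidal_functor ::
  "'a cat \<Rightarrow> 'a monoidal \<Rightarrow> 'a monoidal \<Rightarrow> ('a \<Rightarrow> 'a) \<Rightarrow> ('a \<Rightarrow> 'a \<Rightarrow> 'a) \<Rightarrow> 'a \<Rightarrow> bool" where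
  "lax_monoidal_functor C M N F \<phi> \<phi>\<^sub>0 \<longleftrightarrow>
     is_functor C C F \<and>
     \<phi>\<^sub>0 \<in> Hom C (Unit N) (F (Unit M)) \<and>
     (\<forall>X \<in> Obj C. \<forall>Y \<in> Obj C. \<phi> X Y \<in> Hom C (Tensor N (F X) (F Y)) (F (Tensor M X Y))) \<and>
     (\<forall>X X' Y Y'. \<forall>f \<in> Hom C X X'. \<forall>g \<in> Hom C Y Y'.
        Comp C (\<phi> X' Y') (Tensor N (F f) (F g)) = Comp C (F (Tensor M f g)) (\<phi> X Y)) \<and>
     (\<forall>X \<in> Obj C. \<forall>Y \<in> Obj C. \<forall>Z \<in> Obj C.
        Comp C (F (Assoc M X Y Z)) (Comp C (\<phi> (Tensor M X Y) Z) (Tensor N (\<phi> X Y) (F Z)))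
      = Comp C (\<phi> X (Tensor M Y Z)) (Comp C (Tensor N (F X) (\<phi> Y Z)) (Assoc N (F X) (F Y) (F Z)))) \<and>
     (\<forall>X \<in> Obj C.
        Comp C (F (LUnit M X)) (Comp C (\<phi> (Unit M) X) (Tensor N \<phi>\<^sub>0 (F X))) = LUnit N (F X)) \<and>
     (\<forall>X \<in> Obj C.
        Comp C (F (RUnit M X)) (Comp C (\<phi> X (Unit M)) (Tensor N (F X) \<phi>\<^sub>0)) = RUnit N (F X))"

definition is_monoid :: "'a cat \<Rightarrow> 'a monoidal \<Rightarrow> 'a \<Rightarrow> 'a \<Rightarrow> 'a \<Rightarrow> bool" where
  "is_monoid C M H m u \<longleftrightarrow> H \<in> Obj C \<and>
     m \<in> Hom C (Tensor M H H) H \<and> u \<in> Hom C (Unit M) H \<and>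
     Comp C m (Tensor M m H) = Comp C m (Comp C (Tensor M H m) (Assoc M H H H)) \<and>
     Comp C m (Tensor M u H) = LUnit M H \<and>
     Comp C m (Tensor M H u) = RUnit M H"

definition is_comonoid :: "'a cat \<Rightarrow> 'a monoidal \<Rightarrow> 'a \<Rightarrow> 'a \<Rightarrow> 'a \<Rightarrow> bool" where
  "is_comonoid C M H d e \<longleftrightarrow> H \<in> Obj C \<and>
     d \<in> Hom C H (Tensor M H H) \<and> e \<in> Hom C H (Unit M) \<and>
     Comp C (Assoc M H H H) (Comp C (Tensor M d H) d) = Comp C (Tensor M H d) d \<and>
     Comp C (LUnit M H) (Comp C (Tensor M e H) d) = H \<and>
     Comp C (RUnit M H) (Comp C (Tensor M H e) d) = H"

text \<open>\<open>EpsI\<close> is the common value of the counit of \<open>I\<close> and the unit of \<open>J\<close>.\<close>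

record 'a duoidal =
  Circ :: "'a monoidal"
  Bul :: "'a monoidal"
  Zeta :: "'a \<Rightarrow> 'a \<Rightarrow> 'a \<Rightarrow> 'a \<Rightarrow> 'a"
  DeltaI :: 'a
  MultJ :: 'a
  EpsI :: 'a

locale duoidal_data =
  fixes C :: "'a cat" and D :: "'a duoidal"
begin

abbreviation comp (infixr "\<cdot>" 55) where "g \<cdot> f \<equiv> Comp C g f"
abbreviation inverse_arr ("_\<^sup>\<inverse>" [1000] 999) where "f\<^sup>\<inverse> \<equiv> inverse_of C f"

abbreviation circ (infix "\<odot>" 70) where "f \<odot> g \<equiv> Tensor (Circ D) f g"
abbreviation circ_unit ("\<I>") where "\<I> \<equiv> Unit (Circ D)"
abbreviation circ_assoc ("\<a>\<^sup>\<circ>") where "\<a>\<^sup>\<circ> \<equiv> Assoc (Circ D)"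
abbreviation circ_lunit ("\<l>\<^sup>\<circ>") where "\<l>\<^sup>\<circ> \<equiv> LUnit (Circ D)"
abbreviation circ_runit ("\<r>\<^sup>\<circ>") where "\<r>\<^sup>\<circ> \<equiv> RUnit (Circ D)"

abbreviation bul (infix "\<bullet>" 70) where "f \<bullet> g \<equiv> Tensor (Bul D) f g"
abbreviation bul_unit ("\<J>") where "\<J> \<equiv> Unit (Bul D)"
abbreviation bul_assoc ("\<a>\<^sup>\<bullet>") where "\<a>\<^sup>\<bullet> \<equiv> Assoc (Bul D)"
abbreviation bul_lunit ("\<l>\<^sup>\<bullet>") where "\<l>\<^sup>\<bullet> \<equiv> LUnit (Bul D)"
abbreviation bul_runit ("\<r>\<^sup>\<bullet>") where "\<r>\<^sup>\<bullet> \<equiv> RUnit (Bul D)"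

abbreviation zeta ("\<zeta>") where "\<zeta> \<equiv> Zeta D"
abbreviation Delta_I ("\<Delta>\<^sub>I") where "\<Delta>\<^sub>I \<equiv> DeltaI D"
abbreviation mult_J ("\<mu>\<^sub>J") where "\<mu>\<^sub>J \<equiv> MultJ D"
abbreviation eps_I ("\<epsilon>\<^sub>I") where "\<epsilon>\<^sub>I \<equiv> EpsI D"
abbreviation Delta_J ("\<Delta>\<^sub>J") where "\<Delta>\<^sub>J \<equiv> (\<l>\<^sup>\<bullet> \<J>)\<^sup>\<inverse>"

end

locale duoidal_category =
  duoidal_data C D + circ: monoidal_category C "Circ D" + bul: monoidal_category C "Bul D"
  for C :: "'a cat" and D :: "'a duoidal" +
  assumes zeta_hom: "\<lbrakk>X \<in> Obj C; Y \<in> Obj C; Z \<in> Obj C; T \<in> Obj C\<rbrakk>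
      \<Longrightarrow> \<zeta> X Y Z T \<in> Hom C ((X \<bullet> Y) \<odot> (Z \<bullet> T)) ((X \<odot> Z) \<bullet> (Y \<odot> T))"
    and zeta_natural: "\<lbrakk>f \<in> Hom C X X'; g \<in> Hom C Y Y'; h \<in> Hom C Z Z'; k \<in> Hom C T T'\<rbrakk>
      \<Longrightarrow> \<zeta> X' Y' Z' T' \<cdot> ((f \<bullet> g) \<odot> (h \<bullet> k)) = ((f \<odot> h) \<bullet> (g \<odot> k)) \<cdot> \<zeta> X Y Z T"
    and J_monoid: "is_monoid C (Circ D) \<J> \<mu>\<^sub>J \<epsilon>\<^sub>I"
    and I_comonoid: "is_comonoid C (Bul D) \<I> \<Delta>\<^sub>I \<epsilon>\<^sub>I"
    and zeta_circ_assoc: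
      "\<lbrakk>X \<in> Obj C; Y \<in> Obj C; Z \<in> Obj C; T \<in> Obj C; U \<in> Obj C; V \<in> Obj C\<rbrakk> \<Longrightarrow>
         (\<a>\<^sup>\<circ> X Z U \<bullet> \<a>\<^sup>\<circ> Y T V) \<cdot> \<zeta> (X \<odot> Z) (Y \<odot> T) U V \<cdot> (\<zeta> X Y Z T \<odot> (U \<bullet> V))
       = \<zeta> X Y (Z \<odot> U) (T \<odot> V) \<cdot> ((X \<bullet> Y) \<odot> \<zeta> Z T U V) \<cdot> \<a>\<^sup>\<circ> (X \<bullet> Y) (Z \<bullet> T) (U \<bullet> V)"
    and zeta_bul_assoc:
      "\<lbrakk>X \<in> Obj C; Y \<in> Obj C; Z \<in> Obj C; T \<in> Obj C; U \<in> Obj C; V \<in> Obj C\<rbrakk> \<Longrightarrow>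
         \<a>\<^sup>\<bullet> (X \<odot> T) (Y \<odot> U) (Z \<odot> V) \<cdot> (\<zeta> X Y T U \<bullet> (Z \<odot> V)) \<cdot> \<zeta> (X \<bullet> Y) Z (T \<bullet> U) V
       = ((X \<odot> T) \<bullet> \<zeta> Y Z U V) \<cdot> \<zeta> X (Y \<bullet> Z) T (U \<bullet> V) \<cdot> (\<a>\<^sup>\<bullet> X Y Z \<odot> \<a>\<^sup>\<bullet> T U V)"
    and zeta_circ_lunit: "\<lbrakk>X \<in> Obj C; Y \<in> Obj C\<rbrakk> \<Longrightarrow>
        (\<l>\<^sup>\<circ> X \<bullet> \<l>\<^sup>\<circ> Y) \<cdot> \<zeta> \<I> \<I> X Y \<cdot> (\<Delta>\<^sub>I \<odot> (X \<bullet> Y)) = \<l>\<^sup>\<circ> (X \<bullet> Y)"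
    and zeta_circ_runit: "\<lbrakk>X \<in> Obj C; Y \<in> Obj C\<rbrakk> \<Longrightarrow>
        (\<r>\<^sup>\<circ> X \<bullet> \<r>\<^sup>\<circ> Y) \<cdot> \<zeta> X Y \<I> \<I> \<cdot> ((X \<bullet> Y) \<odot> \<Delta>\<^sub>I) = \<r>\<^sup>\<circ> (X \<bullet> Y)"
    and zeta_bul_lunit: "\<lbrakk>X \<in> Obj C; Y \<in> Obj C\<rbrakk> \<Longrightarrow>
        \<l>\<^sup>\<bullet> (X \<odot> Y) \<cdot> (\<mu>\<^sub>J \<bullet> (X \<odot> Y)) \<cdot> \<zeta> \<J> X \<J> Y = \<l>\<^sup>\<bullet> X \<odot> \<l>\<^sup>\<bullet> Y"
    and zeta_bul_runit: "\<lbrakk>X \<in> Obj C; Y \<in> Obj C\<rbrakk> \<Longrightarrow>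
        \<r>\<^sup>\<bullet> (X \<odot> Y) \<cdot> ((X \<odot> Y) \<bullet> \<mu>\<^sub>J) \<cdot> \<zeta> X \<J> Y \<J> = \<r>\<^sup>\<bullet> X \<odot> \<r>\<^sup>\<bullet> Y"

record 'a bimonoid =
  Under :: 'a
  Mult :: 'a
  One :: 'a
  Comult :: 'a
  Counit :: 'a

context duoidal_data
begin

definition bimonoid :: "'a bimonoid \<Rightarrow> bool" where
  "bimonoid H \<longleftrightarrow>
     is_monoid C (Circ D) (Under H) (Mult H) (One H) \<and>
     is_comonoid C (Bul D) (Under H) (Comult H) (Counit H) \<and>
     Comult H \<cdot> Mult H = (Mult H \<bullet> Mult H) \<cdot> \<zeta> (Under H) (Under H) (Under H) (Under H)
       \<cdot> (Comult H \<odot> Comult H) \<and>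
     Counit H \<cdot> Mult H = \<mu>\<^sub>J \<cdot> (Counit H \<odot> Counit H) \<and>
     Comult H \<cdot> One H = (One H \<bullet> One H) \<cdot> \<Delta>\<^sub>I \<and>
     Counit H \<cdot> One H = \<epsilon>\<^sub>I"

definition bimonoid_morphism :: "'a bimonoid \<Rightarrow> 'a \<Rightarrow> 'a bimonoid \<Rightarrow> bool" where
  "bimonoid_morphism H f K \<longleftrightarrow>
     f \<in> Hom C (Under H) (Under K) \<and>
     f \<cdot> Mult H = Mult K \<cdot> (f \<odot> f) \<and> f \<cdot> One H = One K \<and>
     Comult K \<cdot> f = (f \<bullet> f) \<cdot> Comult H \<and> Counit K \<cdot> f = Counit H"

end

record 'a reversion =
  Rev :: "'a \<Rightarrow> 'a"
  PhiCirc :: "'a \<Rightarrow> 'a \<Rightarrow> 'a"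
  PhiCirc0 :: 'a
  PhiBul :: "'a \<Rightarrow> 'a \<Rightarrow> 'a"
  PhiBul0 :: 'a
  Gamma :: "'a \<Rightarrow> 'a \<Rightarrow> 'a \<Rightarrow> 'a \<Rightarrow> 'a"
  Delta :: "'a \<Rightarrow> 'a \<Rightarrow> 'a \<Rightarrow> 'a \<Rightarrow> 'a"
  GammaTilde :: "'a \<Rightarrow> 'a \<Rightarrow> 'a \<Rightarrow> 'a \<Rightarrow> 'a"
  DeltaTilde :: "'a \<Rightarrow> 'a \<Rightarrow> 'a \<Rightarrow> 'a \<Rightarrow> 'a"

locale reversion_data = duoidal_data C D
  for C :: "'a cat" and D :: "'a duoidal" +
  fixes R :: "'a reversion"
begin

abbreviation rev_arr ("_\<^sup>-" [1000] 999) where "f\<^sup>- \<equiv> Rev R f"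
abbreviation phi_circ ("\<phi>\<^sup>\<circ>") where "\<phi>\<^sup>\<circ> \<equiv> PhiCirc R"
abbreviation phi_circ0 ("\<phi>\<^sup>\<circ>\<^sub>0") where "\<phi>\<^sup>\<circ>\<^sub>0 \<equiv> PhiCirc0 R"
abbreviation phi_bul ("\<phi>\<^sup>\<bullet>") where "\<phi>\<^sup>\<bullet> \<equiv> PhiBul R"
abbreviation phi_bul0 ("\<phi>\<^sup>\<bullet>\<^sub>0") where "\<phi>\<^sup>\<bullet>\<^sub>0 \<equiv> PhiBul0 R"
abbreviation gamma ("\<gamma>") where "\<gamma> \<equiv> Gamma R"
abbreviation delta ("\<delta>") where "\<delta> \<equiv> Delta R"
abbreviation gamma_tilde ("\<gamma>\<^sup>~") where "\<gamma>\<^sup>~ \<equiv> GammaTilde R"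
abbreviation delta_tilde ("\<delta>\<^sup>~") where "\<delta>\<^sup>~ \<equiv> DeltaTilde R"

definition psi ("\<psi>") where
  "\<psi> X Y = \<gamma> \<J> X \<I> Y \<cdot> (((\<l>\<^sup>\<bullet> (X\<^sup>-))\<^sup>\<inverse> \<odot> \<I>) \<bullet> Y) \<cdot> ((\<r>\<^sup>\<circ> (X\<^sup>-))\<^sup>\<inverse> \<bullet> Y)"

definition phi ("\<phi>") where
  "\<phi> X Y = \<delta> X \<I> Y \<J> \<cdot> (X \<bullet> (\<I> \<odot> (\<r>\<^sup>\<bullet> (Y\<^sup>-))\<^sup>\<inverse>)) \<cdot> (X \<bullet> (\<l>\<^sup>\<circ> (Y\<^sup>-))\<^sup>\<inverse>)"

definition psi_tilde ("\<psi>\<^sup>~") where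
  "\<psi>\<^sup>~ X Y = \<l>\<^sup>\<circ> ((X \<odot> Y)\<^sup>-) \<cdot> (\<I> \<odot> \<r>\<^sup>\<bullet> ((X \<odot> Y)\<^sup>-)) \<cdot> \<gamma>\<^sup>~ X Y \<I> \<J>"

definition phi_tilde ("\<phi>\<^sup>~") where
  "\<phi>\<^sup>~ X Y = \<r>\<^sup>\<circ> ((X \<odot> Y)\<^sup>-) \<cdot> (\<l>\<^sup>\<bullet> ((X \<odot> Y)\<^sup>-) \<odot> \<I>) \<cdot> \<delta>\<^sup>~ \<J> \<I> X Y"

definition antipode :: "'a bimonoid \<Rightarrow> 'a \<Rightarrow> bool" where
  "antipode H \<Sigma> \<longleftrightarrow> \<Sigma> \<in> Hom C (Under H) ((Under H)\<^sup>-) \<and>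
     ((Mult H \<bullet> \<I>) \<odot> \<J>) \<cdot> \<phi> (Under H) (Under H) \<cdot> (Under H \<bullet> \<Sigma>) \<cdot> Comult H
       = ((One H \<bullet> \<I>) \<odot> \<J>) \<cdot> (\<Delta>\<^sub>I \<odot> \<J>) \<cdot> (\<l>\<^sup>\<circ> \<J>)\<^sup>\<inverse> \<cdot> Counit H \<and>
     (\<J> \<odot> (\<I> \<bullet> Mult H)) \<cdot> \<psi> (Under H) (Under H) \<cdot> (\<Sigma> \<bullet> Under H) \<cdot> Comult H
       = (\<J> \<odot> (\<I> \<bullet> One H)) \<cdot> (\<J> \<odot> \<Delta>\<^sub>I) \<cdot> (\<r>\<^sup>\<circ> \<J>)\<^sup>\<inverse> \<cdot> Counit H"

text \<open>Antipodes are not part of the data of a Hopf monoid, and morphisms need not mention them.\<close>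

definition hopf_monoid :: "'a bimonoid \<Rightarrow> bool" where
  "hopf_monoid H \<longleftrightarrow> bimonoid H \<and> (\<exists>\<Sigma>. antipode H \<Sigma>)"

definition hopf_category :: "('a bimonoid \<times> 'a \<times> 'a bimonoid) cat" where
  "hopf_category = \<lparr>
     Arr = {(H, f, K). hopf_monoid H \<and> hopf_monoid K \<and> bimonoid_morphism H f K},
     Dom = (\<lambda>(H, f, K). (H, Under H, H)),
     Cod = (\<lambda>(H, f, K). (K, Under K, K)),
     Comp = (\<lambda>(K, g, L) (H, f, K'). (H, g \<cdot> f, L))\<rparr>"

end

locale reversion = reversion_data C D R + duoidal_category C D
  for C :: "'a cat" and D :: "'a duoidal" and R :: "'a reversion" +
  assumes phi_circ_lax:
      "lax_monoidal_functor C (reverse_monoidal C (Circ D)) (Circ D) (Rev R) \<phi>\<^sup>\<circ> \<phi>\<^sup>\<circ>\<^sub>0"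
    and phi_bul_lax:
      "lax_monoidal_functor C (reverse_monoidal C (Bul D)) (Bul D) (Rev R) \<phi>\<^sup>\<bullet> \<phi>\<^sup>\<bullet>\<^sub>0"
    and double_lax_zeta: "\<lbrakk>X \<in> Obj C; Y \<in> Obj C; Z \<in> Obj C; T \<in> Obj C\<rbrakk> \<Longrightarrow>
        \<phi>\<^sup>\<bullet> (Z \<odot> X) (T \<odot> Y) \<cdot> (\<phi>\<^sup>\<circ> X Z \<bullet> \<phi>\<^sup>\<circ> Y T) \<cdot> \<zeta> (X\<^sup>-) (Y\<^sup>-) (Z\<^sup>-) (T\<^sup>-)
      = (\<zeta> T Z Y X)\<^sup>- \<cdot> \<phi>\<^sup>\<circ> (Y \<bullet> X) (T \<bullet> Z) \<cdot> (\<phi>\<^sup>\<bullet> X Y \<odot> \<phi>\<^sup>\<bullet> Z T)"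
    and double_lax_Delta: "\<phi>\<^sup>\<bullet> \<I> \<I> \<cdot> (\<phi>\<^sup>\<circ>\<^sub>0 \<bullet> \<phi>\<^sup>\<circ>\<^sub>0) \<cdot> \<Delta>\<^sub>I = \<Delta>\<^sub>I\<^sup>- \<cdot> \<phi>\<^sup>\<circ>\<^sub>0"
    and double_lax_mult: "\<mu>\<^sub>J\<^sup>- \<cdot> \<phi>\<^sup>\<circ> \<J> \<J> \<cdot> (\<phi>\<^sup>\<bullet>\<^sub>0 \<odot> \<phi>\<^sup>\<bullet>\<^sub>0) = \<phi>\<^sup>\<bullet>\<^sub>0 \<cdot> \<mu>\<^sub>J"
    and double_lax_eps: "\<phi>\<^sup>\<bullet>\<^sub>0 \<cdot> \<epsilon>\<^sub>I = \<epsilon>\<^sub>I\<^sup>- \<cdot> \<phi>\<^sup>\<circ>\<^sub>0"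
    and gamma_hom: "\<lbrakk>X \<in> Obj C; Y \<in> Obj C; Z \<in> Obj C; T \<in> Obj C\<rbrakk> \<Longrightarrow>
        \<gamma> X Y Z T \<in> Hom C (((X \<bullet> Y\<^sup>-) \<odot> Z) \<bullet> T) (X \<odot> (Z \<bullet> (Y \<odot> T)))"
    and gamma_natural: "\<lbrakk>f \<in> Hom C X X'; g \<in> Hom C Y Y'; h \<in> Hom C Z Z'; k \<in> Hom C T T'\<rbrakk> \<Longrightarrow>
        \<gamma> X' Y' Z' T' \<cdot> (((f \<bullet> g\<^sup>-) \<odot> h) \<bullet> k) = (f \<odot> (h \<bullet> (g \<odot> k))) \<cdot> \<gamma> X Y Z T"
    and delta_hom: "\<lbrakk>X \<in> Obj C; Y \<in> Obj C; Z \<in> Obj C; T \<in> Obj C\<rbrakk> \<Longrightarrow>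
        \<delta> X Y Z T \<in> Hom C (X \<bullet> (Y \<odot> (Z\<^sup>- \<bullet> T))) (((X \<odot> Z) \<bullet> Y) \<odot> T)"
    and delta_natural: "\<lbrakk>f \<in> Hom C X X'; g \<in> Hom C Y Y'; h \<in> Hom C Z Z'; k \<in> Hom C T T'\<rbrakk> \<Longrightarrow>
        \<delta> X' Y' Z' T' \<cdot> (f \<bullet> (g \<odot> (h\<^sup>- \<bullet> k))) = (((f \<odot> h) \<bullet> g) \<odot> k) \<cdot> \<delta> X Y Z T"
    and gamma_tilde_hom: "\<lbrakk>X \<in> Obj C; Y \<in> Obj C; Z \<in> Obj C; T \<in> Obj C\<rbrakk> \<Longrightarrow>
        \<gamma>\<^sup>~ X Y Z T \<in> Hom C (X\<^sup>- \<bullet> ((Y \<bullet> Z) \<odot> T)) (Z \<odot> ((X \<odot> Y)\<^sup>- \<bullet> T))"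
    and gamma_tilde_natural: "\<lbrakk>f \<in> Hom C X X'; g \<in> Hom C Y Y'; h \<in> Hom C Z Z'; k \<in> Hom C T T'\<rbrakk> \<Longrightarrow>
        \<gamma>\<^sup>~ X' Y' Z' T' \<cdot> (f\<^sup>- \<bullet> ((g \<bullet> h) \<odot> k)) = (h \<odot> ((f \<odot> g)\<^sup>- \<bullet> k)) \<cdot> \<gamma>\<^sup>~ X Y Z T"
    and delta_tilde_hom: "\<lbrakk>X \<in> Obj C; Y \<in> Obj C; Z \<in> Obj C; T \<in> Obj C\<rbrakk> \<Longrightarrow>
        \<delta>\<^sup>~ X Y Z T \<in> Hom C ((X \<odot> (Y \<bullet> Z)) \<bullet> T\<^sup>-) ((X \<bullet> (Z \<odot> T)\<^sup>-) \<odot> Y)"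
    and delta_tilde_natural: "\<lbrakk>f \<in> Hom C X X'; g \<in> Hom C Y Y'; h \<in> Hom C Z Z'; k \<in> Hom C T T'\<rbrakk> \<Longrightarrow>
        \<delta>\<^sup>~ X' Y' Z' T' \<cdot> ((f \<odot> (g \<bullet> h)) \<bullet> k\<^sup>-) = ((f \<bullet> (h \<odot> k)\<^sup>-) \<odot> g) \<cdot> \<delta>\<^sup>~ X Y Z T"
    and R1: "\<lbrakk>X \<in> Obj C; Y \<in> Obj C; Z \<in> Obj C; T \<in> Obj C; U \<in> Obj C; V \<in> Obj C\<rbrakk> \<Longrightarrow>
        \<gamma> X Y (Z \<odot> U) (T \<odot> V) \<cdot> (\<a>\<^sup>\<circ> (X \<bullet> Y\<^sup>-) Z U \<bullet> (T \<odot> V)) \<cdot> \<zeta> ((X \<bullet> Y\<^sup>-) \<odot> Z) T U V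
      = (X \<odot> ((Z \<odot> U) \<bullet> \<a>\<^sup>\<circ> Y T V)) \<cdot> (X \<odot> \<zeta> Z (Y \<odot> T) U V)
          \<cdot> \<a>\<^sup>\<circ> X (Z \<bullet> (Y \<odot> T)) (U \<bullet> V) \<cdot> (\<gamma> X Y Z T \<odot> (U \<bullet> V))"
    and R2: "\<lbrakk>X \<in> Obj C; Y \<in> Obj C; Z \<in> Obj C; T \<in> Obj C; U \<in> Obj C; V \<in> Obj C\<rbrakk> \<Longrightarrow>
        ((X \<odot> T) \<bullet> \<gamma> Y Z U V) \<cdot> \<a>\<^sup>\<bullet> (X \<odot> T) ((Y \<bullet> Z\<^sup>-) \<odot> U) V \<cdot> (\<zeta> X (Y \<bullet> Z\<^sup>-) T U \<bullet> V)
          \<cdot> ((\<a>\<^sup>\<bullet> X Y (Z\<^sup>-) \<odot> (T \<bullet> U)) \<bullet> V)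
      = \<zeta> X Y T (U \<bullet> (Z \<odot> V)) \<cdot> ((X \<bullet> Y) \<odot> \<a>\<^sup>\<bullet> T U (Z \<odot> V)) \<cdot> \<gamma> (X \<bullet> Y) Z (T \<bullet> U) V"
    and R3: "\<lbrakk>X \<in> Obj C; Y \<in> Obj C; Z \<in> Obj C; T \<in> Obj C; U \<in> Obj C; V \<in> Obj C\<rbrakk> \<Longrightarrow>
        ((\<a>\<^sup>\<circ> X Z U \<bullet> (Y \<odot> T)) \<odot> V) \<cdot> \<delta> (X \<odot> Z) (Y \<odot> T) U V
          \<cdot> ((X \<odot> Z) \<bullet> (\<a>\<^sup>\<circ> Y T (U\<^sup>- \<bullet> V))\<^sup>\<inverse>) \<cdot> \<zeta> X Y Z (T \<odot> (U\<^sup>- \<bullet> V))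
      = (\<zeta> X Y (Z \<odot> U) T \<odot> V) \<cdot> (\<a>\<^sup>\<circ> (X \<bullet> Y) ((Z \<odot> U) \<bullet> T) V)\<^sup>\<inverse> \<cdot> ((X \<bullet> Y) \<odot> \<delta> Z T U V)"
    and R4: "\<lbrakk>X \<in> Obj C; Y \<in> Obj C; Z \<in> Obj C; T \<in> Obj C; U \<in> Obj C; V \<in> Obj C\<rbrakk> \<Longrightarrow>
        (\<delta> X Y T U \<bullet> (Z \<odot> V)) \<cdot> (\<a>\<^sup>\<bullet> X (Y \<odot> (T\<^sup>- \<bullet> U)) (Z \<odot> V))\<^sup>\<inverse>
          \<cdot> (X \<bullet> \<zeta> Y Z (T\<^sup>- \<bullet> U) V) \<cdot> (X \<bullet> ((Y \<bullet> Z) \<odot> (\<a>\<^sup>\<bullet> (T\<^sup>-) U V)\<^sup>\<inverse>))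
      = \<zeta> ((X \<odot> T) \<bullet> Y) Z U V \<cdot> ((\<a>\<^sup>\<bullet> (X \<odot> T) Y Z)\<^sup>\<inverse> \<odot> (U \<bullet> V)) \<cdot> \<delta> X (Y \<bullet> Z) T (U \<bullet> V)"
    and R5: "\<lbrakk>X \<in> Obj C; Y \<in> Obj C; Z \<in> Obj C; T \<in> Obj C; U \<in> Obj C; V \<in> Obj C\<rbrakk> \<Longrightarrow>
        \<delta> X Y T (U \<bullet> (Z \<odot> V)) \<cdot> (X \<bullet> (Y \<odot> \<a>\<^sup>\<bullet> (T\<^sup>-) U (Z \<odot> V))) \<cdot> (X \<bullet> \<gamma> Y Z (T\<^sup>- \<bullet> U) V)
          \<cdot> \<a>\<^sup>\<bullet> X ((Y \<bullet> Z\<^sup>-) \<odot> (T\<^sup>- \<bullet> U)) V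
      = \<gamma> ((X \<odot> T) \<bullet> Y) Z U V \<cdot> (((\<a>\<^sup>\<bullet> (X \<odot> T) Y (Z\<^sup>-))\<^sup>\<inverse> \<odot> U) \<bullet> V) \<cdot> (\<delta> X (Y \<bullet> Z\<^sup>-) T U \<bullet> V)"
    and R6: "\<l>\<^sup>\<circ> (\<I> \<bullet> \<I>) \<cdot> (\<I> \<odot> (\<I> \<bullet> \<l>\<^sup>\<circ> \<I>)) \<cdot> \<gamma> \<I> \<I> \<I> \<I> \<cdot> ((((\<I> \<bullet> \<phi>\<^sup>\<circ>\<^sub>0) \<cdot> \<Delta>\<^sub>I) \<odot> \<I>) \<bullet> \<I>)
      = \<l>\<^sup>\<circ> \<I> \<bullet> \<I>"
    and R7: "\<r>\<^sup>\<circ> (\<I> \<bullet> \<I>) \<cdot> ((\<r>\<^sup>\<circ> \<I> \<bullet> \<I>) \<odot> \<I>) \<cdot> \<delta> \<I> \<I> \<I> \<I> \<cdot> (\<I> \<bullet> (\<I> \<odot> ((\<phi>\<^sup>\<circ>\<^sub>0 \<bullet> \<I>) \<cdot> \<Delta>\<^sub>I)))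
      = \<I> \<bullet> \<r>\<^sup>\<circ> \<I>"
    and R8: "\<lbrakk>X \<in> Obj C; Y \<in> Obj C; Z \<in> Obj C; U \<in> Obj C\<rbrakk> \<Longrightarrow>
        \<gamma> (X \<odot> Z) Y (\<J> \<odot> \<J>) U \<cdot> (\<a>\<^sup>\<circ> ((X \<odot> Z) \<bullet> Y\<^sup>-) \<J> \<J> \<bullet> U)
          \<cdot> ((\<delta> X (Y\<^sup>-) Z \<J> \<odot> \<J>) \<bullet> U) \<cdot> (((X \<bullet> (Y\<^sup>- \<odot> (\<r>\<^sup>\<bullet> (Z\<^sup>-))\<^sup>\<inverse>)) \<odot> \<J>) \<bullet> U)
      = ((X \<odot> Z) \<odot> \<zeta> \<J> Y \<J> U) \<cdot> ((X \<odot> Z) \<odot> ((\<l>\<^sup>\<bullet> Y)\<^sup>\<inverse> \<odot> (\<l>\<^sup>\<bullet> U)\<^sup>\<inverse>))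
          \<cdot> (\<a>\<^sup>\<circ> X Z (Y \<odot> U))\<^sup>\<inverse> \<cdot> (X \<odot> \<a>\<^sup>\<circ> Z Y U) \<cdot> (X \<odot> \<l>\<^sup>\<bullet> ((Z \<odot> Y) \<odot> U))
          \<cdot> \<gamma> X (Z \<odot> Y) \<J> U \<cdot> (((X \<bullet> \<phi>\<^sup>\<circ> Y Z) \<odot> \<J>) \<bullet> U)"
    and R9: "\<lbrakk>X \<in> Obj C; Y \<in> Obj C; Z \<in> Obj C; U \<in> Obj C\<rbrakk> \<Longrightarrow>
        \<delta> X (\<J> \<odot> \<J>) Z (Y \<odot> U) \<cdot> (X \<bullet> (\<a>\<^sup>\<circ> \<J> \<J> (Z\<^sup>- \<bullet> (Y \<odot> U)))\<^sup>\<inverse>)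
          \<cdot> (X \<bullet> (\<J> \<odot> \<gamma> \<J> Y (Z\<^sup>-) U)) \<cdot> (X \<bullet> (\<J> \<odot> (((\<l>\<^sup>\<bullet> (Y\<^sup>-))\<^sup>\<inverse> \<odot> Z\<^sup>-) \<bullet> U)))
      = (\<zeta> X \<J> Z \<J> \<odot> (Y \<odot> U)) \<cdot> (((\<r>\<^sup>\<bullet> X)\<^sup>\<inverse> \<odot> (\<r>\<^sup>\<bullet> Z)\<^sup>\<inverse>) \<odot> (Y \<odot> U))
          \<cdot> \<a>\<^sup>\<circ> (X \<odot> Z) Y U \<cdot> ((\<a>\<^sup>\<circ> X Z Y)\<^sup>\<inverse> \<odot> U) \<cdot> (\<r>\<^sup>\<bullet> (X \<odot> (Z \<odot> Y)) \<odot> U)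
          \<cdot> \<delta> X \<J> (Z \<odot> Y) U \<cdot> (X \<bullet> (\<J> \<odot> (\<phi>\<^sup>\<circ> Y Z \<bullet> U)))"
    and R10: "\<lbrakk>X \<in> Obj C; Y \<in> Obj C; Z \<in> Obj C\<rbrakk> \<Longrightarrow>
        (\<a>\<^sup>\<circ> X Y Z)\<^sup>- \<cdot> \<phi>\<^sup>~ (X \<odot> Y) Z \<cdot> (\<psi> X Y \<bullet> Z\<^sup>-)
      = \<psi>\<^sup>~ X (Y \<odot> Z) \<cdot> (X\<^sup>- \<bullet> \<phi> Y Z) \<cdot> \<a>\<^sup>\<bullet> (X\<^sup>-) Y (Z\<^sup>-)"
    and R11: "X \<in> Obj C \<Longrightarrow>
        (\<r>\<^sup>\<circ> X)\<^sup>- \<cdot> \<l>\<^sup>\<circ> ((X \<odot> \<I>)\<^sup>-) \<cdot> (\<I> \<odot> \<r>\<^sup>\<bullet> ((X \<odot> \<I>)\<^sup>-)) \<cdot> \<gamma>\<^sup>~ X \<I> \<I> \<J> \<cdot> (X\<^sup>- \<bullet> (\<Delta>\<^sub>I \<odot> \<J>))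
      = \<r>\<^sup>\<bullet> (X\<^sup>-) \<cdot> (X\<^sup>- \<bullet> \<l>\<^sup>\<circ> \<J>)"
    and R12: "X \<in> Obj C \<Longrightarrow>
        (\<l>\<^sup>\<circ> X)\<^sup>- \<cdot> \<r>\<^sup>\<circ> ((\<I> \<odot> X)\<^sup>-) \<cdot> (\<l>\<^sup>\<bullet> ((\<I> \<odot> X)\<^sup>-) \<odot> \<I>) \<cdot> \<delta>\<^sup>~ \<J> \<I> \<I> X \<cdot> ((\<J> \<odot> \<Delta>\<^sub>I) \<bullet> X\<^sup>-)
      = \<l>\<^sup>\<bullet> (X\<^sup>-) \<cdot> (\<r>\<^sup>\<circ> \<J> \<bullet> X\<^sup>-)"
    and R13: "\<lbrakk>X \<in> Obj C; Y \<in> Obj C; Z \<in> Obj C; T \<in> Obj C; U \<in> Obj C; V \<in> Obj C\<rbrakk> \<Longrightarrow>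
        (X \<odot> \<a>\<^sup>\<bullet> T (Z \<odot> U) (Y \<odot> V)) \<cdot> \<gamma> X Y (T \<bullet> (Z \<odot> U)) V \<cdot> (\<gamma> (X \<bullet> Y\<^sup>-) Z T U \<bullet> V)
      = (X \<odot> (T \<bullet> \<zeta> Z Y U V)) \<cdot> \<gamma> X (Z \<bullet> Y) T (U \<bullet> V) \<cdot> (((X \<bullet> \<phi>\<^sup>\<bullet> Y Z) \<odot> T) \<bullet> (U \<bullet> V))
          \<cdot> ((\<a>\<^sup>\<bullet> X (Y\<^sup>-) (Z\<^sup>-) \<odot> T) \<bullet> (U \<bullet> V)) \<cdot> \<a>\<^sup>\<bullet> (((X \<bullet> Y\<^sup>-) \<bullet> Z\<^sup>-) \<odot> T) U V"
    and R14: "\<lbrakk>X \<in> Obj C; Y \<in> Obj C; Z \<in> Obj C; T \<in> Obj C; U \<in> Obj C; V \<in> Obj C\<rbrakk> \<Longrightarrow>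
        \<delta> X ((Y \<odot> T) \<bullet> Z) U V \<cdot> (X \<bullet> \<delta> Y Z T (U\<^sup>- \<bullet> V))
      = (\<a>\<^sup>\<bullet> (X \<odot> U) (Y \<odot> T) Z \<odot> V) \<cdot> ((\<zeta> X Y U T \<bullet> Z) \<odot> V) \<cdot> \<delta> (X \<bullet> Y) Z (U \<bullet> T) V
          \<cdot> ((X \<bullet> Y) \<bullet> (Z \<odot> (\<phi>\<^sup>\<bullet> T U \<bullet> V))) \<cdot> ((X \<bullet> Y) \<bullet> (Z \<odot> (\<a>\<^sup>\<bullet> (T\<^sup>-) (U\<^sup>-) V)\<^sup>\<inverse>))
          \<cdot> (\<a>\<^sup>\<bullet> X Y (Z \<odot> (T\<^sup>- \<bullet> (U\<^sup>- \<bullet> V))))\<^sup>\<inverse>"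
    and R15: "\<lbrakk>X \<in> Obj C; Y \<in> Obj C; Z \<in> Obj C; T \<in> Obj C; U \<in> Obj C; V \<in> Obj C\<rbrakk> \<Longrightarrow>
        (X \<odot> \<gamma> Z T U (Y \<odot> V)) \<cdot> \<gamma> X Y ((Z \<bullet> T\<^sup>-) \<odot> U) V \<cdot> (\<a>\<^sup>\<circ> (X \<bullet> Y\<^sup>-) (Z \<bullet> T\<^sup>-) U \<bullet> V)
      = \<a>\<^sup>\<circ> X Z (U \<bullet> (T \<odot> (Y \<odot> V))) \<cdot> ((X \<odot> Z) \<odot> (U \<bullet> \<a>\<^sup>\<circ> T Y V))
          \<cdot> \<gamma> (X \<odot> Z) (T \<odot> Y) U V \<cdot> ((((X \<odot> Z) \<bullet> \<phi>\<^sup>\<circ> Y T) \<odot> U) \<bullet> V)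
          \<cdot> ((\<zeta> X (Y\<^sup>-) Z (T\<^sup>-) \<odot> U) \<bullet> V)"
    and R16: "\<lbrakk>X \<in> Obj C; Y \<in> Obj C; Z \<in> Obj C; T \<in> Obj C; U \<in> Obj C; V \<in> Obj C\<rbrakk> \<Longrightarrow>
        ((\<a>\<^sup>\<circ> X U Z \<bullet> Y) \<odot> (T \<odot> V)) \<cdot> \<a>\<^sup>\<circ> (((X \<odot> U) \<odot> Z) \<bullet> Y) T V
          \<cdot> (\<delta> (X \<odot> U) Y Z T \<odot> V) \<cdot> \<delta> X (Y \<odot> (Z\<^sup>- \<bullet> T)) U V
      = \<delta> X Y (U \<odot> Z) (T \<odot> V) \<cdot> (X \<bullet> (Y \<odot> (\<phi>\<^sup>\<circ> Z U \<bullet> (T \<odot> V))))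
          \<cdot> (X \<bullet> (Y \<odot> \<zeta> (Z\<^sup>-) T (U\<^sup>-) V)) \<cdot> (X \<bullet> \<a>\<^sup>\<circ> Y (Z\<^sup>- \<bullet> T) (U\<^sup>- \<bullet> V))"
    and R17: "\<r>\<^sup>\<circ> \<J> \<cdot> (\<J> \<odot> \<r>\<^sup>\<bullet> \<I>) \<cdot> (\<J> \<odot> (\<I> \<bullet> \<mu>\<^sub>J)) \<cdot> \<gamma> \<J> \<J> \<I> \<J>
          \<cdot> ((((\<J> \<bullet> \<phi>\<^sup>\<bullet>\<^sub>0) \<cdot> \<Delta>\<^sub>J) \<odot> \<I>) \<bullet> \<J>)
      = \<r>\<^sup>\<bullet> \<J> \<cdot> (\<r>\<^sup>\<circ> \<J> \<bullet> \<J>)"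
    and R18: "\<l>\<^sup>\<circ> \<J> \<cdot> (\<l>\<^sup>\<bullet> \<I> \<odot> \<J>) \<cdot> ((\<mu>\<^sub>J \<bullet> \<I>) \<odot> \<J>) \<cdot> \<delta> \<J> \<I> \<J> \<J>
          \<cdot> (\<J> \<bullet> (\<I> \<odot> ((\<phi>\<^sup>\<bullet>\<^sub>0 \<bullet> \<J>) \<cdot> \<Delta>\<^sub>J)))
      = \<l>\<^sup>\<bullet> \<J> \<cdot> (\<J> \<bullet> \<l>\<^sup>\<circ> \<J>)"

text \<open>Chosen finite products; \<open>Prod\<close>, \<open>Fst\<close> and \<open>Snd\<close> are only meaningful on objects.\<close>

record 'a products =
  Prod :: "'a \<Rightarrow> 'a \<Rightarrow> 'a"
  Fst :: "'a \<Rightarrow> 'a \<Rightarrow> 'a"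
  Snd :: "'a \<Rightarrow> 'a \<Rightarrow> 'a"
  Terminal :: 'a

definition finite_products :: "'a cat \<Rightarrow> 'a products \<Rightarrow> bool" where
  "finite_products C P \<longleftrightarrow>
     (\<forall>X \<in> Obj C. \<forall>Y \<in> Obj C.
        Prod P X Y \<in> Obj C \<and> Fst P X Y \<in> Hom C (Prod P X Y) X \<and> Snd P X Y \<in> Hom C (Prod P X Y) Y \<and>
        (\<forall>Z. \<forall>f \<in> Hom C Z X. \<forall>g \<in> Hom C Z Y.
           \<exists>!h. h \<in> Hom C Z (Prod P X Y) \<and> Comp C (Fst P X Y) h = f \<and> Comp C (Snd P X Y) h = g)) \<and>
     Terminal P \<in> Obj C \<and> (\<forall>X \<in> Obj C. \<exists>!h. h \<in> Hom C X (Terminal P))"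

definition pairing :: "'a cat \<Rightarrow> 'a products \<Rightarrow> 'a \<Rightarrow> 'a \<Rightarrow> 'a" where
  "pairing C P f g = (THE h. h \<in> Hom C (Dom C f) (Prod P (Cod C f) (Cod C g)) \<and>
     Comp C (Fst P (Cod C f) (Cod C g)) h = f \<and> Comp C (Snd P (Cod C f) (Cod C g)) h = g)"

definition bang :: "'a cat \<Rightarrow> 'a products \<Rightarrow> 'a \<Rightarrow> 'a" where
  "bang C P X = (THE h. h \<in> Hom C X (Terminal P))"

definition cartesian_monoidal :: "'a cat \<Rightarrow> 'a products \<Rightarrow> 'a monoidal" where
  "cartesian_monoidal C P = \<lparr>
     Tensor = (\<lambda>f g. pairing C P (Comp C f (Fst P (Dom C f) (Dom C g)))
                                 (Comp C g (Snd P (Dom C f) (Dom C g)))),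
     Unit = Terminal P,
     Assoc = (\<lambda>X Y Z. pairing C P
       (Comp C (Fst P X Y) (Fst P (Prod P X Y) Z))
       (pairing C P (Comp C (Snd P X Y) (Fst P (Prod P X Y) Z)) (Snd P (Prod P X Y) Z))),
     LUnit = (\<lambda>X. Snd P (Terminal P) X),
     RUnit = (\<lambda>X. Fst P X (Terminal P))\<rparr>"

definition cartesian_duoidal :: "'a cat \<Rightarrow> 'a monoidal \<Rightarrow> 'a products \<Rightarrow> 'a duoidal" where
  "cartesian_duoidal C M P = \<lparr>
     Circ = M,
     Bul = cartesian_monoidal C P,
     Zeta = (\<lambda>X Y Z T. pairing C P (Tensor M (Fst P X Y) (Fst P Z T)) (Tensor M (Snd P X Y) (Snd P Z T))),
     DeltaI = pairing C P (Unit M) (Unit M),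
     MultJ = bang C P (Tensor M (Terminal P) (Terminal P)),
     EpsI = bang C P (Unit M)\<rparr>"

definition Grp :: "'a cat \<Rightarrow> 'a monoidal \<Rightarrow> 'a products \<Rightarrow> 'a reversion
    \<Rightarrow> ('a bimonoid \<times> 'a \<times> 'a bimonoid) cat" where
  "Grp C M P R = reversion_data.hopf_category C (cartesian_duoidal C M P) R"

definition Grp_m :: "'a cat \<Rightarrow> 'a monoidal \<Rightarrow> 'a products \<Rightarrow> 'a reversion
    \<Rightarrow> ('a bimonoid \<times> 'a \<times> 'a bimonoid) cat" where
  "Grp_m C M P R = full_subcategory (Grp C M P R) (\<lambda>(G, _, _). monic C (One G))"

end

theory Submission
  imports Defs
begin

text \<open>
  For \<open>\<bullet> = \<times>\<close> a bimonoid is just a monoid, and the antipode of a Hopf monoid \<open>G\<close> allows one to form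
  quotients \<open>x y\<inverse>\<close> of generalized elements. The proof follows the case of ordinary groups. Given a
  split epimorphism \<open>p : A \<rightarrow> B\<close> with section \<open>s\<close>, every \<open>a\<close> factorizes as
  \<open>a = (a s(p a)\<inverse>) s(p a)\<close>, and the first factor lifts to the pullback of \<open>p\<close> along any \<open>v : E \<rightarrow> B\<close>.
  As this factorization is natural, a morphism of points over \<open>B\<close> is a retract of \<open>g \<circ> B\<close>, where \<open>g\<close> is its
  inverse image; hence it is invertible as soon as \<open>g\<close> is. In the same way
  \<open>(a, e) \<mapsto> (a s(p a)\<inverse> s(v e), e)\<close> makes the pullback of \<open>p\<close> along \<open>v\<close> a retract of \<open>A \<times> E\<close>, from which
  it inherits an antipode. The difficulty is that \<open>\<circ>\<close> does not preserve products. It is overcome by retractions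
  constructed from \<open>\<gamma>\<close> and \<open>\<delta>\<close>, which show that a morphism to \<open>(X \<times> Z \<times> I) \<circ> T\<close> is determined by its
  components in \<open>(X \<times> I) \<circ> J\<close> and \<open>(Z \<times> I) \<circ> T\<close>.
\<close>

text \<open>The model behind the formulas is spans over a fixed set of vertices: there the tensor
  product composes paths, products consist of parallel pairs, \<open>I\<close> consists of the
  identities, and a factor \<open>I\<close> in a product says that the other factor is a loop. The
  transformations \<open>Gamma R\<close> and \<open>Delta R\<close> merely rearrange: the first
  sends \<open>((x, y), z), t\<close> to \<open>x\<close> followed by the pair of \<open>z\<close>
  and \<open>y t\<close>, the second sends \<open>x, (y, (z, t))\<close> to the pair of
  \<open>x z\<close> and \<open>y\<close>, followed by \<open>t\<close>. An arrow into a tensor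
  product has no components, and tensoring with \<open>T\<close> may turn jointly monic arrows into
  arrows that are no longer so. The axioms give values of \<open>Gamma R\<close> and
  \<open>Delta R\<close> outright only at the unit (\<open>R6\<close>, \<open>R7\<close>);
  \<open>R1\<close> and \<open>R3\<close> spread these values to other objects. All equations
  between quotients inside a tensor product are therefore reduced to components that are known to
  separate, and the antipode equations, which only speak of \<open>J\<close>, are extended to
  arbitrary \<open>T\<close> in this way.\<close>

text \<open>The constant \<open>hom_type\<close> is opaque to the simplifier, so that premises of the form
  \<open>ty f = hom_type X Y\<close> with unknown \<open>X\<close> and \<open>Y\<close> are solved by reflexivity. Conditional rewriting thereby
  infers domains and codomains in linear time.\<close>

definition hom_type :: "'a \<Rightarrow> 'a \<Rightarrow> ('a \<times> 'a) option" where
  "hom_type X Y = Some (X, Y)"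

section \<open>Typed composition in a category\<close>

context category
begin

definition ty :: "'a \<Rightarrow> ('a \<times> 'a) option" where
  "ty f = (if f \<in> Arr C then hom_type (Dom C f) (Cod C f) else None)"

abbreviation in_hom ("_ \<^bold>: _ \<rightarrow> _" [55, 55, 55] 50) where
  "f \<^bold>: X \<rightarrow> Y \<equiv> ty f = hom_type X Y"

abbreviation comp (infixr "\<cdot>" 55) where "g \<cdot> f \<equiv> Comp C g f"

lemma in_hom_iff: "f \<^bold>: X \<rightarrow> Y \<longleftrightarrow> f \<in> Arr C \<and> Dom C f = X \<and> Cod C f = Y"
  by (auto simp: ty_def hom_type_def)

lemma Hom_iff [simp]: "f \<in> Hom C X Y \<longleftrightarrow> f \<^bold>: X \<rightarrow> Y"
  by (auto simp: Hom_def in_hom_iff)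

lemma in_homD:
  assumes "f \<^bold>: X \<rightarrow> Y"
  shows "f \<in> Arr C" "Dom C f = X" "Cod C f = Y" "X \<in> Obj C" "Y \<in> Obj C"
  using assms by (simp_all add: in_hom_iff Obj_def) (auto simp: dom_in cod_in dom_dom dom_cod)

lemma Dom_Cod_ty [simp]:
  assumes "f \<^bold>: X \<rightarrow> Y"
  shows "Dom C f = X" "Cod C f = Y" "f \<in> Arr C"
  using in_homD[OF assms] by simp_all

lemma obj_ty [simp]: "X \<in> Obj C \<Longrightarrow> X \<^bold>: X \<rightarrow> X"
  using cod_dom[of X] by (simp add: in_hom_iff Obj_def del: Dom_Cod_ty)

lemma comp_ty [simp]: "f \<^bold>: X \<rightarrow> Y \<Longrightarrow> g \<^bold>: Y \<rightarrow> Z \<Longrightarrow> g \<cdot> f \<^bold>: X \<rightarrow> Z"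
  using comp_in[of f X Y g Z] by simp

lemma comp_assoc' [simp]:
  "f \<^bold>: X \<rightarrow> Y \<Longrightarrow> g \<^bold>: Y \<rightarrow> Z \<Longrightarrow> h \<^bold>: Z \<rightarrow> T \<Longrightarrow> (h \<cdot> g) \<cdot> f = h \<cdot> (g \<cdot> f)"
  using comp_assoc[of f X Y g Z h T] by simp

text \<open>The premise on objects is redundant, but makes the simplifier reject most instances at once.\<close>

lemma comp_id_left [simp]: "Y \<in> Obj C \<Longrightarrow> f \<^bold>: X \<rightarrow> Y \<Longrightarrow> Y \<cdot> f = f"
  using comp_cod[of f] by simp

lemma comp_id_right [simp]: "X \<in> Obj C \<Longrightarrow> f \<^bold>: X \<rightarrow> Y \<Longrightarrow> f \<cdot> X = f"
  using comp_dom[of f] by simp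

lemma arr_ty: "f \<in> Arr C \<Longrightarrow> f \<^bold>: Dom C f \<rightarrow> Cod C f"
  by (simp add: in_hom_iff del: Dom_Cod_ty)

lemma inverse_arrowsD:
  assumes "inverse_arrows C f g" "f \<^bold>: X \<rightarrow> Y"
  shows "g \<^bold>: Y \<rightarrow> X" "g \<cdot> f = X" "f \<cdot> g = Y"
  using assms by (simp_all add: inverse_arrows_def)

lemma inverse_arrowsI:
  "f \<^bold>: X \<rightarrow> Y \<Longrightarrow> g \<^bold>: Y \<rightarrow> X \<Longrightarrow> g \<cdot> f = X \<Longrightarrow> f \<cdot> g = Y \<Longrightarrow> inverse_arrows C f g"
  by (simp add: inverse_arrows_def)

lemma inverse_arrows_unique:
  assumes "inverse_arrows C f g" "inverse_arrows C f h"
  shows "g = h"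
proof -
  have f: "f \<^bold>: Dom C f \<rightarrow> Cod C f" using assms(1) by (intro arr_ty) (simp add: inverse_arrows_def)
  note g = inverse_arrowsD[OF assms(1) f] and h = inverse_arrowsD[OF assms(2) f]
  have "g = Dom C f \<cdot> g" by (rule comp_id_left[OF in_homD(5)[OF g(1)] g(1), symmetric])
  also have "\<dots> = (h \<cdot> f) \<cdot> g" by (simp only: h(2))
  also have "\<dots> = h \<cdot> (f \<cdot> g)" by (rule comp_assoc'[OF g(1) f h(1)])
  also have "\<dots> = h \<cdot> Cod C f" by (simp only: g(3))
  also have "\<dots> = h" by (rule comp_id_right[OF in_homD(4)[OF h(1)] h(1)])
  finally show ?thesis .
qed

lemma inverse_of_eqI: "inverse_arrows C f g \<Longrightarrow> inverse_of C f = g"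
  unfolding inverse_of_def using inverse_arrows_unique by (intro the_equality)

lemma inverse_of_props:
  assumes "is_iso C f" "f \<^bold>: X \<rightarrow> Y"
  shows "inverse_of C f \<^bold>: Y \<rightarrow> X" "f \<cdot> inverse_of C f = Y" "inverse_of C f \<cdot> f = X"
proof -
  obtain g where g: "inverse_arrows C f g" using assms(1) by (auto simp: is_iso_def)
  show "inverse_of C f \<^bold>: Y \<rightarrow> X" "f \<cdot> inverse_of C f = Y" "inverse_of C f \<cdot> f = X"
    using inverse_arrowsD[OF g assms(2)] by (simp_all only: inverse_of_eqI[OF g])
qed

lemma epi_cancel:
  assumes "f \<cdot> e = g \<cdot> e" "f \<^bold>: Y \<rightarrow> Z" "g \<^bold>: Y \<rightarrow> Z" "e \<^bold>: X \<rightarrow> Y" "e' \<^bold>: Y \<rightarrow> X" "e \<cdot> e' = Y"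
  shows "f = g"
proof -
  note [simp] = in_homD(4)[OF assms(2)]
  have "f = (f \<cdot> e) \<cdot> e'" using assms(2-) by simp
  also have "\<dots> = (g \<cdot> e) \<cdot> e'" by (simp only: assms(1))
  also have "\<dots> = g" using assms(2-) by simp
  finally show ?thesis .
qed

lemma mono_cancel:
  assumes "e \<cdot> f = e \<cdot> g" "f \<^bold>: Z \<rightarrow> X" "g \<^bold>: Z \<rightarrow> X" "e \<^bold>: X \<rightarrow> Y" "e' \<^bold>: Y \<rightarrow> X" "e' \<cdot> e = X"
  shows "f = g"
proof -
  note [simp] = in_homD(5)[OF assms(2)]
  have "f = (e' \<cdot> e) \<cdot> f" unfolding assms(6) using assms(2) by simp
  also have "\<dots> = e' \<cdot> e \<cdot> f" using assms(2-5) by simp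
  also have "\<dots> = e' \<cdot> e \<cdot> g" by (simp only: assms(1))
  also have "\<dots> = (e' \<cdot> e) \<cdot> g" using assms(2-5) by simp
  also have "\<dots> = g" unfolding assms(6) using assms(3) by simp
  finally show ?thesis .
qed

section \<open>Pullbacks in a category\<close>

lemma pullbackD:
  assumes "pullback C p v k q" "Dom C k = Q" "p \<^bold>: A \<rightarrow> B" "v \<^bold>: E \<rightarrow> B"
  shows "k \<^bold>: Q \<rightarrow> A" "q \<^bold>: Q \<rightarrow> E" "p \<cdot> k = v \<cdot> q" "Q \<in> Obj C"
    and "a \<^bold>: V \<rightarrow> A \<Longrightarrow> b \<^bold>: V \<rightarrow> E \<Longrightarrow> p \<cdot> a = v \<cdot> b \<Longrightarrow> \<exists>h. h \<^bold>: V \<rightarrow> Q \<and> k \<cdot> h = a \<and> q \<cdot> h = b"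
    and "f \<^bold>: V \<rightarrow> Q \<Longrightarrow> g \<^bold>: V \<rightarrow> Q \<Longrightarrow> k \<cdot> f = k \<cdot> g \<Longrightarrow> q \<cdot> f = q \<cdot> g \<Longrightarrow> f = g"
proof -
  have dp: "Dom C p = A" "Dom C v = E" using assms(3,4) by simp_all
  show k: "k \<^bold>: Q \<rightarrow> A" and q: "q \<^bold>: Q \<rightarrow> E" and pk: "p \<cdot> k = v \<cdot> q"
    using assms(1) unfolding pullback_def dp assms(2) Hom_iff by blast+
  show "Q \<in> Obj C" using in_homD(4)[OF k] .
  have u: "\<exists>!h. h \<^bold>: V \<rightarrow> Q \<and> k \<cdot> h = a \<and> q \<cdot> h = b"
    if "a \<^bold>: V \<rightarrow> A" "b \<^bold>: V \<rightarrow> E" "p \<cdot> a = v \<cdot> b" for a b V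
  proof -
    have U: "\<forall>X. \<forall>a\<in>Hom C X A. \<forall>b\<in>Hom C X E. p \<cdot> a = v \<cdot> b \<longrightarrow> (\<exists>!h. h \<in> Hom C X (Q) \<and> k \<cdot> h = a \<and> q \<cdot> h = b)"
      using assms(1) unfolding pullback_def dp assms(2) by (elim conjE)
    have ab: "a \<in> Hom C V A" "b \<in> Hom C V E" using that by simp_all
    have "\<exists>!h. h \<in> Hom C V (Q) \<and> k \<cdot> h = a \<and> q \<cdot> h = b"
      by (rule U[rule_format, OF ab that(3)])
    thus ?thesis unfolding Hom_iff .
  qed
  show "\<exists>h. h \<^bold>: V \<rightarrow> Q \<and> k \<cdot> h = a \<and> q \<cdot> h = b" if "a \<^bold>: V \<rightarrow> A" "b \<^bold>: V \<rightarrow> E" "p \<cdot> a = v \<cdot> b"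
    using ex1_implies_ex[OF u[OF that]] .
  show "f = g" if fg: "f \<^bold>: V \<rightarrow> Q" "g \<^bold>: V \<rightarrow> Q" "k \<cdot> f = k \<cdot> g" "q \<cdot> f = q \<cdot> g"
  proof -
    have 1: "k \<cdot> g \<^bold>: V \<rightarrow> A" "q \<cdot> g \<^bold>: V \<rightarrow> E" using fg(2) k q by simp_all
    have "(p \<cdot> k) \<cdot> g = (v \<cdot> q) \<cdot> g" by (simp only: pk)
    hence 2: "p \<cdot> (k \<cdot> g) = v \<cdot> (q \<cdot> g)" using fg(2) k q assms(3,4) by simp
    show ?thesis by (rule ex1E[OF u[OF 1 2]]) (use fg in metis)
  qed
qed

text \<open>Proved for any category because it is applied inside the category of groups, where it
  compares a given pullback with one that was computed in \<open>C\<close>.\<close>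

lemma pullback_compare:
  assumes kq: "pullback C p v k q" "Dom C k = Q" and kq': "pullback C p v k' q'" "Dom C k' = Q'"
    and p [simp]: "p \<^bold>: A \<rightarrow> B" and v [simp]: "v \<^bold>: E \<rightarrow> B"
  obtains i j where "i \<^bold>: Q' \<rightarrow> Q" "j \<^bold>: Q \<rightarrow> Q'" "i \<cdot> j = Q" "j \<cdot> i = Q'" "k \<cdot> i = k'" "q \<cdot> i = q'"
proof -
  note P = pullbackD[OF kq p v] and P' = pullbackD[OF kq' p v]
  note [simp] = P(1,2,4) P'(1,2,4)
  obtain i where i [simp]: "i \<^bold>: Q' \<rightarrow> Q" and ki: "k \<cdot> i = k'" and qi: "q \<cdot> i = q'"
    using P(5)[OF P'(1-3)] by blast
  obtain j where j [simp]: "j \<^bold>: Q \<rightarrow> Q'" and kj: "k' \<cdot> j = k" and qj: "q' \<cdot> j = q"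
    using P'(5)[OF P(1-3)] by blast
  have "k \<cdot> (i \<cdot> j) = (k \<cdot> i) \<cdot> j" "q \<cdot> (i \<cdot> j) = (q \<cdot> i) \<cdot> j" by simp_all
  hence 1: "i \<cdot> j = Q" by - (rule P(6)[of "i \<cdot> j" Q Q], simp_all add: ki qi kj qj)
  have "k' \<cdot> (j \<cdot> i) = (k' \<cdot> j) \<cdot> i" "q' \<cdot> (j \<cdot> i) = (q' \<cdot> j) \<cdot> i" by simp_all
  hence 2: "j \<cdot> i = Q'" by - (rule P'(6)[of "j \<cdot> i" Q' Q'], simp_all add: ki qi kj qj)
  show ?thesis by (rule that[OF i j 1 2 ki qi])
qed

text \<open>The second half of that comparison: once the two groups are known to be isomorphic over
  both projections, the pullback property in \<open>C\<close> is carried across.\<close>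

lemma pullback_iso:
  assumes kq: "pullback C p v k q" "Dom C k = Q" and p: "p \<^bold>: A \<rightarrow> B" and v: "v \<^bold>: E \<rightarrow> B"
    and ij: "i \<^bold>: Q' \<rightarrow> Q" "j \<^bold>: Q \<rightarrow> Q'" "i \<cdot> j = Q" "j \<cdot> i = Q'"
  shows "pullback C p v (k \<cdot> i) (q \<cdot> i)"
proof -
  note P = pullbackD[OF kq p v]
  note [simp] = p v P(1,2,4) ij(1,2) in_homD(4)[OF ij(1)]
  have eq: "p \<cdot> (k \<cdot> i) = v \<cdot> (q \<cdot> i)" using arg_cong[OF P(3), of "\<lambda>f. f \<cdot> i"] by simp
  have uni: "\<exists>!h. h \<^bold>: X \<rightarrow> Q' \<and> (k \<cdot> i) \<cdot> h = a \<and> (q \<cdot> i) \<cdot> h = b"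
    if ab: "a \<^bold>: X \<rightarrow> A" "b \<^bold>: X \<rightarrow> E" "p \<cdot> a = v \<cdot> b" for a b X
  proof -
    obtain h where h [simp]: "h \<^bold>: X \<rightarrow> Q" and kh: "k \<cdot> h = a" "q \<cdot> h = b"
      using P(5)[OF ab] by blast
    have ijh: "i \<cdot> (j \<cdot> h) = h" using arg_cong[OF ij(3), of "\<lambda>f. f \<cdot> h"] by simp
    show ?thesis
    proof (rule ex1I[of _ "j \<cdot> h"])
      show "j \<cdot> h \<^bold>: X \<rightarrow> Q' \<and> (k \<cdot> i) \<cdot> (j \<cdot> h) = a \<and> (q \<cdot> i) \<cdot> (j \<cdot> h) = b"
        by (simp add: ijh kh)
      fix h' assume "h' \<^bold>: X \<rightarrow> Q' \<and> (k \<cdot> i) \<cdot> h' = a \<and> (q \<cdot> i) \<cdot> h' = b"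
      hence h' [simp]: "h' \<^bold>: X \<rightarrow> Q'" and 1: "(k \<cdot> i) \<cdot> h' = a" "(q \<cdot> i) \<cdot> h' = b" by blast+
      have "k \<cdot> (i \<cdot> h') = k \<cdot> h" "q \<cdot> (i \<cdot> h') = q \<cdot> h" using 1 by (simp_all add: kh)
      hence "i \<cdot> h' = h" by - (rule P(6)[of _ X], simp_all)
      hence "(j \<cdot> i) \<cdot> h' = j \<cdot> h" by simp
      thus "h' = j \<cdot> h" unfolding ij(4) by simp
    qed
  qed
  show ?thesis
    unfolding pullback_def Hom_iff using uni eq by simp
qed

lemma finitely_complete_pullback:
  assumes fc: "finitely_complete C" and p: "p \<^bold>: A \<rightarrow> B" and v: "v \<^bold>: E \<rightarrow> B"
  shows "\<exists>k q. pullback C p v k q"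
proof -
  note [simp] = p v
  note obj = in_homD(4,5)[OF p] in_homD(4)[OF v]
  let ?V = "{0, 1, 2 :: nat}"
  define D where "D = (\<lambda>i::nat. if i = 0 then A else if i = 1 then E else B)"
  let ?E = "{(0::nat, p, 2::nat), (1, v, 2)}"
  have "finite_diagram C ?V D ?E" by (simp add: finite_diagram_def D_def obj)
  then obtain X \<pi> where L: "limit_cone C ?V D ?E X \<pi>" using fc unfolding finitely_complete_def by blast
  have \<pi>: "X \<in> Obj C" "\<pi> 0 \<^bold>: X \<rightarrow> A" "\<pi> 1 \<^bold>: X \<rightarrow> E" "\<pi> 2 \<^bold>: X \<rightarrow> B" "p \<cdot> \<pi> 0 = \<pi> 2" "v \<cdot> \<pi> 1 = \<pi> 2"
    using L by (simp_all add: limit_cone_def cone_def D_def)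
  have "\<exists>!h. h \<^bold>: Z \<rightarrow> X \<and> \<pi> 0 \<cdot> h = a \<and> \<pi> 1 \<cdot> h = b"
    if ab: "a \<^bold>: Z \<rightarrow> A" "b \<^bold>: Z \<rightarrow> E" "p \<cdot> a = v \<cdot> b" for a b Z
  proof -
    define \<rho> where "\<rho> = (\<lambda>i::nat. if i = 0 then a else if i = 1 then b else p \<cdot> a)"
    have "cone C ?V D ?E Z \<rho>" using ab in_homD(4)[OF ab(1)] by (simp add: cone_def D_def \<rho>_def)
    hence ex: "\<exists>!h. h \<in> Hom C Z X \<and> (\<forall>w \<in> ?V. \<pi> w \<cdot> h = \<rho> w)" using L unfolding limit_cone_def by blast
    \<comment> \<open>The condition at vertex 2 follows from the one at vertex 0, since
      \<open>\<pi> 2\<close> is \<open>p\<close> after \<open>\<pi> 0\<close>. Hence mediating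
      arrows of cones and of commutative squares are the same.\<close>
    have "(h \<in> Hom C Z X \<and> (\<forall>w \<in> ?V. \<pi> w \<cdot> h = \<rho> w)) \<longleftrightarrow> (h \<^bold>: Z \<rightarrow> X \<and> \<pi> 0 \<cdot> h = a \<and> \<pi> 1 \<cdot> h = b)" for h
    proof -
      have "\<pi> 2 \<cdot> h = p \<cdot> a" if h: "h \<^bold>: Z \<rightarrow> X" "\<pi> 0 \<cdot> h = a"
        unfolding \<pi>(5)[symmetric] using \<pi>(2) h by simp
      thus ?thesis by (auto simp: \<rho>_def)
    qed
    thus ?thesis using ex by simp
  qed
  hence "pullback C p v (\<pi> 0) (\<pi> 1)" using \<pi> by (simp add: pullback_def)
  thus ?thesis by blast
qed

end

section \<open>Rewriting in a monoidal category\<close>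

context monoidal_category
begin

abbreviation tensor (infix "\<odot>" 70) where "f \<odot> g \<equiv> Tensor M f g"
abbreviation unit ("\<I>") where "\<I> \<equiv> Unit M"
abbreviation as ("\<a>") where "\<a> \<equiv> Assoc M"
abbreviation lu ("\<l>") where "\<l> \<equiv> LUnit M"
abbreviation ru ("\<r>") where "\<r> \<equiv> RUnit M"
abbreviation ai ("\<a>''") where "\<a>' X Y Z \<equiv> inverse_of C (\<a> X Y Z)"
abbreviation li ("\<l>''") where "\<l>' X \<equiv> inverse_of C (\<l> X)"
abbreviation ri ("\<r>''") where "\<r>' X \<equiv> inverse_of C (\<r> X)"

lemma tensor_ty [simp]: "f \<^bold>: X \<rightarrow> Y \<Longrightarrow> g \<^bold>: Z \<rightarrow> T \<Longrightarrow> f \<odot> g \<^bold>: X \<odot> Z \<rightarrow> Y \<odot> T"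
  using tensor_hom[of f X Y g Z T] by simp

lemma tensor_obj [simp]: "X \<in> Obj C \<Longrightarrow> Y \<in> Obj C \<Longrightarrow> X \<odot> Y \<in> Obj C"
  using in_homD(4)[OF tensor_ty[OF obj_ty obj_ty]] .

lemma unit_obj' [simp]: "\<I> \<in> Obj C" by (rule unit_obj)

lemma tensor_comp [simp]:
  assumes "f \<^bold>: X \<rightarrow> Y" "g \<^bold>: Y \<rightarrow> Z" "f' \<^bold>: X' \<rightarrow> Y'" "g' \<^bold>: Y' \<rightarrow> Z'"
  shows "(g \<odot> g') \<cdot> (f \<odot> f') = (g \<cdot> f) \<odot> (g' \<cdot> f')"
  using interchange[of f X Y g Z f' X' Y' g' Z'] assms by simp

text \<open>Composites are kept nested to the right, so a rule for a composite of two arrows must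
  also be available when a further arrow \<open>h\<close> follows on the right. The lemmas
  \<open>lu_nat'\<close>, \<open>ru_nat'\<close>, \<open>as_nat'\<close> and \<open>ai_nat'\<close>
  serve the same purpose.\<close>

lemma tensor_comp' [simp]:
  assumes "f \<^bold>: X \<rightarrow> Y" "g \<^bold>: Y \<rightarrow> Z" "f' \<^bold>: X' \<rightarrow> Y'" "g' \<^bold>: Y' \<rightarrow> Z'" "h \<^bold>: V \<rightarrow> X \<odot> X'"
  shows "(g \<odot> g') \<cdot> ((f \<odot> f') \<cdot> h) = ((g \<cdot> f) \<odot> (g' \<cdot> f')) \<cdot> h"
proof -
  have "(g \<odot> g') \<cdot> ((f \<odot> f') \<cdot> h) = ((g \<odot> g') \<cdot> (f \<odot> f')) \<cdot> h" using assms by (simp del: tensor_comp)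
  thus ?thesis using assms by simp
qed

lemma unitors_ty [simp]:
  assumes "X \<in> Obj C"
  shows "\<l> X \<^bold>: \<I> \<odot> X \<rightarrow> X" "\<r> X \<^bold>: X \<odot> \<I> \<rightarrow> X" "\<l>' X \<^bold>: X \<rightarrow> \<I> \<odot> X" "\<r>' X \<^bold>: X \<rightarrow> X \<odot> \<I>"
    "\<l> X \<cdot> \<l>' X = X" "\<l>' X \<cdot> \<l> X = \<I> \<odot> X" "\<r> X \<cdot> \<r>' X = X" "\<r>' X \<cdot> \<r> X = X \<odot> \<I>"
  using lunit_hom[OF assms] runit_hom[OF assms] inverse_of_props[OF lunit_iso[OF assms]]
    inverse_of_props[OF runit_iso[OF assms]]
  by auto

lemma assoc_ty [simp]:
  assumes "X \<in> Obj C" "Y \<in> Obj C" "Z \<in> Obj C"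
  shows "\<a> X Y Z \<^bold>: (X \<odot> Y) \<odot> Z \<rightarrow> X \<odot> (Y \<odot> Z)" "\<a>' X Y Z \<^bold>: X \<odot> (Y \<odot> Z) \<rightarrow> (X \<odot> Y) \<odot> Z"
    "\<a> X Y Z \<cdot> \<a>' X Y Z = X \<odot> (Y \<odot> Z)" "\<a>' X Y Z \<cdot> \<a> X Y Z = (X \<odot> Y) \<odot> Z"
  using assoc_hom[OF assms] inverse_of_props[OF assoc_iso[OF assms]] by auto

lemma cancel_inverse:
  assumes "g \<^bold>: Y \<rightarrow> X" "f \<^bold>: X \<rightarrow> Y" "g \<cdot> f = X" "h \<^bold>: V \<rightarrow> X"
  shows "g \<cdot> (f \<cdot> h) = h"
proof -
  have "g \<cdot> (f \<cdot> h) = (g \<cdot> f) \<cdot> h" using assms(1,2,4) by simp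
  thus ?thesis using assms(3,4) in_homD(5)[OF assms(4)] by simp
qed

lemma cancel_unitors [simp]:
  "X \<in> Obj C \<Longrightarrow> h \<^bold>: V \<rightarrow> X \<Longrightarrow> \<l> X \<cdot> (\<l>' X \<cdot> h) = h"
  "X \<in> Obj C \<Longrightarrow> h \<^bold>: V \<rightarrow> \<I> \<odot> X \<Longrightarrow> \<l>' X \<cdot> (\<l> X \<cdot> h) = h"
  "X \<in> Obj C \<Longrightarrow> h \<^bold>: V \<rightarrow> X \<Longrightarrow> \<r> X \<cdot> (\<r>' X \<cdot> h) = h"
  "X \<in> Obj C \<Longrightarrow> h \<^bold>: V \<rightarrow> X \<odot> \<I> \<Longrightarrow> \<r>' X \<cdot> (\<r> X \<cdot> h) = h"
  by (rule cancel_inverse; simp)+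

lemma cancel_assoc [simp]:
  assumes "X \<in> Obj C" "Y \<in> Obj C" "Z \<in> Obj C"
  shows "h \<^bold>: V \<rightarrow> X \<odot> (Y \<odot> Z) \<Longrightarrow> \<a> X Y Z \<cdot> (\<a>' X Y Z \<cdot> h) = h"
    "h \<^bold>: V \<rightarrow> (X \<odot> Y) \<odot> Z \<Longrightarrow> \<a>' X Y Z \<cdot> (\<a> X Y Z \<cdot> h) = h"
  using assms by - (rule cancel_inverse; simp)+

lemma lu_nat: "f \<^bold>: X \<rightarrow> Y \<Longrightarrow> \<l> Y \<cdot> (\<I> \<odot> f) = f \<cdot> \<l> X"
  using lunit_natural[of f X Y] by simp

lemma ru_nat: "f \<^bold>: X \<rightarrow> Y \<Longrightarrow> \<r> Y \<cdot> (f \<odot> \<I>) = f \<cdot> \<r> X"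
  using runit_natural[of f X Y] by simp

lemma as_nat:
  "f \<^bold>: X \<rightarrow> X' \<Longrightarrow> g \<^bold>: Y \<rightarrow> Y' \<Longrightarrow> h \<^bold>: Z \<rightarrow> Z'
    \<Longrightarrow> \<a> X' Y' Z' \<cdot> ((f \<odot> g) \<odot> h) = (f \<odot> (g \<odot> h)) \<cdot> \<a> X Y Z"
  using assoc_natural[of f X X' g Y Y' h Z Z'] by simp

lemma li_nat: 
  assumes [simp]: "f \<^bold>: X \<rightarrow> Y"
  shows "\<l>' Y \<cdot> f = (\<I> \<odot> f) \<cdot> \<l>' X"
proof -
  note [simp] = in_homD(4,5)[OF assms]
  have "\<l>' Y \<cdot> f = \<l>' Y \<cdot> (f \<cdot> \<l> X) \<cdot> \<l>' X" by simp
  also have "\<dots> = (\<I> \<odot> f) \<cdot> \<l>' X" by (subst lu_nat[OF assms, symmetric]) simp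
  finally show ?thesis .
qed

lemma ri_nat: 
  assumes [simp]: "f \<^bold>: X \<rightarrow> Y"
  shows "\<r>' Y \<cdot> f = (f \<odot> \<I>) \<cdot> \<r>' X"
proof -
  note [simp] = in_homD(4,5)[OF assms]
  have "\<r>' Y \<cdot> f = \<r>' Y \<cdot> (f \<cdot> \<r> X) \<cdot> \<r>' X" by simp
  also have "\<dots> = (f \<odot> \<I>) \<cdot> \<r>' X" by (subst ru_nat[OF assms, symmetric]) simp
  finally show ?thesis .
qed

lemma ai_nat:
  assumes [simp]: "f \<^bold>: X \<rightarrow> X'" "g \<^bold>: Y \<rightarrow> Y'" "h \<^bold>: Z \<rightarrow> Z'"
  shows "\<a>' X' Y' Z' \<cdot> (f \<odot> (g \<odot> h)) = ((f \<odot> g) \<odot> h) \<cdot> \<a>' X Y Z"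
proof -
  note [simp] = assms[THEN in_homD(4)] assms[THEN in_homD(5)]
  have "\<a>' X' Y' Z' \<cdot> (f \<odot> (g \<odot> h)) = \<a>' X' Y' Z' \<cdot> ((f \<odot> (g \<odot> h)) \<cdot> \<a> X Y Z) \<cdot> \<a>' X Y Z" by simp
  also have "\<dots> = ((f \<odot> g) \<odot> h) \<cdot> \<a>' X Y Z" by (subst as_nat[OF assms, symmetric]) simp
  finally show ?thesis .
qed

subsection \<open>Coherence of the unit constraints\<close>

text \<open>Kelly's argument: pentagon and triangle yield the equation after tensoring with
  \<open>I\<close> on the left, and this operation is faithful because the left unit constraint is
  natural and invertible.\<close>

lemma lu_tensor:
  assumes [simp]: "X \<in> Obj C" "Y \<in> Obj C"
  shows "\<l> (X \<odot> Y) \<cdot> \<a> \<I> X Y = \<l> X \<odot> Y"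
proof -
  let ?L = "\<l> (X \<odot> Y) \<cdot> \<a> \<I> X Y" and ?R = "\<l> X \<odot> Y"
  have "(\<I> \<odot> ?L) \<cdot> (\<a> \<I> (\<I> \<odot> X) Y \<cdot> (\<a> \<I> \<I> X \<odot> Y))
      = (\<I> \<odot> \<l> (X \<odot> Y)) \<cdot> (\<I> \<odot> \<a> \<I> X Y) \<cdot> (\<a> \<I> (\<I> \<odot> X) Y \<cdot> (\<a> \<I> \<I> X \<odot> Y))"
    by simp
  also have "\<dots> = (\<I> \<odot> \<l> (X \<odot> Y)) \<cdot> \<a> \<I> \<I> (X \<odot> Y) \<cdot> \<a> (\<I> \<odot> \<I>) X Y"
    by (subst pentagon) simp_all
  also have "\<dots> = ((\<I> \<odot> \<l> (X \<odot> Y)) \<cdot> \<a> \<I> \<I> (X \<odot> Y)) \<cdot> \<a> (\<I> \<odot> \<I>) X Y" by simp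
  also have "\<dots> = (\<r> \<I> \<odot> (X \<odot> Y)) \<cdot> \<a> (\<I> \<odot> \<I>) X Y"
    by (subst triangle) simp_all
  also have "\<dots> = \<a> \<I> X Y \<cdot> ((\<r> \<I> \<odot> X) \<odot> Y)"
    using as_nat[of "\<r> \<I>" "\<I> \<odot> \<I>" \<I> X X X Y Y Y] by simp
  also have "\<dots> = \<a> \<I> X Y \<cdot> ((\<I> \<odot> \<l> X) \<odot> Y) \<cdot> (\<a> \<I> \<I> X \<odot> Y)"
    using triangle[of \<I> X] by simp
  also have "\<dots> = (\<a> \<I> X Y \<cdot> ((\<I> \<odot> \<l> X) \<odot> Y)) \<cdot> (\<a> \<I> \<I> X \<odot> Y)" by (simp del: tensor_comp)
  also have "\<dots> = ((\<I> \<odot> ?R) \<cdot> \<a> \<I> (\<I> \<odot> X) Y) \<cdot> (\<a> \<I> \<I> X \<odot> Y)"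
    by (subst as_nat[of \<I> \<I> \<I> "\<l> X" "\<I> \<odot> X" X Y Y Y]) simp_all
  also have "\<dots> = (\<I> \<odot> ?R) \<cdot> (\<a> \<I> (\<I> \<odot> X) Y \<cdot> (\<a> \<I> \<I> X \<odot> Y))" by simp
  finally have *: "\<I> \<odot> ?L = \<I> \<odot> ?R"
    by (rule epi_cancel[where e' = "(\<a>' \<I> \<I> X \<odot> Y) \<cdot> \<a>' \<I> (\<I> \<odot> X) Y"]) simp_all
  have "?L \<cdot> \<l> ((\<I> \<odot> X) \<odot> Y) = \<l> (X \<odot> Y) \<cdot> (\<I> \<odot> ?L)"
    by (subst lu_nat[of _ "(\<I> \<odot> X) \<odot> Y"]) simp_all
  also have "\<dots> = ?R \<cdot> \<l> ((\<I> \<odot> X) \<odot> Y)" unfolding *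
    by (subst lu_nat[of _ "(\<I> \<odot> X) \<odot> Y"]) simp_all
  finally show ?thesis
    by (rule epi_cancel[where e' = "\<l>' ((\<I> \<odot> X) \<odot> Y)"]) simp_all
qed

text \<open>By naturality the left unit constraint at the tensor square of \<open>I\<close> is
  \<open>I\<close> tensored with the one at \<open>I\<close>. So \<open>lu_tensor\<close> and the
  triangle identify the two constraints after tensoring with \<open>I\<close> on the right, which is
  again faithful.\<close>

lemma lu_unit_eq_ru_unit: "\<l> \<I> = \<r> \<I>"
proof -
  have "\<l> \<I> \<cdot> \<l> (\<I> \<odot> \<I>) = \<l> \<I> \<cdot> (\<I> \<odot> \<l> \<I>)" by (subst lu_nat[of _ "\<I> \<odot> \<I>"]) simp_all
  hence "\<l> (\<I> \<odot> \<I>) = \<I> \<odot> \<l> \<I>" by (rule mono_cancel[where e' = "\<l>' \<I>"]) simp_all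
  hence *: "\<l> \<I> \<odot> \<I> = \<r> \<I> \<odot> \<I>" using lu_tensor[of \<I> \<I>] triangle[of \<I> \<I>] by simp
  have "\<l> \<I> \<cdot> \<r> (\<I> \<odot> \<I>) = \<r> \<I> \<cdot> (\<l> \<I> \<odot> \<I>)" by (subst ru_nat[of _ "\<I> \<odot> \<I>"]) simp_all
  also have "\<dots> = \<r> \<I> \<cdot> \<r> (\<I> \<odot> \<I>)" unfolding * by (subst ru_nat[of _ "\<I> \<odot> \<I>"]) simp_all
  finally show ?thesis by (rule epi_cancel[where e' = "\<r>' (\<I> \<odot> \<I>)"]) simp_all
qed

lemma lu_nat': "f \<^bold>: X \<rightarrow> Y \<Longrightarrow> h \<^bold>: V \<rightarrow> \<I> \<odot> X \<Longrightarrow> \<l> Y \<cdot> ((\<I> \<odot> f) \<cdot> h) = f \<cdot> (\<l> X \<cdot> h)"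
  using lu_nat[of f X Y] in_homD(4,5)[of f X Y] comp_assoc'[of h V "\<I> \<odot> X" "\<I> \<odot> f" "\<I> \<odot> Y" "\<l> Y" Y]
  by simp

lemma ru_nat': "f \<^bold>: X \<rightarrow> Y \<Longrightarrow> h \<^bold>: V \<rightarrow> X \<odot> \<I> \<Longrightarrow> \<r> Y \<cdot> ((f \<odot> \<I>) \<cdot> h) = f \<cdot> (\<r> X \<cdot> h)"
  using ru_nat[of f X Y] in_homD(4,5)[of f X Y] comp_assoc'[of h V "X \<odot> \<I>" "f \<odot> \<I>" "Y \<odot> \<I>" "\<r> Y" Y]
  by simp

lemma as_nat':
  assumes fgh [simp]: "f \<^bold>: X \<rightarrow> X'" "g \<^bold>: Y \<rightarrow> Y'" "h \<^bold>: Z \<rightarrow> Z'" and [simp]: "k \<^bold>: V \<rightarrow> (X \<odot> Y) \<odot> Z"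
  shows "\<a> X' Y' Z' \<cdot> (((f \<odot> g) \<odot> h) \<cdot> k) = (f \<odot> (g \<odot> h)) \<cdot> (\<a> X Y Z \<cdot> k)"
proof -
  note [simp] = fgh[THEN in_homD(4)] fgh[THEN in_homD(5)]
  have "(\<a> X' Y' Z' \<cdot> ((f \<odot> g) \<odot> h)) \<cdot> k = ((f \<odot> (g \<odot> h)) \<cdot> \<a> X Y Z) \<cdot> k" by (simp only: as_nat[OF fgh])
  thus ?thesis by simp
qed

lemma ai_nat':
  assumes fgh [simp]: "f \<^bold>: X \<rightarrow> X'" "g \<^bold>: Y \<rightarrow> Y'" "h \<^bold>: Z \<rightarrow> Z'" and [simp]: "k \<^bold>: V \<rightarrow> X \<odot> (Y \<odot> Z)"
  shows "\<a>' X' Y' Z' \<cdot> ((f \<odot> (g \<odot> h)) \<cdot> k) = ((f \<odot> g) \<odot> h) \<cdot> (\<a>' X Y Z \<cdot> k)"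
proof -
  note [simp] = fgh[THEN in_homD(4)] fgh[THEN in_homD(5)]
  have "(\<a>' X' Y' Z' \<cdot> (f \<odot> (g \<odot> h))) \<cdot> k = (((f \<odot> g) \<odot> h) \<cdot> \<a>' X Y Z) \<cdot> k" by (simp only: ai_nat[OF fgh])
  thus ?thesis by simp
qed

lemma as_ri:
  assumes [simp]: "X \<in> Obj C" "Y \<in> Obj C"
  shows "\<a> X \<I> Y \<cdot> (\<r>' X \<odot> Y) = X \<odot> \<l>' Y"
proof -
  have "(X \<odot> \<l> Y) \<cdot> (\<a> X \<I> Y \<cdot> (\<r>' X \<odot> Y)) = (\<r> X \<odot> Y) \<cdot> (\<r>' X \<odot> Y)"
    using triangle[of X Y] by (simp flip: comp_assoc')
  also have "\<dots> = (X \<odot> \<l> Y) \<cdot> (X \<odot> \<l>' Y)" by simp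
  finally show ?thesis by (rule mono_cancel[where e' = "X \<odot> \<l>' Y"]) simp_all
qed

text \<open>A unit inserted on the right of the first factor becomes, after rebracketing, a unit
  inserted on the left of the second. The arrows \<open>f\<close>, \<open>g\<close>,
  \<open>u\<close> are included because simplification merges them with the unit constraint, so that
  the bare coherence law \<open>as_ri\<close> would not match.\<close>

lemma as_ri_tensor:
  assumes fgu [simp]: "f \<^bold>: X \<rightarrow> X'" "g \<^bold>: \<I> \<rightarrow> Y" "u \<^bold>: V \<rightarrow> U" and [simp]: "h \<^bold>: W \<rightarrow> X \<odot> V"
  shows "\<a> X' Y U \<cdot> ((((f \<odot> g) \<cdot> \<r>' X) \<odot> u) \<cdot> h) = (f \<odot> ((g \<odot> u) \<cdot> \<l>' V)) \<cdot> h"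
proof -
  note [simp] = fgu[THEN in_homD(4)] fgu[THEN in_homD(5)]
  have "\<a> X' Y U \<cdot> ((((f \<odot> g) \<cdot> \<r>' X) \<odot> u) \<cdot> h) = \<a> X' Y U \<cdot> (((f \<odot> g) \<odot> u) \<cdot> ((\<r>' X \<odot> V) \<cdot> h))" by simp
  also have "\<dots> = (f \<odot> (g \<odot> u)) \<cdot> (\<a> X \<I> V \<cdot> (\<r>' X \<odot> V)) \<cdot> h" 
    by (subst as_nat'[of f X X' g \<I> Y u V]) simp_all
  also have "\<dots> = (f \<odot> ((g \<odot> u) \<cdot> \<l>' V)) \<cdot> h" unfolding as_ri[OF in_homD(4)[OF fgu(1)] in_homD(4)[OF fgu(3)]] by simp
  finally show ?thesis .
qed

lemma as_ri_tensor':
  assumes "u \<^bold>: V \<rightarrow> U" "X \<in> Obj C" "h \<^bold>: W \<rightarrow> X \<odot> V"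
  shows "\<a> X \<I> U \<cdot> ((\<r>' X \<odot> u) \<cdot> h) = (X \<odot> ((\<I> \<odot> u) \<cdot> \<l>' V)) \<cdot> h"
  using as_ri_tensor[of X X X \<I> \<I> u V U h W] assms by simp

lemma ai_li:
  assumes [simp]: "X \<in> Obj C" "Y \<in> Obj C"
  shows "\<a>' X \<I> Y \<cdot> (X \<odot> \<l>' Y) = \<r>' X \<odot> Y"
  unfolding as_ri[OF assms, symmetric] by simp

lemma ai_li_tensor:
  assumes fgu [simp]: "f \<^bold>: \<I> \<rightarrow> Y" "g \<^bold>: X \<rightarrow> X'" "u \<^bold>: V \<rightarrow> U" and [simp]: "h \<^bold>: W \<rightarrow> V \<odot> X"
  shows "\<a>' U Y X' \<cdot> ((u \<odot> ((f \<odot> g) \<cdot> \<l>' X)) \<cdot> h) = (((u \<odot> f) \<cdot> \<r>' V) \<odot> g) \<cdot> h"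
proof -
  note [simp] = fgu[THEN in_homD(4)] fgu[THEN in_homD(5)]
  have "\<a>' U Y X' \<cdot> ((u \<odot> ((f \<odot> g) \<cdot> \<l>' X)) \<cdot> h) = \<a>' U Y X' \<cdot> ((u \<odot> (f \<odot> g)) \<cdot> ((V \<odot> \<l>' X) \<cdot> h))" by simp
  also have "\<dots> = ((u \<odot> f) \<odot> g) \<cdot> (\<a>' V \<I> X \<cdot> (V \<odot> \<l>' X)) \<cdot> h" 
    by (subst ai_nat'[of u V U f \<I> Y g X]) simp_all
  also have "\<dots> = (((u \<odot> f) \<cdot> \<r>' V) \<odot> g) \<cdot> h" unfolding ai_li[OF in_homD(4)[OF fgu(3)] in_homD(4)[OF fgu(2)]] by simp
  finally show ?thesis .
qed

lemma ai_li_tensor':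
  assumes "u \<^bold>: V \<rightarrow> U" "X \<in> Obj C" "h \<^bold>: W \<rightarrow> V \<odot> X"
  shows "\<a>' U \<I> X \<cdot> ((u \<odot> \<l>' X) \<cdot> h) = (((u \<odot> \<I>) \<cdot> \<r>' V) \<odot> X) \<cdot> h"
  using ai_li_tensor[of \<I> \<I> X X X u V U h W] assms by simp

lemma li_unit_eq_ri_unit: "\<l>' \<I> = \<r>' \<I>"
  by (simp only: lu_unit_eq_ru_unit)

text \<open>An arrow to the unit can be absorbed in either factor, because the two unit constraints
  agree at \<open>I\<close>. This converts arguments of the form required by
  \<open>gamma_unit\<close>, with a unit on the left, into those required by
  \<open>delta_unit\<close>, with a unit on the right.\<close>

lemma unit_swap:
  assumes k [simp]: "k \<^bold>: D \<rightarrow> \<I>" and fg [simp]: "f \<^bold>: \<I> \<rightarrow> F" "g \<^bold>: \<I> \<rightarrow> G"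
  shows "(f \<odot> (g \<cdot> k)) \<cdot> \<l>' D = ((f \<cdot> k) \<odot> g) \<cdot> \<r>' D"
proof -
  note [simp] = in_homD(4)[OF k]
  have "(f \<odot> (g \<cdot> k)) \<cdot> \<l>' D = (f \<odot> g) \<cdot> ((\<I> \<odot> k) \<cdot> \<l>' D)" by simp
  also have "\<dots> = (f \<odot> g) \<cdot> ((k \<odot> \<I>) \<cdot> \<r>' D)"
    using li_nat[OF k] ri_nat[OF k] li_unit_eq_ri_unit by simp
  also have "\<dots> = ((f \<cdot> k) \<odot> g) \<cdot> \<r>' D" by simp
  finally show ?thesis .
qed

end

section \<open>Products and reversion in explicit form\<close>

locale cartesian_reversion = monoidal_category C M for C :: "'a cat" and M :: "'a monoidal" +
  fixes P :: "'a products" and R :: "'a reversion"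
  assumes fin_prod: "finite_products C P"
    and rev: "reversion C (cartesian_duoidal C M P) R"
begin

abbreviation obj_prod (infix "**" 70) where "X ** Y \<equiv> Prod P X Y"
abbreviation pair ("\<langle>_,/ _\<rangle>") where "\<langle>f, g\<rangle> \<equiv> pairing C P f g"
abbreviation p1 ("\<pi>1") where "\<pi>1 \<equiv> Fst P"
abbreviation p2 ("\<pi>2") where "\<pi>2 \<equiv> Snd P"
abbreviation terminal ("\<J>") where "\<J> \<equiv> Terminal P"
abbreviation tau ("\<tau>") where "\<tau> \<equiv> bang C P"

abbreviation rv ("_\<^sup>-" [1000] 999) where "f\<^sup>- \<equiv> Rev R f"
abbreviation phi0 ("\<phi>0") where "\<phi>0 \<equiv> PhiCirc0 R"
abbreviation gam ("\<gamma>") where "\<gamma> \<equiv> Gamma R"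
abbreviation del ("\<delta>") where "\<delta> \<equiv> Delta R"
abbreviation gamt ("\<gamma>\<^sup>~") where "\<gamma>\<^sup>~ \<equiv> GammaTilde R"
abbreviation delt ("\<delta>\<^sup>~") where "\<delta>\<^sup>~ \<equiv> DeltaTilde R"

lemma prod_obj [simp]: "X \<in> Obj C \<Longrightarrow> Y \<in> Obj C \<Longrightarrow> X ** Y \<in> Obj C"
  and proj1_ty [simp]: "X \<in> Obj C \<Longrightarrow> Y \<in> Obj C \<Longrightarrow> \<pi>1 X Y \<^bold>: X ** Y \<rightarrow> X"
  and proj2_ty [simp]: "X \<in> Obj C \<Longrightarrow> Y \<in> Obj C \<Longrightarrow> \<pi>2 X Y \<^bold>: X ** Y \<rightarrow> Y"
  and terminal_obj [simp]: "\<J> \<in> Obj C"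
  using fin_prod unfolding finite_products_def Hom_iff by (blast+)

lemma pair_ex1:
  assumes "f \<^bold>: Z \<rightarrow> X" "g \<^bold>: Z \<rightarrow> Y"
  shows "\<exists>!h. h \<^bold>: Z \<rightarrow> X ** Y \<and> \<pi>1 X Y \<cdot> h = f \<and> \<pi>2 X Y \<cdot> h = g"
proof -
  have "\<forall>X\<in>Obj C. \<forall>Y\<in>Obj C. \<forall>Z. \<forall>f \<in> Hom C Z X. \<forall>g \<in> Hom C Z Y.
      \<exists>!h. h \<in> Hom C Z (X ** Y) \<and> \<pi>1 X Y \<cdot> h = f \<and> \<pi>2 X Y \<cdot> h = g"
    using fin_prod unfolding finite_products_def by blast
  moreover have "f \<in> Hom C Z X" "g \<in> Hom C Z Y" using assms by simp_all
  ultimately have "\<exists>!h. h \<in> Hom C Z (X ** Y) \<and> \<pi>1 X Y \<cdot> h = f \<and> \<pi>2 X Y \<cdot> h = g"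
    using in_homD(5)[OF assms(1)] in_homD(5)[OF assms(2)] by blast
  thus ?thesis unfolding Hom_iff .
qed

lemma pair_all:
  assumes "f \<^bold>: Z \<rightarrow> X" "g \<^bold>: Z \<rightarrow> Y"
  shows "\<langle>f, g\<rangle> \<^bold>: Z \<rightarrow> X ** Y \<and> \<pi>1 X Y \<cdot> \<langle>f, g\<rangle> = f \<and> \<pi>2 X Y \<cdot> \<langle>f, g\<rangle> = g"
proof -
  have "Dom C f = Z" "Cod C f = X" "Cod C g = Y" using assms by simp_all
  thus ?thesis unfolding pairing_def Hom_iff using theI'[OF pair_ex1[OF assms]] by (simp only:)
qed

lemma pair_ty [simp]: "f \<^bold>: Z \<rightarrow> X \<Longrightarrow> g \<^bold>: Z \<rightarrow> Y \<Longrightarrow> \<langle>f, g\<rangle> \<^bold>: Z \<rightarrow> X ** Y"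
  and proj_pair [simp]: "f \<^bold>: Z \<rightarrow> X \<Longrightarrow> g \<^bold>: Z \<rightarrow> Y \<Longrightarrow> \<pi>1 X Y \<cdot> \<langle>f, g\<rangle> = f"
    "f \<^bold>: Z \<rightarrow> X \<Longrightarrow> g \<^bold>: Z \<rightarrow> Y \<Longrightarrow> \<pi>2 X Y \<cdot> \<langle>f, g\<rangle> = g"
  using pair_all by blast+

lemma prod_eqI:
  assumes "f \<^bold>: Z \<rightarrow> X ** Y" "g \<^bold>: Z \<rightarrow> X ** Y" "X \<in> Obj C" "Y \<in> Obj C"
    "\<pi>1 X Y \<cdot> f = \<pi>1 X Y \<cdot> g" "\<pi>2 X Y \<cdot> f = \<pi>2 X Y \<cdot> g"
  shows "f = g"
proof -
  have "\<pi>1 X Y \<cdot> f \<^bold>: Z \<rightarrow> X" "\<pi>2 X Y \<cdot> f \<^bold>: Z \<rightarrow> Y" using assms(1,3,4) by simp_all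
  from pair_ex1[OF this] show ?thesis using assms(1,2,5,6) by metis
qed

lemma pair_comp [simp]:
  "f \<^bold>: Z \<rightarrow> X \<Longrightarrow> g \<^bold>: Z \<rightarrow> Y \<Longrightarrow> h \<^bold>: V \<rightarrow> Z \<Longrightarrow> \<langle>f, g\<rangle> \<cdot> h = \<langle>f \<cdot> h, g \<cdot> h\<rangle>"
  by (rule prod_eqI[of _ V X Y]) (simp_all add: in_homD(5) comp_assoc'[symmetric] del: comp_assoc')

lemma pair_eta:
  assumes "f \<^bold>: Z \<rightarrow> X ** Y" "X \<in> Obj C" "Y \<in> Obj C"
  shows "\<langle>\<pi>1 X Y \<cdot> f, \<pi>2 X Y \<cdot> f\<rangle> = f"
  using assms by - (rule prod_eqI[of _ Z X Y]; simp)

lemma pair_proj [simp]: "X \<in> Obj C \<Longrightarrow> Y \<in> Obj C \<Longrightarrow> \<langle>\<pi>1 X Y, \<pi>2 X Y\<rangle> = X ** Y"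
  using pair_eta[of "X ** Y" "X ** Y" X Y] by simp

lemma terminal_ex1: "X \<in> Obj C \<Longrightarrow> \<exists>!h. h \<^bold>: X \<rightarrow> \<J>"
  using fin_prod unfolding finite_products_def Hom_iff by blast

lemma tau_ty [simp]: "X \<in> Obj C \<Longrightarrow> \<tau> X \<^bold>: X \<rightarrow> \<J>"
  unfolding bang_def Hom_iff by (rule theI'[OF terminal_ex1])

lemma terminal_eqI: "f \<^bold>: X \<rightarrow> \<J> \<Longrightarrow> g \<^bold>: X \<rightarrow> \<J> \<Longrightarrow> f = g"
  using terminal_ex1[of X] in_homD(4)[of f X \<J>] by blast

lemma tau_comp [simp]: "f \<^bold>: X \<rightarrow> Y \<Longrightarrow> \<tau> Y \<cdot> f = \<tau> X"
  using in_homD(4,5)[of f X Y] by - (rule terminal_eqI[of _ X]; simp)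

lemma tau_terminal [simp]: "\<tau> \<J> = \<J>"
  by (rule terminal_eqI[of _ \<J>]) simp_all

text \<open>Replaces every piece of the cartesian structure by pairings and projections. After that
  the constraints of the product are computed away, and only those of the tensor product remain to
  be handled.\<close>

lemma duo_simps:
  "Circ (cartesian_duoidal C M P) = M"
  "Bul (cartesian_duoidal C M P) = cartesian_monoidal C P"
  "Tensor (cartesian_monoidal C P) f g = \<langle>f \<cdot> \<pi>1 (Dom C f) (Dom C g), g \<cdot> \<pi>2 (Dom C f) (Dom C g)\<rangle>"
  "Unit (cartesian_monoidal C P) = \<J>"
  "LUnit (cartesian_monoidal C P) X = \<pi>2 \<J> X"
  "RUnit (cartesian_monoidal C P) X = \<pi>1 X \<J>"
  "Assoc (cartesian_monoidal C P) X Y Z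
    = \<langle>\<pi>1 X Y \<cdot> \<pi>1 (X ** Y) Z, \<langle>\<pi>2 X Y \<cdot> \<pi>1 (X ** Y) Z, \<pi>2 (X ** Y) Z\<rangle>\<rangle>"
  "Zeta (cartesian_duoidal C M P) X Y Z T = \<langle>\<pi>1 X Y \<odot> \<pi>1 Z T, \<pi>2 X Y \<odot> \<pi>2 Z T\<rangle>"
  "DeltaI (cartesian_duoidal C M P) = \<langle>\<I>, \<I>\<rangle>"
  "MultJ (cartesian_duoidal C M P) = \<tau> (\<J> \<odot> \<J>)"
  "EpsI (cartesian_duoidal C M P) = \<tau> \<I>"
  by (simp_all add: cartesian_duoidal_def cartesian_monoidal_def)

lemma bul_unitor_inverses:
  assumes [simp]: "X \<in> Obj C"
  shows "inverse_of C (\<pi>2 \<J> X) = \<langle>\<tau> X, X\<rangle>" "inverse_of C (\<pi>1 X \<J>) = \<langle>X, \<tau> X\<rangle>"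
proof -
  have t: "\<tau> (\<J> ** X) = \<pi>1 \<J> X" "\<tau> (X ** \<J>) = \<pi>2 X \<J>"
    by (rule terminal_eqI; simp)+
  show "inverse_of C (\<pi>2 \<J> X) = \<langle>\<tau> X, X\<rangle>"
    by (rule inverse_of_eqI, rule inverse_arrowsI[of _ "\<J> ** X" X]) (simp_all add: t)
  show "inverse_of C (\<pi>1 X \<J>) = \<langle>X, \<tau> X\<rangle>"
    by (rule inverse_of_eqI, rule inverse_arrowsI[of _ "X ** \<J>" X]) (simp_all add: t)
qed

lemma bul_assoc_inverse:
  "X \<in> Obj C \<Longrightarrow> Y \<in> Obj C \<Longrightarrow> Z \<in> Obj C \<Longrightarrow>
    inverse_of C \<langle>\<pi>1 X Y \<cdot> \<pi>1 (X ** Y) Z, \<langle>\<pi>2 X Y \<cdot> \<pi>1 (X ** Y) Z, \<pi>2 (X ** Y) Z\<rangle>\<rangle>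
      = \<langle>\<langle>\<pi>1 X (Y ** Z), \<pi>1 Y Z \<cdot> \<pi>2 X (Y ** Z)\<rangle>, \<pi>2 Y Z \<cdot> \<pi>2 X (Y ** Z)\<rangle>"
  by (rule inverse_of_eqI, rule inverse_arrowsI[of _ "(X ** Y) ** Z" "X ** (Y ** Z)"]) (simp_all add: pair_eta)

lemma rv_functor: "is_functor C C (Rev R)"
  using reversion.phi_circ_lax[OF rev] unfolding lax_monoidal_functor_def by blast

lemma rv_ty [simp]: "f \<^bold>: X \<rightarrow> Y \<Longrightarrow> f\<^sup>- \<^bold>: X\<^sup>- \<rightarrow> Y\<^sup>-"
  using rv_functor unfolding is_functor_def in_hom_iff by blast

lemma rv_obj [simp]: "X \<in> Obj C \<Longrightarrow> X\<^sup>- \<in> Obj C"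
  using in_homD(4)[OF rv_ty[OF obj_ty]] .

lemma rv_comp [simp]: "f \<^bold>: X \<rightarrow> Y \<Longrightarrow> g \<^bold>: Y \<rightarrow> Z \<Longrightarrow> (g \<cdot> f)\<^sup>- = g\<^sup>- \<cdot> f\<^sup>-"
  using rv_functor unfolding is_functor_def in_hom_iff by blast

lemma phi0_ty [simp]: "\<phi>0 \<^bold>: \<I> \<rightarrow> \<I>\<^sup>-"
  using reversion.phi_circ_lax[OF rev]
  unfolding lax_monoidal_functor_def reverse_monoidal_def Hom_iff duo_simps by simp

lemma gamma_ty [simp]:
  assumes "X \<in> Obj C" "Y \<in> Obj C" "Z \<in> Obj C" "T \<in> Obj C"
  shows "\<gamma> X Y Z T \<^bold>: ((X ** Y\<^sup>-) \<odot> Z) ** T \<rightarrow> X \<odot> (Z ** (Y \<odot> T))"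
  using reversion.gamma_hom[OF rev assms] assms by (simp add: duo_simps)

lemma delta_ty [simp]:
  assumes "X \<in> Obj C" "Y \<in> Obj C" "Z \<in> Obj C" "T \<in> Obj C"
  shows "\<delta> X Y Z T \<^bold>: X ** (Y \<odot> (Z\<^sup>- ** T)) \<rightarrow> ((X \<odot> Z) ** Y) \<odot> T"
  using reversion.delta_hom[OF rev assms] assms by (simp add: duo_simps)

lemma gamma_tilde_ty [simp]:
  assumes "X \<in> Obj C" "Y \<in> Obj C" "Z \<in> Obj C" "T \<in> Obj C"
  shows "\<gamma>\<^sup>~ X Y Z T \<^bold>: X\<^sup>- ** ((Y ** Z) \<odot> T) \<rightarrow> Z \<odot> ((X \<odot> Y)\<^sup>- ** T)"
  using reversion.gamma_tilde_hom[OF rev assms] assms by (simp add: duo_simps)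

lemma delta_tilde_ty [simp]:
  assumes "X \<in> Obj C" "Y \<in> Obj C" "Z \<in> Obj C" "T \<in> Obj C"
  shows "\<delta>\<^sup>~ X Y Z T \<^bold>: (X \<odot> (Y ** Z)) ** T\<^sup>- \<rightarrow> (X ** (Z \<odot> T)\<^sup>-) \<odot> Y"
  using reversion.delta_tilde_hom[OF rev assms] assms by (simp add: duo_simps)

text \<open>Naturality on generalized elements. An argument in a product is given by its components,
  but an argument in a tensor product is not; the arrow \<open>w\<close> into
  \<open>Q \<odot> Q'\<close> stands for such an argument, and \<open>x\<close>, \<open>y\<close>,
  \<open>z\<close> act inside the two factors.\<close>

lemma gamma_nat:
  assumes fghk [simp]: "f \<^bold>: X \<rightarrow> X'" "g \<^bold>: Y \<rightarrow> Y'" "h \<^bold>: Z \<rightarrow> Z'" "k \<^bold>: T \<rightarrow> T'"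
    and [simp]: "x \<^bold>: Q \<rightarrow> X" "y \<^bold>: Q \<rightarrow> Y\<^sup>-" "z \<^bold>: Q' \<rightarrow> Z" "w \<^bold>: V \<rightarrow> Q \<odot> Q'" "v \<^bold>: V \<rightarrow> T"
  shows "\<gamma> X' Y' Z' T' \<cdot> \<langle>(\<langle>f \<cdot> x, g\<^sup>- \<cdot> y\<rangle> \<odot> (h \<cdot> z)) \<cdot> w, k \<cdot> v\<rangle>
    = (f \<odot> \<langle>h \<cdot> \<pi>1 Z (Y \<odot> T), (g \<odot> k) \<cdot> \<pi>2 Z (Y \<odot> T)\<rangle>) \<cdot> \<gamma> X Y Z T \<cdot> \<langle>(\<langle>x, y\<rangle> \<odot> z) \<cdot> w, v\<rangle>"
proof -
  note [simp] = fghk[THEN in_homD(4)] fghk[THEN in_homD(5)]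
  have "\<gamma> X' Y' Z' T' \<cdot> \<langle>(\<langle>f \<cdot> x, g\<^sup>- \<cdot> y\<rangle> \<odot> (h \<cdot> z)) \<cdot> w, k \<cdot> v\<rangle>
    = (\<gamma> X' Y' Z' T' \<cdot> \<langle>(\<langle>f \<cdot> \<pi>1 X (Y\<^sup>-), g\<^sup>- \<cdot> \<pi>2 X (Y\<^sup>-)\<rangle> \<odot> h) \<cdot> \<pi>1 ((X ** Y\<^sup>-) \<odot> Z) T,
           k \<cdot> \<pi>2 ((X ** Y\<^sup>-) \<odot> Z) T\<rangle>) \<cdot> \<langle>(\<langle>x, y\<rangle> \<odot> z) \<cdot> w, v\<rangle>"
    by simp
  also have "\<dots> = ((f \<odot> \<langle>h \<cdot> \<pi>1 Z (Y \<odot> T), (g \<odot> k) \<cdot> \<pi>2 Z (Y \<odot> T)\<rangle>) \<cdot> \<gamma> X Y Z T) \<cdot> \<langle>(\<langle>x, y\<rangle> \<odot> z) \<cdot> w, v\<rangle>"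
    using reversion.gamma_natural[OF rev, of f X X' g Y Y' h Z Z' k T T'] by (simp add: duo_simps del: comp_assoc')
  finally show ?thesis by simp
qed

lemma delta_nat:
  assumes fghk [simp]: "f \<^bold>: X \<rightarrow> X'" "g \<^bold>: Y \<rightarrow> Y'" "h \<^bold>: Z \<rightarrow> Z'" "k \<^bold>: T \<rightarrow> T'"
    and [simp]: "x \<^bold>: V \<rightarrow> X" "y \<^bold>: Q \<rightarrow> Y" "z \<^bold>: Q' \<rightarrow> Z\<^sup>-" "t \<^bold>: Q' \<rightarrow> T" "w \<^bold>: V \<rightarrow> Q \<odot> Q'"
  shows "\<delta> X' Y' Z' T' \<cdot> \<langle>f \<cdot> x, ((g \<cdot> y) \<odot> \<langle>h\<^sup>- \<cdot> z, k \<cdot> t\<rangle>) \<cdot> w\<rangle>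
    = (\<langle>(f \<odot> h) \<cdot> \<pi>1 (X \<odot> Z) Y, g \<cdot> \<pi>2 (X \<odot> Z) Y\<rangle> \<odot> k) \<cdot> \<delta> X Y Z T \<cdot> \<langle>x, (y \<odot> \<langle>z, t\<rangle>) \<cdot> w\<rangle>"
proof -
  note [simp] = fghk[THEN in_homD(4)] fghk[THEN in_homD(5)]
  have "\<delta> X' Y' Z' T' \<cdot> \<langle>f \<cdot> x, ((g \<cdot> y) \<odot> \<langle>h\<^sup>- \<cdot> z, k \<cdot> t\<rangle>) \<cdot> w\<rangle>
    = (\<delta> X' Y' Z' T' \<cdot> \<langle>f \<cdot> \<pi>1 X (Y \<odot> (Z\<^sup>- ** T)),
          (g \<odot> \<langle>h\<^sup>- \<cdot> \<pi>1 (Z\<^sup>-) T, k \<cdot> \<pi>2 (Z\<^sup>-) T\<rangle>) \<cdot> \<pi>2 X (Y \<odot> (Z\<^sup>- ** T))\<rangle>) \<cdot> \<langle>x, (y \<odot> \<langle>z, t\<rangle>) \<cdot> w\<rangle>"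
    by simp
  also have "\<dots> = ((\<langle>(f \<odot> h) \<cdot> \<pi>1 (X \<odot> Z) Y, g \<cdot> \<pi>2 (X \<odot> Z) Y\<rangle> \<odot> k) \<cdot> \<delta> X Y Z T) \<cdot> \<langle>x, (y \<odot> \<langle>z, t\<rangle>) \<cdot> w\<rangle>"
    using reversion.delta_natural[OF rev, of f X X' g Y Y' h Z Z' k T T'] by (simp add: duo_simps del: comp_assoc')
  finally show ?thesis by simp
qed

subsection \<open>Separation of components\<close>

text \<open>Precomposing \<open>R6\<close> with the pair of the inverse unit constraint and the
  identity of \<open>I\<close> makes its right-hand side an identity pair. The invertible arrows in
  front of \<open>Gamma R\<close> are then moved to the other side.\<close>

lemma R6_point: "\<gamma> \<I> \<I> \<I> \<I> \<cdot> \<langle>(\<langle>\<I>, \<phi>0\<rangle> \<odot> \<I>) \<cdot> \<r>' \<I>, \<I>\<rangle> = (\<I> \<odot> \<langle>\<I>, \<r>' \<I>\<rangle>) \<cdot> \<r>' \<I>"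
proof -
  let ?g = "\<gamma> \<I> \<I> \<I> \<I> \<cdot> \<langle>(\<langle>\<I>, \<phi>0\<rangle> \<odot> \<I>) \<cdot> \<r>' \<I>, \<I>\<rangle>"
  let ?k = "\<I> \<odot> \<langle>\<pi>1 \<I> (\<I> \<odot> \<I>), \<l> \<I> \<cdot> \<pi>2 \<I> (\<I> \<odot> \<I>)\<rangle>"
  let ?k' = "\<I> \<odot> \<langle>\<pi>1 \<I> \<I>, \<l>' \<I> \<cdot> \<pi>2 \<I> \<I>\<rangle>"
  have "\<l> (\<I> ** \<I>) \<cdot> (?k \<cdot> ?g) = \<langle>\<I>, \<I>\<rangle>"
    using arg_cong[OF reversion.R6[OF rev], of "\<lambda>x. x \<cdot> \<langle>\<l>' \<I>, \<I>\<rangle>"]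
    by (simp add: duo_simps li_unit_eq_ri_unit[symmetric])
  also have "\<dots> = \<l> (\<I> ** \<I>) \<cdot> ((\<I> \<odot> \<langle>\<I>, \<I>\<rangle>) \<cdot> \<l>' \<I>)"
    by (simp add: lu_nat')
  finally have "?k \<cdot> ?g = (\<I> \<odot> \<langle>\<I>, \<I>\<rangle>) \<cdot> \<l>' \<I>"
    by (rule mono_cancel[where e' = "\<l>' (\<I> ** \<I>)"]) simp_all
  hence "?k' \<cdot> (?k \<cdot> ?g) = ?k' \<cdot> ((\<I> \<odot> \<langle>\<I>, \<I>\<rangle>) \<cdot> \<l>' \<I>)"
    by (simp only:)
  thus ?thesis by (simp add: li_unit_eq_ri_unit[symmetric])
qed

text \<open>In spans: if \<open>x\<close> and \<open>y\<close> are identities, nothing is composed.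
  \<open>R1\<close> with its first four objects equal to \<open>I\<close> reduces the claim to
  \<open>R6_point\<close>, and naturality along the left unit constraints of \<open>U\<close> and
  \<open>S\<close> removes the units that \<open>R1\<close> inserts.\<close>

lemma gamma_unit:
  assumes us [simp]: "u \<^bold>: V \<rightarrow> U" "s \<^bold>: V \<rightarrow> S"
  shows "\<gamma> \<I> \<I> U S \<cdot> \<langle>(\<langle>\<I>, \<phi>0\<rangle> \<odot> u) \<cdot> \<l>' V, s\<rangle> = (\<I> \<odot> \<langle>u, (\<I> \<odot> s) \<cdot> \<l>' V\<rangle>) \<cdot> \<l>' V"
proof -
  note [simp] = us[THEN in_homD(4)] us[THEN in_homD(5)]
  let ?e = "(\<langle>(\<langle>\<I>, \<phi>0\<rangle> \<odot> \<I>) \<cdot> \<r>' \<I>, \<I>\<rangle> \<odot> \<langle>u, s\<rangle>) \<cdot> \<l>' V"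
  let ?k = "\<I> \<odot> \<langle>\<l> U \<cdot> \<pi>1 (\<I> \<odot> U) (\<I> \<odot> (\<I> \<odot> S)), (\<I> \<odot> \<l> S) \<cdot> \<pi>2 (\<I> \<odot> U) (\<I> \<odot> (\<I> \<odot> S))\<rangle>"
  have "?k \<cdot> \<gamma> \<I> \<I> (\<I> \<odot> U) (\<I> \<odot> S) \<cdot> \<langle>(\<langle>\<I>, \<phi>0\<rangle> \<odot> ((\<I> \<odot> u) \<cdot> \<l>' V)) \<cdot> \<l>' V, (\<I> \<odot> s) \<cdot> \<l>' V\<rangle>
     = (\<I> \<odot> \<langle>u, (\<I> \<odot> s) \<cdot> \<l>' V\<rangle>) \<cdot> \<l>' V"
    using arg_cong[OF reversion.R1[OF rev, of \<I> \<I> \<I> \<I> U S], of "\<lambda>x. ?k \<cdot> x \<cdot> ?e"]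
    by (simp add: duo_simps as_ri_tensor as_ri_tensor' R6_point lu_nat')
  thus ?thesis
    using gamma_nat[of \<I> \<I> \<I> \<I> \<I> \<I> "\<l> U" "\<I> \<odot> U" U "\<l> S" "\<I> \<odot> S" S \<I> \<I> \<phi>0 "(\<I> \<odot> u) \<cdot> \<l>' V" V "\<l>' V" V "(\<I> \<odot> s) \<cdot> \<l>' V"]
    by (simp add: lu_nat')
qed

lemma R7_point: "\<delta> \<I> \<I> \<I> \<I> \<cdot> \<langle>\<I>, (\<I> \<odot> \<langle>\<phi>0, \<I>\<rangle>) \<cdot> \<l>' \<I>\<rangle> = (\<langle>\<l>' \<I>, \<I>\<rangle> \<odot> \<I>) \<cdot> \<l>' \<I>"
proof -
  let ?g = "\<delta> \<I> \<I> \<I> \<I> \<cdot> \<langle>\<I>, (\<I> \<odot> \<langle>\<phi>0, \<I>\<rangle>) \<cdot> \<l>' \<I>\<rangle>"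
  let ?k = "\<langle>\<r> \<I> \<cdot> \<pi>1 (\<I> \<odot> \<I>) \<I>, \<pi>2 (\<I> \<odot> \<I>) \<I>\<rangle> \<odot> \<I>"
  let ?k' = "\<langle>\<r>' \<I> \<cdot> \<pi>1 \<I> \<I>, \<pi>2 \<I> \<I>\<rangle> \<odot> \<I>"
  have "\<r> (\<I> ** \<I>) \<cdot> (?k \<cdot> ?g) = \<langle>\<I>, \<I>\<rangle>"
    using arg_cong[OF reversion.R7[OF rev], of "\<lambda>x. x \<cdot> \<langle>\<I>, \<r>' \<I>\<rangle>"]
    by (simp add: duo_simps li_unit_eq_ri_unit)
  also have "\<dots> = \<r> (\<I> ** \<I>) \<cdot> ((\<langle>\<I>, \<I>\<rangle> \<odot> \<I>) \<cdot> \<r>' \<I>)"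
    by (simp add: ru_nat')
  finally have "?k \<cdot> ?g = (\<langle>\<I>, \<I>\<rangle> \<odot> \<I>) \<cdot> \<r>' \<I>"
    by (rule mono_cancel[where e' = "\<r>' (\<I> ** \<I>)"]) simp_all
  hence "?k' \<cdot> (?k \<cdot> ?g) = ?k' \<cdot> ((\<langle>\<I>, \<I>\<rangle> \<odot> \<I>) \<cdot> \<r>' \<I>)"
    by (simp only:)
  thus ?thesis by (simp add: li_unit_eq_ri_unit)
qed

text \<open>The mirror image of \<open>gamma_unit\<close>: here the last four objects of
  \<open>R3\<close> are \<open>I\<close>, and \<open>R7_point\<close> supplies the value.\<close>

lemma delta_unit:
  assumes us [simp]: "u \<^bold>: V \<rightarrow> U" "s \<^bold>: V \<rightarrow> S"
  shows "\<delta> S U \<I> \<I> \<cdot> \<langle>s, (u \<odot> \<langle>\<phi>0, \<I>\<rangle>) \<cdot> \<r>' V\<rangle> = (\<langle>(s \<odot> \<I>) \<cdot> \<r>' V, u\<rangle> \<odot> \<I>) \<cdot> \<r>' V"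
proof -
  note [simp] = us[THEN in_homD(4)] us[THEN in_homD(5)]
  let ?e = "(\<langle>s, u\<rangle> \<odot> \<langle>\<I>, (\<I> \<odot> \<langle>\<phi>0, \<I>\<rangle>) \<cdot> \<l>' \<I>\<rangle>) \<cdot> \<r>' V"
  let ?k = "\<langle>(\<r> S \<odot> \<I>) \<cdot> \<pi>1 ((S \<odot> \<I>) \<odot> \<I>) (U \<odot> \<I>), \<r> U \<cdot> \<pi>2 ((S \<odot> \<I>) \<odot> \<I>) (U \<odot> \<I>)\<rangle> \<odot> \<I>"
  let ?j = "\<langle>\<a>' S \<I> \<I> \<cdot> \<pi>1 (S \<odot> (\<I> \<odot> \<I>)) (U \<odot> \<I>), \<pi>2 (S \<odot> (\<I> \<odot> \<I>)) (U \<odot> \<I>)\<rangle> \<odot> \<I>"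
  have "?k \<cdot> \<delta> (S \<odot> \<I>) (U \<odot> \<I>) \<I> \<I> \<cdot> \<langle>(s \<odot> \<I>) \<cdot> \<r>' V, (((u \<odot> \<I>) \<cdot> \<r>' V) \<odot> \<langle>\<phi>0, \<I>\<rangle>) \<cdot> \<r>' V\<rangle>
     = (\<langle>(s \<odot> \<I>) \<cdot> \<r>' V, u\<rangle> \<odot> \<I>) \<cdot> \<r>' V"
    using arg_cong[OF reversion.R3[OF rev, of S U \<I> \<I> \<I> \<I>], of "\<lambda>x. ?k \<cdot> ?j \<cdot> x \<cdot> ?e"]
    by (simp add: duo_simps ai_li_tensor ai_li_tensor' R7_point ru_nat')
  thus ?thesis
    using delta_nat[of "\<r> S" "S \<odot> \<I>" S "\<r> U" "U \<odot> \<I>" U \<I> \<I> \<I> \<I> \<I> \<I> "(s \<odot> \<I>) \<cdot> \<r>' V" V "(u \<odot> \<I>) \<cdot> \<r>' V" V \<phi>0 \<I> \<I> "\<r>' V"]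
    by (simp add: ru_nat')
qed

text \<open>The only use of (R5). Substituting \<open>v = k\<close> or \<open>x = k\<close> makes one of the two sides computable.\<close>

lemma delta_gamma:
  assumes xkv [simp]: "x \<^bold>: D \<rightarrow> X" "k \<^bold>: D \<rightarrow> \<I>" "v \<^bold>: D \<rightarrow> V"
  shows "\<delta> X \<I> \<I> (\<I> ** (\<I> \<odot> V)) \<cdot> \<langle>x, (\<I> \<odot> \<langle>\<phi>0 \<cdot> k, \<langle>k, (\<I> \<odot> v) \<cdot> \<l>' D\<rangle>\<rangle>) \<cdot> \<l>' D\<rangle>
    = \<gamma> ((X \<odot> \<I>) ** \<I>) \<I> \<I> V \<cdot> \<langle>(\<langle>\<langle>(x \<odot> \<I>) \<cdot> \<r>' D, k\<rangle>, \<phi>0 \<cdot> k\<rangle> \<odot> \<I>) \<cdot> \<r>' D, v\<rangle>"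
proof -
  note [simp] = xkv[THEN in_homD(4)] xkv[THEN in_homD(5)]
  \<comment> \<open>The entry on which both \<open>Gamma R\<close> and \<open>Delta R\<close> act in
    this instance of \<open>R5\<close>. It consists of identities only, so \<open>unit_swap\<close>
    gives it the two forms on which \<open>gamma_unit\<close> and \<open>delta_unit\<close> can be
    evaluated.\<close>
  define c where "c = (\<langle>\<I>, \<phi>0\<rangle> \<odot> \<langle>\<phi>0 \<cdot> k, k\<rangle>) \<cdot> \<l>' D"
  have c_ty [simp]: "c \<^bold>: D \<rightarrow> (\<I> ** \<I>\<^sup>-) \<odot> (\<I>\<^sup>- ** \<I>)" by (simp add: c_def)
  have c: "c = (\<langle>k, \<phi>0 \<cdot> k\<rangle> \<odot> \<langle>\<phi>0, \<I>\<rangle>) \<cdot> \<r>' D"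
    unfolding c_def using unit_swap[of k D "\<langle>\<I>, \<phi>0\<rangle>" "\<I> ** \<I>\<^sup>-" "\<langle>\<phi>0, \<I>\<rangle>" "\<I>\<^sup>- ** \<I>"] by simp
  have g: "\<gamma> \<I> \<I> (\<I>\<^sup>- ** \<I>) V \<cdot> \<langle>c, v\<rangle> = (\<I> \<odot> \<langle>\<langle>\<phi>0 \<cdot> k, k\<rangle>, (\<I> \<odot> v) \<cdot> \<l>' D\<rangle>) \<cdot> \<l>' D"
    unfolding c_def by (subst gamma_unit) simp_all
  have d: "\<delta> X (\<I> ** \<I>\<^sup>-) \<I> \<I> \<cdot> \<langle>x, c\<rangle> = (\<langle>(x \<odot> \<I>) \<cdot> \<r>' D, \<langle>k, \<phi>0 \<cdot> k\<rangle>\<rangle> \<odot> \<I>) \<cdot> \<r>' D"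
    unfolding c by (subst delta_unit) simp_all
  show ?thesis
    using arg_cong[OF reversion.R5[OF rev, of X \<I> \<I> \<I> \<I> V], of "\<lambda>f. f \<cdot> \<langle>\<langle>x, c\<rangle>, v\<rangle>"]
    by (simp add: duo_simps bul_assoc_inverse g d)
qed

text \<open>The case \<open>v = k\<close> of \<open>delta_gamma\<close>. On the side of
  \<open>Delta R\<close> the pair of the identity and the inverse unit constraint comes out by
  naturality, and what is left is an instance of \<open>delta_unit\<close>.\<close>

lemma gamma_diag:
  assumes xk [simp]: "x \<^bold>: D \<rightarrow> X" "k \<^bold>: D \<rightarrow> \<I>"
  shows "\<gamma> (X ** \<I>) \<I> \<I> \<I> \<cdot> \<langle>(\<langle>\<langle>x, k\<rangle>, \<phi>0 \<cdot> k\<rangle> \<odot> \<I>) \<cdot> \<r>' D, k\<rangle> = (\<langle>x, k\<rangle> \<odot> \<langle>\<I>, \<l>' \<I>\<rangle>) \<cdot> \<r>' D"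
proof -
  note [simp] = xk[THEN in_homD(4)] xk[THEN in_homD(5)]
  have "\<gamma> ((X \<odot> \<I>) ** \<I>) \<I> \<I> \<I> \<cdot> \<langle>(\<langle>\<langle>(x \<odot> \<I>) \<cdot> \<r>' D, k\<rangle>, \<phi>0 \<cdot> k\<rangle> \<odot> \<I>) \<cdot> \<r>' D, k\<rangle>
      = \<delta> X \<I> \<I> (\<I> ** (\<I> \<odot> \<I>)) \<cdot> \<langle>x, (\<I> \<odot> \<langle>\<phi>0 \<cdot> k, \<langle>\<I>, \<l>' \<I>\<rangle> \<cdot> k\<rangle>) \<cdot> \<l>' D\<rangle>"
    using delta_gamma[of x D X k k \<I>] by (simp add: li_nat)
  also have "\<dots> = (((X \<odot> \<I>) ** \<I>) \<odot> \<langle>\<I>, \<l>' \<I>\<rangle>) \<cdot> \<delta> X \<I> \<I> \<I> \<cdot> \<langle>x, (\<I> \<odot> \<langle>\<phi>0 \<cdot> k, k\<rangle>) \<cdot> \<l>' D\<rangle>"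
    using delta_nat[of X X X \<I> \<I> \<I> \<I> \<I> \<I> "\<langle>\<I>, \<l>' \<I>\<rangle>" \<I> "\<I> ** (\<I> \<odot> \<I>)" x D \<I> \<I> "\<phi>0 \<cdot> k" D k "\<l>' D"] by simp
  also have "(\<I> \<odot> \<langle>\<phi>0 \<cdot> k, k\<rangle>) \<cdot> \<l>' D = (k \<odot> \<langle>\<phi>0, \<I>\<rangle>) \<cdot> \<r>' D"
    using unit_swap[of k D \<I> \<I> "\<langle>\<phi>0, \<I>\<rangle>" "\<I>\<^sup>- ** \<I>"] by simp
  also have "\<delta> X \<I> \<I> \<I> \<cdot> \<langle>x, (k \<odot> \<langle>\<phi>0, \<I>\<rangle>) \<cdot> \<r>' D\<rangle> = (\<langle>(x \<odot> \<I>) \<cdot> \<r>' D, k\<rangle> \<odot> \<I>) \<cdot> \<r>' D"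
    by (subst delta_unit) simp_all
  finally have *: "\<gamma> ((X \<odot> \<I>) ** \<I>) \<I> \<I> \<I> \<cdot> \<langle>(\<langle>\<langle>(x \<odot> \<I>) \<cdot> \<r>' D, k\<rangle>, \<phi>0 \<cdot> k\<rangle> \<odot> \<I>) \<cdot> \<r>' D, k\<rangle>
      = (\<langle>(x \<odot> \<I>) \<cdot> \<r>' D, k\<rangle> \<odot> \<langle>\<I>, \<l>' \<I>\<rangle>) \<cdot> \<r>' D" by simp
  show ?thesis
    \<comment> \<open>Evaluating \<open>Delta R\<close> has tensored \<open>X\<close> with a unit;
      naturality along the right unit constraint removes it.\<close>
    using gamma_nat[of "\<langle>\<r> X \<cdot> \<pi>1 (X \<odot> \<I>) \<I>, \<pi>2 (X \<odot> \<I>) \<I>\<rangle>" "(X \<odot> \<I>) ** \<I>" "X ** \<I>" \<I> \<I> \<I> \<I> \<I> \<I> \<I> \<I> \<I>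
        "\<langle>(x \<odot> \<I>) \<cdot> \<r>' D, k\<rangle>" D "\<phi>0 \<cdot> k" \<I> \<I> "\<r>' D" D k]
    by (simp add: * ru_nat')
qed

text \<open>The case \<open>x = k\<close> of \<open>delta_gamma\<close>, with the roles exchanged:
  now the side of \<open>Gamma R\<close> is evaluated, by \<open>gamma_unit\<close>.\<close>

lemma delta_diag:
  assumes kv [simp]: "k \<^bold>: D \<rightarrow> \<I>" "v \<^bold>: D \<rightarrow> V"
  shows "\<delta> \<I> \<I> \<I> (\<I> ** V) \<cdot> \<langle>k, (\<I> \<odot> \<langle>\<phi>0 \<cdot> k, \<langle>k, v\<rangle>\<rangle>) \<cdot> \<l>' D\<rangle> = (\<langle>\<r>' \<I>, \<I>\<rangle> \<odot> \<langle>k, v\<rangle>) \<cdot> \<l>' D"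
proof -
  note [simp] = kv[THEN in_homD(4)] kv[THEN in_homD(5)]
  have "\<delta> \<I> \<I> \<I> (\<I> ** (\<I> \<odot> V)) \<cdot> \<langle>k, (\<I> \<odot> \<langle>\<phi>0 \<cdot> k, \<langle>k, (\<I> \<odot> v) \<cdot> \<l>' D\<rangle>\<rangle>) \<cdot> \<l>' D\<rangle>
    = \<gamma> ((\<I> \<odot> \<I>) ** \<I>) \<I> \<I> V \<cdot> \<langle>(\<langle>\<langle>\<r>' \<I>, \<I>\<rangle> \<cdot> k, \<phi>0 \<cdot> k\<rangle> \<odot> \<I>) \<cdot> \<r>' D, v\<rangle>"
    using delta_gamma[of k D \<I> k v V] by (simp add: ri_nat)
  also have "\<dots> = (\<langle>\<r>' \<I>, \<I>\<rangle> \<odot> (\<I> ** (\<I> \<odot> V))) \<cdot> \<gamma> \<I> \<I> \<I> V \<cdot> \<langle>(\<langle>k, \<phi>0 \<cdot> k\<rangle> \<odot> \<I>) \<cdot> \<r>' D, v\<rangle>"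
    using gamma_nat[of "\<langle>\<r>' \<I>, \<I>\<rangle>" \<I> "(\<I> \<odot> \<I>) ** \<I>" \<I> \<I> \<I> \<I> \<I> \<I> V V V k D "\<phi>0 \<cdot> k" \<I> \<I> "\<r>' D" D v] by simp
  also have "(\<langle>k, \<phi>0 \<cdot> k\<rangle> \<odot> \<I>) \<cdot> \<r>' D = (\<langle>\<I>, \<phi>0\<rangle> \<odot> k) \<cdot> \<l>' D"
    using unit_swap[of k D "\<langle>\<I>, \<phi>0\<rangle>" "\<I> ** \<I>\<^sup>-" \<I> \<I>] by simp
  also have "\<gamma> \<I> \<I> \<I> V \<cdot> \<langle>(\<langle>\<I>, \<phi>0\<rangle> \<odot> k) \<cdot> \<l>' D, v\<rangle> = (\<I> \<odot> \<langle>k, (\<I> \<odot> v) \<cdot> \<l>' D\<rangle>) \<cdot> \<l>' D"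
    by (subst gamma_unit) simp_all
  finally have *: "\<delta> \<I> \<I> \<I> (\<I> ** (\<I> \<odot> V)) \<cdot> \<langle>k, (\<I> \<odot> \<langle>\<phi>0 \<cdot> k, \<langle>k, (\<I> \<odot> v) \<cdot> \<l>' D\<rangle>\<rangle>) \<cdot> \<l>' D\<rangle>
    = (\<langle>\<r>' \<I>, \<I>\<rangle> \<odot> \<langle>k, (\<I> \<odot> v) \<cdot> \<l>' D\<rangle>) \<cdot> \<l>' D" by simp
  show ?thesis
    using delta_nat[of \<I> \<I> \<I> \<I> \<I> \<I> \<I> \<I> \<I> "\<langle>\<pi>1 \<I> (\<I> \<odot> V), \<l> V \<cdot> \<pi>2 \<I> (\<I> \<odot> V)\<rangle>" "\<I> ** (\<I> \<odot> V)" "\<I> ** V"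
       k D \<I> \<I> "\<phi>0 \<cdot> k" D "\<langle>k, (\<I> \<odot> v) \<cdot> \<l>' D\<rangle>" "\<l>' D"]
    by (simp add: * lu_nat')
qed

text \<open>(R4) with \<open>Y\<close> and \<open>U\<close> doubled along diagonals.\<close>

lemma delta_proj:
  assumes xyztw [simp]: "x \<^bold>: D \<rightarrow> X" "y \<^bold>: Q \<rightarrow> Y" "z \<^bold>: Q' \<rightarrow> Z\<^sup>-" "t \<^bold>: Q' \<rightarrow> T" "w \<^bold>: D \<rightarrow> Q \<odot> Q'"
    and [simp]: "Z \<in> Obj C"
  shows "(\<pi>2 (X \<odot> Z) Y \<odot> T) \<cdot> \<delta> X Y Z T \<cdot> \<langle>x, (y \<odot> \<langle>z, t\<rangle>) \<cdot> w\<rangle> = (y \<odot> t) \<cdot> w"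
proof -
  note [simp] = xyztw[THEN in_homD(4)] xyztw[THEN in_homD(5)]
  have "\<delta> X (Y ** Y) Z (T ** T) \<cdot> \<langle>x, (\<langle>y, y\<rangle> \<odot> \<langle>z, \<langle>t, t\<rangle>\<rangle>) \<cdot> w\<rangle>
    = (\<langle>\<pi>1 (X \<odot> Z) Y, \<langle>\<pi>2 (X \<odot> Z) Y, \<pi>2 (X \<odot> Z) Y\<rangle>\<rangle> \<odot> \<langle>T, T\<rangle>) \<cdot> \<delta> X Y Z T \<cdot> \<langle>x, (y \<odot> \<langle>z, t\<rangle>) \<cdot> w\<rangle>"
    using delta_nat[of X X X "\<langle>Y, Y\<rangle>" Y "Y ** Y" Z Z Z "\<langle>T, T\<rangle>" T "T ** T" x D y Q z Q' t w] by simp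
  thus ?thesis
    using arg_cong[OF reversion.R4[OF rev, of X Y Y Z T T],
        of "\<lambda>f. \<pi>2 (((X \<odot> Z) ** Y) \<odot> T) (Y \<odot> T) \<cdot> f \<cdot> \<langle>x, (\<langle>y, y\<rangle> \<odot> \<langle>z, \<langle>t, t\<rangle>\<rangle>) \<cdot> w\<rangle>"]
    by (simp add: duo_simps bul_assoc_inverse)
qed

text \<open>By (R1), \<open>(n \<circ> T) g\<close> depends only on the two components of \<open>g\<close>, where
  \<open>n : Y \<rightarrow> W \<circ> (I \<times> (I \<circ> S))\<close> is built from \<open>\<gamma>\<close>; and \<open>n\<close> is a split monomorphism.\<close>

lemma separation_right:
  assumes y [simp]: "y1 \<^bold>: Y \<rightarrow> X ** \<I>" "y2 \<^bold>: Y \<rightarrow> Z ** \<I>" "z \<^bold>: (X ** \<I>) ** (Z ** \<I>) \<rightarrow> Y"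
    and XZT [simp]: "X \<in> Obj C" "Z \<in> Obj C" "T \<in> Obj C"
    and y12: "\<pi>2 Z \<I> \<cdot> y2 = \<pi>2 X \<I> \<cdot> y1"
    and z: "z \<cdot> \<langle>y1, y2\<rangle> = Y"
    and gh: "g \<^bold>: V \<rightarrow> Y \<odot> T" "h \<^bold>: V \<rightarrow> Y \<odot> T"
    and eq: "(y1 \<odot> \<tau> T) \<cdot> g = (y1 \<odot> \<tau> T) \<cdot> h" "(y2 \<odot> T) \<cdot> g = (y2 \<odot> T) \<cdot> h"
  shows "g = h"
proof -
  note [simp] = in_homD(4)[OF y(1)]
  let ?W = "X ** \<I>"
  let ?S = "Z ** \<I>"
  define i where "i = \<pi>2 X \<I> \<cdot> y1"
  have i [simp]: "i \<^bold>: Y \<rightarrow> \<I>" unfolding i_def by simp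
  \<comment> \<open>In spans \<open>n\<close> sends an element to its part \<open>y1\<close>
    followed by the pair of an identity and its part \<open>y2\<close>. These are composable because
    \<open>i\<close> makes both parts loops at one vertex.\<close>
  define y' where "y' = \<langle>(\<langle>y1, \<phi>0 \<cdot> i\<rangle> \<odot> \<I>) \<cdot> \<r>' Y, y2\<rangle>"
  define n where "n = \<gamma> ?W \<I> \<I> ?S \<cdot> y'"
  have y' [simp]: "y' \<^bold>: Y \<rightarrow> ((?W ** \<I>\<^sup>-) \<odot> \<I>) ** ?S" by (simp add: y'_def)
  have n_ty [simp]: "n \<^bold>: Y \<rightarrow> ?W \<odot> (\<I> ** (\<I> \<odot> ?S))" by (simp add: n_def)
  \<comment> \<open>Forgetting \<open>Z\<close> turns \<open>y2\<close> into \<open>i\<close>, which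
    is the situation of \<open>gamma_diag\<close>; \<open>y1\<close> can be read off from the
    result.\<close>
  have n1: "(?W \<odot> \<langle>\<pi>1 \<I> (\<I> \<odot> ?S), (\<I> \<odot> \<pi>2 Z \<I>) \<cdot> \<pi>2 \<I> (\<I> \<odot> ?S)\<rangle>) \<cdot> n = (y1 \<odot> \<langle>\<I>, \<l>' \<I>\<rangle>) \<cdot> \<r>' Y"
  proof -
    have y1: "y1 = \<langle>\<pi>1 X \<I> \<cdot> y1, i\<rangle>" unfolding i_def using pair_eta[of y1 Y X \<I>] by simp
    have "(?W \<odot> \<langle>\<pi>1 \<I> (\<I> \<odot> ?S), (\<I> \<odot> \<pi>2 Z \<I>) \<cdot> \<pi>2 \<I> (\<I> \<odot> ?S)\<rangle>) \<cdot> n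
        = \<gamma> ?W \<I> \<I> \<I> \<cdot> \<langle>(\<langle>y1, \<phi>0 \<cdot> i\<rangle> \<odot> \<I>) \<cdot> \<r>' Y, i\<rangle>"
      using gamma_nat[of ?W ?W ?W \<I> \<I> \<I> \<I> \<I> \<I> "\<pi>2 Z \<I>" ?S \<I> y1 Y "\<phi>0 \<cdot> i" \<I> \<I> "\<r>' Y" Y y2] y12
      by (simp add: n_def y'_def i_def)
    also have "\<dots> = (y1 \<odot> \<langle>\<I>, \<l>' \<I>\<rangle>) \<cdot> \<r>' Y"
      using gamma_diag[of "\<pi>1 X \<I> \<cdot> y1" Y X i] by (simp flip: y1)
    finally show ?thesis .
  qed
  \<comment> \<open>Forgetting \<open>X\<close> turns \<open>y1\<close> into \<open>i\<close>, which
    is the situation of \<open>gamma_unit\<close>; now \<open>y2\<close> can be read off.\<close>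
  have n2: "(\<pi>2 X \<I> \<odot> (\<I> ** (\<I> \<odot> ?S))) \<cdot> n = (\<I> \<odot> \<langle>i, (\<I> \<odot> y2) \<cdot> \<l>' Y\<rangle>) \<cdot> \<l>' Y"
  proof -
    have "(\<pi>2 X \<I> \<odot> (\<I> ** (\<I> \<odot> ?S))) \<cdot> n = \<gamma> \<I> \<I> \<I> ?S \<cdot> \<langle>(\<langle>i, \<phi>0 \<cdot> i\<rangle> \<odot> \<I>) \<cdot> \<r>' Y, y2\<rangle>"
      using gamma_nat[of "\<pi>2 X \<I>" ?W \<I> \<I> \<I> \<I> \<I> \<I> \<I> ?S ?S ?S y1 Y "\<phi>0 \<cdot> i" \<I> \<I> "\<r>' Y" Y y2]
      by (simp add: n_def y'_def flip: i_def)
    also have "(\<langle>i, \<phi>0 \<cdot> i\<rangle> \<odot> \<I>) \<cdot> \<r>' Y = (\<langle>\<I>, \<phi>0\<rangle> \<odot> i) \<cdot> \<l>' Y"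
      using unit_swap[of i Y "\<langle>\<I>, \<phi>0\<rangle>" "\<I> ** \<I>\<^sup>-" \<I> \<I>] by simp
    also have "\<gamma> \<I> \<I> \<I> ?S \<cdot> \<langle>(\<langle>\<I>, \<phi>0\<rangle> \<odot> i) \<cdot> \<l>' Y, y2\<rangle> = (\<I> \<odot> \<langle>i, (\<I> \<odot> y2) \<cdot> \<l>' Y\<rangle>) \<cdot> \<l>' Y"
      by (subst gamma_unit) simp_all
    finally show ?thesis .
  qed
  \<comment> \<open>The retraction: its two entries recover \<open>y1\<close> and \<open>y2\<close>
    by means of \<open>n1\<close> and \<open>n2\<close>, and \<open>z\<close> reassembles
    them.\<close>
  define zz where "zz = z \<cdot> \<langle>\<r> ?W \<cdot> (?W \<odot> (\<l> \<I> \<cdot> (\<I> \<odot> \<pi>2 Z \<I>))), \<l> ?S \<cdot> \<l> (\<I> \<odot> ?S) \<cdot> (\<pi>2 X \<I> \<odot> (\<I> \<odot> ?S))\<rangle>"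
  have zz_ty [simp]: "zz \<^bold>: ?W \<odot> (\<I> \<odot> ?S) \<rightarrow> Y" by (simp add: zz_def)
  have zz: "zz \<cdot> (?W \<odot> \<pi>2 \<I> (\<I> \<odot> ?S)) \<cdot> n = Y"
  proof -
    have "\<r> ?W \<cdot> (?W \<odot> (\<l> \<I> \<cdot> (\<I> \<odot> \<pi>2 Z \<I>) \<cdot> \<pi>2 \<I> (\<I> \<odot> ?S))) \<cdot> n
        = \<r> ?W \<cdot> (?W \<odot> (\<l> \<I> \<cdot> \<pi>2 \<I> (\<I> \<odot> \<I>))) \<cdot> ((?W \<odot> \<langle>\<pi>1 \<I> (\<I> \<odot> ?S), (\<I> \<odot> \<pi>2 Z \<I>) \<cdot> \<pi>2 \<I> (\<I> \<odot> ?S)\<rangle>) \<cdot> n)"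
      by simp
    also have "\<dots> = y1" unfolding n1 by (simp add: ru_nat')
    finally have 1: "\<r> ?W \<cdot> (?W \<odot> (\<l> \<I> \<cdot> (\<I> \<odot> \<pi>2 Z \<I>) \<cdot> \<pi>2 \<I> (\<I> \<odot> ?S))) \<cdot> n = y1" .
    have "\<l> ?S \<cdot> \<l> (\<I> \<odot> ?S) \<cdot> (\<pi>2 X \<I> \<odot> \<pi>2 \<I> (\<I> \<odot> ?S)) \<cdot> n
        = \<l> ?S \<cdot> \<l> (\<I> \<odot> ?S) \<cdot> (\<I> \<odot> \<pi>2 \<I> (\<I> \<odot> ?S)) \<cdot> ((\<pi>2 X \<I> \<odot> (\<I> ** (\<I> \<odot> ?S))) \<cdot> n)"
      by simp
    also have "\<dots> = y2" unfolding n2 by (simp add: lu_nat')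
    finally have 2: "\<l> ?S \<cdot> \<l> (\<I> \<odot> ?S) \<cdot> (\<pi>2 X \<I> \<odot> \<pi>2 \<I> (\<I> \<odot> ?S)) \<cdot> n = y2" .
    show ?thesis using z by (simp add: zz_def 1 2)
  qed
  \<comment> \<open>Only the two components from \<open>eq\<close> enter here. \<open>R1\<close>
    with \<open>J\<close> and \<open>T\<close> as last objects shows that \<open>p g\<close> is also
    obtained from \<open>n\<close> tensored with the pair of \<open>\<tau> T\<close> and
    \<open>T\<close>; the object \<open>J\<close> is the reason why the first component needs to be
    known only up to \<open>\<tau> T\<close>.\<close>
  define p where "p g = \<gamma> ?W \<I> (\<I> \<odot> \<J>) (?S \<odot> T) \<cdot> \<langle>(\<langle>?W, \<phi>0 \<cdot> \<pi>2 X \<I>\<rangle> \<odot> \<l>' \<J>) \<cdot> ((y1 \<odot> \<tau> T) \<cdot> g), (y2 \<odot> T) \<cdot> g\<rangle>" for g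
  let ?k = "?W \<odot> \<langle>\<pi>1 \<I> (\<I> \<odot> ?S) \<odot> \<pi>1 \<J> T, \<a> \<I> ?S T \<cdot> (\<pi>2 \<I> (\<I> \<odot> ?S) \<odot> \<pi>2 \<J> T)\<rangle>"
  let ?j = "?W \<odot> (\<a>' \<I> ?S T \<cdot> \<pi>2 (\<I> \<odot> \<J>) (\<I> \<odot> (?S \<odot> T)))"
  have R1: "\<gamma> ?W \<I> (\<I> \<odot> \<J>) (?S \<odot> T)
      \<cdot> \<langle>\<a> (?W ** \<I>\<^sup>-) \<I> \<J> \<cdot> (\<pi>1 ((?W ** \<I>\<^sup>-) \<odot> \<I>) ?S \<odot> \<pi>1 \<J> T), \<pi>2 ((?W ** \<I>\<^sup>-) \<odot> \<I>) ?S \<odot> \<pi>2 \<J> T\<rangle>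
      = ?k \<cdot> \<a> ?W (\<I> ** (\<I> \<odot> ?S)) (\<J> ** T) \<cdot> (\<gamma> ?W \<I> \<I> ?S \<odot> (\<J> ** T))"
    using reversion.R1[OF rev, of ?W \<I> \<I> ?S \<J> T] by (simp add: duo_simps)
  have lj: "\<l>' \<J> \<cdot> \<tau> T = (\<I> \<odot> \<tau> T) \<cdot> \<l>' T" by (rule li_nat) simp
  have p: "(zz \<odot> T) \<cdot> \<a>' ?W (\<I> \<odot> ?S) T \<cdot> ?j \<cdot> p g = g" if [simp]: "g \<^bold>: V \<rightarrow> Y \<odot> T" for g
  proof -
    have a1: "(\<pi>1 ((?W ** \<I>\<^sup>-) \<odot> \<I>) ?S \<odot> \<pi>1 \<J> T) \<cdot> ((y' \<odot> \<langle>\<tau> T, T\<rangle>) \<cdot> g) = (((\<langle>y1, \<phi>0 \<cdot> i\<rangle> \<odot> \<I>) \<cdot> \<r>' Y) \<odot> \<tau> T) \<cdot> g"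
      by (simp add: y'_def)
    have a2: "(\<pi>2 ((?W ** \<I>\<^sup>-) \<odot> \<I>) ?S \<odot> \<pi>2 \<J> T) \<cdot> ((y' \<odot> \<langle>\<tau> T, T\<rangle>) \<cdot> g) = (y2 \<odot> T) \<cdot> g"
      by (simp add: y'_def)
    have a3: "\<a> (?W ** \<I>\<^sup>-) \<I> \<J> \<cdot> ((((\<langle>y1, \<phi>0 \<cdot> i\<rangle> \<odot> \<I>) \<cdot> \<r>' Y) \<odot> \<tau> T) \<cdot> g) = (\<langle>y1, \<phi>0 \<cdot> i\<rangle> \<odot> ((\<I> \<odot> \<tau> T) \<cdot> \<l>' T)) \<cdot> g"
      by (rule as_ri_tensor) simp_all
    have a4: "p g = \<gamma> ?W \<I> (\<I> \<odot> \<J>) (?S \<odot> T) \<cdot> \<langle>(\<langle>y1, \<phi>0 \<cdot> i\<rangle> \<odot> ((\<I> \<odot> \<tau> T) \<cdot> \<l>' T)) \<cdot> g, (y2 \<odot> T) \<cdot> g\<rangle>"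
      by (simp add: p_def lj flip: i_def)
    have "p g = (\<gamma> ?W \<I> (\<I> \<odot> \<J>) (?S \<odot> T)
        \<cdot> \<langle>\<a> (?W ** \<I>\<^sup>-) \<I> \<J> \<cdot> (\<pi>1 ((?W ** \<I>\<^sup>-) \<odot> \<I>) ?S \<odot> \<pi>1 \<J> T), \<pi>2 ((?W ** \<I>\<^sup>-) \<odot> \<I>) ?S \<odot> \<pi>2 \<J> T\<rangle>)
        \<cdot> ((y' \<odot> \<langle>\<tau> T, T\<rangle>) \<cdot> g)"
      unfolding a4 using a1 a2 a3 by (simp del: tensor_comp')
    also have "\<dots> = (?k \<cdot> \<a> ?W (\<I> ** (\<I> \<odot> ?S)) (\<J> ** T) \<cdot> (\<gamma> ?W \<I> \<I> ?S \<odot> (\<J> ** T))) \<cdot> ((y' \<odot> \<langle>\<tau> T, T\<rangle>) \<cdot> g)"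
      by (simp only: R1)
    also have "\<dots> = ?k \<cdot> \<a> ?W (\<I> ** (\<I> \<odot> ?S)) (\<J> ** T) \<cdot> (n \<odot> \<langle>\<tau> T, T\<rangle>) \<cdot> g"
      by (simp add: n_def)
    finally have "p g = ?k \<cdot> \<a> ?W (\<I> ** (\<I> \<odot> ?S)) (\<J> ** T) \<cdot> (n \<odot> \<langle>\<tau> T, T\<rangle>) \<cdot> g" .
    hence "?j \<cdot> p g = (?W \<odot> (\<pi>2 \<I> (\<I> \<odot> ?S) \<odot> \<pi>2 \<J> T)) \<cdot> \<a> ?W (\<I> ** (\<I> \<odot> ?S)) (\<J> ** T) \<cdot> (n \<odot> \<langle>\<tau> T, T\<rangle>) \<cdot> g"
      by simp
    also have "\<dots> = \<a> ?W (\<I> \<odot> ?S) T \<cdot> ((?W \<odot> \<pi>2 \<I> (\<I> \<odot> ?S)) \<odot> \<pi>2 \<J> T) \<cdot> (n \<odot> \<langle>\<tau> T, T\<rangle>) \<cdot> g"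
      using as_nat'[of ?W ?W ?W "\<pi>2 \<I> (\<I> \<odot> ?S)" "\<I> ** (\<I> \<odot> ?S)" "\<I> \<odot> ?S" "\<pi>2 \<J> T" "\<J> ** T" T "(n \<odot> \<langle>\<tau> T, T\<rangle>) \<cdot> g" V]
      by simp
    finally show ?thesis by (simp add: zz)
  qed
  have "p g = p h" unfolding p_def eq ..
  with p[OF gh(1)] have "(zz \<odot> T) \<cdot> \<a>' ?W (\<I> \<odot> ?S) T \<cdot> ?j \<cdot> p h = g" by (simp only:)
  with p[OF gh(2)] show ?thesis by (simp only:)
qed

text \<open>The mirror image of \<open>separation_right\<close>, for the second antipode equation:
  \<open>Delta R\<close>, \<open>R3\<close>, \<open>delta_diag\<close> and \<open>delta_unit\<close>
  replace \<open>Gamma R\<close>, \<open>R1\<close>, \<open>gamma_diag\<close> and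
  \<open>gamma_unit\<close>. The part \<open>y2\<close> now comes first, so that \<open>n\<close> is
  \<open>y2\<close> followed by \<open>y1\<close>.\<close>

lemma separation_left:
  assumes y [simp]: "y1 \<^bold>: Y \<rightarrow> \<I> ** X" "y2 \<^bold>: Y \<rightarrow> \<I> ** Z" "z \<^bold>: (\<I> ** X) ** (\<I> ** Z) \<rightarrow> Y"
    and XZT [simp]: "X \<in> Obj C" "Z \<in> Obj C" "T \<in> Obj C"
    and y12: "\<pi>1 \<I> Z \<cdot> y2 = \<pi>1 \<I> X \<cdot> y1"
    and z: "z \<cdot> \<langle>y1, y2\<rangle> = Y"
    and gh: "g \<^bold>: V \<rightarrow> T \<odot> Y" "h \<^bold>: V \<rightarrow> T \<odot> Y"
    and eq: "(\<tau> T \<odot> y1) \<cdot> g = (\<tau> T \<odot> y1) \<cdot> h" "(T \<odot> y2) \<cdot> g = (T \<odot> y2) \<cdot> h"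
  shows "g = h"
proof -
  note [simp] = in_homD(4)[OF y(1)]
  let ?W = "\<I> ** X"
  let ?S = "\<I> ** Z"
  define i where "i = \<pi>1 \<I> X \<cdot> y1"
  have i [simp]: "i \<^bold>: Y \<rightarrow> \<I>" unfolding i_def by simp
  define y' where "y' = \<langle>y2, (\<I> \<odot> \<langle>\<phi>0 \<cdot> i, y1\<rangle>) \<cdot> \<l>' Y\<rangle>"
  define n where "n = \<delta> ?S \<I> \<I> ?W \<cdot> y'"
  have y' [simp]: "y' \<^bold>: Y \<rightarrow> ?S ** (\<I> \<odot> (\<I>\<^sup>- ** ?W))" by (simp add: y'_def)
  have n_ty [simp]: "n \<^bold>: Y \<rightarrow> ((?S \<odot> \<I>) ** \<I>) \<odot> ?W" by (simp add: n_def)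
  have n1: "(\<langle>(\<pi>1 \<I> Z \<odot> \<I>) \<cdot> \<pi>1 (?S \<odot> \<I>) \<I>, \<pi>2 (?S \<odot> \<I>) \<I>\<rangle> \<odot> ?W) \<cdot> n = (\<langle>\<r>' \<I>, \<I>\<rangle> \<odot> y1) \<cdot> \<l>' Y"
  proof -
    have y1: "y1 = \<langle>i, \<pi>2 \<I> X \<cdot> y1\<rangle>" unfolding i_def using pair_eta[of y1 Y \<I> X] by simp
    have "(\<langle>(\<pi>1 \<I> Z \<odot> \<I>) \<cdot> \<pi>1 (?S \<odot> \<I>) \<I>, \<pi>2 (?S \<odot> \<I>) \<I>\<rangle> \<odot> ?W) \<cdot> n
        = \<delta> \<I> \<I> \<I> ?W \<cdot> \<langle>i, (\<I> \<odot> \<langle>\<phi>0 \<cdot> i, y1\<rangle>) \<cdot> \<l>' Y\<rangle>"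
      using delta_nat[of "\<pi>1 \<I> Z" ?S \<I> \<I> \<I> \<I> \<I> \<I> \<I> ?W ?W ?W y2 Y \<I> \<I> "\<phi>0 \<cdot> i" Y y1 "\<l>' Y"] y12
      by (simp add: n_def y'_def i_def)
    also have "\<dots> = (\<langle>\<r>' \<I>, \<I>\<rangle> \<odot> y1) \<cdot> \<l>' Y"
      using delta_diag[of i Y "\<pi>2 \<I> X \<cdot> y1" X] by (simp flip: y1)
    finally show ?thesis .
  qed
  have n2: "(((?S \<odot> \<I>) ** \<I>) \<odot> \<pi>1 \<I> X) \<cdot> n = (\<langle>(y2 \<odot> \<I>) \<cdot> \<r>' Y, i\<rangle> \<odot> \<I>) \<cdot> \<r>' Y"
  proof -
    have "(((?S \<odot> \<I>) ** \<I>) \<odot> \<pi>1 \<I> X) \<cdot> n = \<delta> ?S \<I> \<I> \<I> \<cdot> \<langle>y2, (\<I> \<odot> \<langle>\<phi>0 \<cdot> i, i\<rangle>) \<cdot> \<l>' Y\<rangle>"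
      using delta_nat[of ?S ?S ?S \<I> \<I> \<I> \<I> \<I> \<I> "\<pi>1 \<I> X" ?W \<I> y2 Y \<I> \<I> "\<phi>0 \<cdot> i" Y y1 "\<l>' Y"]
      by (simp add: n_def y'_def flip: i_def)
    also have "(\<I> \<odot> \<langle>\<phi>0 \<cdot> i, i\<rangle>) \<cdot> \<l>' Y = (i \<odot> \<langle>\<phi>0, \<I>\<rangle>) \<cdot> \<r>' Y"
      using unit_swap[of i Y \<I> \<I> "\<langle>\<phi>0, \<I>\<rangle>" "\<I>\<^sup>- ** \<I>"] by simp
    also have "\<delta> ?S \<I> \<I> \<I> \<cdot> \<langle>y2, (i \<odot> \<langle>\<phi>0, \<I>\<rangle>) \<cdot> \<r>' Y\<rangle> = (\<langle>(y2 \<odot> \<I>) \<cdot> \<r>' Y, i\<rangle> \<odot> \<I>) \<cdot> \<r>' Y"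
      by (subst delta_unit) simp_all
    finally show ?thesis .
  qed
  define zz where "zz = z \<cdot> \<langle>\<l> ?W \<cdot> ((\<r> \<I> \<cdot> (\<pi>1 \<I> Z \<odot> \<I>)) \<odot> ?W), \<r> ?S \<cdot> \<r> (?S \<odot> \<I>) \<cdot> ((?S \<odot> \<I>) \<odot> \<pi>1 \<I> X)\<rangle>"
  have zz_ty [simp]: "zz \<^bold>: (?S \<odot> \<I>) \<odot> ?W \<rightarrow> Y" by (simp add: zz_def)
  have zz: "zz \<cdot> (\<pi>1 (?S \<odot> \<I>) \<I> \<odot> ?W) \<cdot> n = Y"
  proof -
    have "\<l> ?W \<cdot> ((\<r> \<I> \<cdot> (\<pi>1 \<I> Z \<odot> \<I>) \<cdot> \<pi>1 (?S \<odot> \<I>) \<I>) \<odot> ?W) \<cdot> n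
        = \<l> ?W \<cdot> ((\<r> \<I> \<cdot> \<pi>1 (\<I> \<odot> \<I>) \<I>) \<odot> ?W) \<cdot> ((\<langle>(\<pi>1 \<I> Z \<odot> \<I>) \<cdot> \<pi>1 (?S \<odot> \<I>) \<I>, \<pi>2 (?S \<odot> \<I>) \<I>\<rangle> \<odot> ?W) \<cdot> n)"
      by simp
    also have "\<dots> = y1" unfolding n1 by (simp add: lu_nat')
    finally have 1: "\<l> ?W \<cdot> ((\<r> \<I> \<cdot> (\<pi>1 \<I> Z \<odot> \<I>) \<cdot> \<pi>1 (?S \<odot> \<I>) \<I>) \<odot> ?W) \<cdot> n = y1" .
    have "\<r> ?S \<cdot> \<r> (?S \<odot> \<I>) \<cdot> (\<pi>1 (?S \<odot> \<I>) \<I> \<odot> \<pi>1 \<I> X) \<cdot> n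
        = \<r> ?S \<cdot> \<r> (?S \<odot> \<I>) \<cdot> (\<pi>1 (?S \<odot> \<I>) \<I> \<odot> \<I>) \<cdot> ((((?S \<odot> \<I>) ** \<I>) \<odot> \<pi>1 \<I> X) \<cdot> n)"
      by simp
    also have "\<dots> = y2" unfolding n2 by (simp add: ru_nat')
    finally have 2: "\<r> ?S \<cdot> \<r> (?S \<odot> \<I>) \<cdot> (\<pi>1 (?S \<odot> \<I>) \<I> \<odot> \<pi>1 \<I> X) \<cdot> n = y2" .
    show ?thesis using z by (simp add: zz_def 1 2)
  qed
  define p where "p g = \<delta> (T \<odot> ?S) (\<J> \<odot> \<I>) \<I> ?W \<cdot> \<langle>(T \<odot> y2) \<cdot> g, (\<r>' \<J> \<odot> \<langle>\<phi>0 \<cdot> \<pi>1 \<I> X, ?W\<rangle>) \<cdot> ((\<tau> T \<odot> y1) \<cdot> g)\<rangle>" for g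
  let ?k = "\<langle>\<pi>1 T \<J> \<odot> \<pi>1 (?S \<odot> \<I>) \<I>, \<pi>2 T \<J> \<odot> \<pi>2 (?S \<odot> \<I>) \<I>\<rangle> \<odot> ?W"
  let ?j = "(\<a> T ?S \<I> \<cdot> \<pi>1 ((T \<odot> ?S) \<odot> \<I>) (\<J> \<odot> \<I>)) \<odot> ?W"
  have R3: "(\<langle>\<a> T ?S \<I> \<cdot> \<pi>1 ((T \<odot> ?S) \<odot> \<I>) (\<J> \<odot> \<I>), \<pi>2 ((T \<odot> ?S) \<odot> \<I>) (\<J> \<odot> \<I>)\<rangle> \<odot> ?W) \<cdot> \<delta> (T \<odot> ?S) (\<J> \<odot> \<I>) \<I> ?W
          \<cdot> \<langle>\<pi>1 T \<J> \<odot> \<pi>1 ?S (\<I> \<odot> (\<I>\<^sup>- ** ?W)), \<a>' \<J> \<I> (\<I>\<^sup>- ** ?W) \<cdot> (\<pi>2 T \<J> \<odot> \<pi>2 ?S (\<I> \<odot> (\<I>\<^sup>- ** ?W)))\<rangle>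
      = ?k \<cdot> \<a>' (T ** \<J>) ((?S \<odot> \<I>) ** \<I>) ?W \<cdot> ((T ** \<J>) \<odot> \<delta> ?S \<I> \<I> ?W)"
    using reversion.R3[OF rev, of T \<J> ?S \<I> \<I> ?W] by (simp add: duo_simps)
  have rj: "\<r>' \<J> \<cdot> \<tau> T = (\<tau> T \<odot> \<I>) \<cdot> \<r>' T" by (rule ri_nat) simp
  have p: "(T \<odot> zz) \<cdot> \<a> T (?S \<odot> \<I>) ?W \<cdot> ?j \<cdot> p g = g" if [simp]: "g \<^bold>: V \<rightarrow> T \<odot> Y" for g
  proof -
    have [simp]: "p g \<^bold>: V \<rightarrow> (((T \<odot> ?S) \<odot> \<I>) ** (\<J> \<odot> \<I>)) \<odot> ?W" by (simp add: p_def)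
    have a1: "(\<pi>1 T \<J> \<odot> \<pi>1 ?S (\<I> \<odot> (\<I>\<^sup>- ** ?W))) \<cdot> ((\<langle>T, \<tau> T\<rangle> \<odot> y') \<cdot> g) = (T \<odot> y2) \<cdot> g"
      by (simp add: y'_def)
    have a2: "(\<pi>2 T \<J> \<odot> \<pi>2 ?S (\<I> \<odot> (\<I>\<^sup>- ** ?W))) \<cdot> ((\<langle>T, \<tau> T\<rangle> \<odot> y') \<cdot> g) = (\<tau> T \<odot> ((\<I> \<odot> \<langle>\<phi>0 \<cdot> i, y1\<rangle>) \<cdot> \<l>' Y)) \<cdot> g"
      by (simp add: y'_def)
    have a3: "\<a>' \<J> \<I> (\<I>\<^sup>- ** ?W) \<cdot> ((\<tau> T \<odot> ((\<I> \<odot> \<langle>\<phi>0 \<cdot> i, y1\<rangle>) \<cdot> \<l>' Y)) \<cdot> g) = (((\<tau> T \<odot> \<I>) \<cdot> \<r>' T) \<odot> \<langle>\<phi>0 \<cdot> i, y1\<rangle>) \<cdot> g"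
      by (rule ai_li_tensor) simp_all
    have a4: "p g = \<delta> (T \<odot> ?S) (\<J> \<odot> \<I>) \<I> ?W \<cdot> \<langle>(T \<odot> y2) \<cdot> g, (((\<tau> T \<odot> \<I>) \<cdot> \<r>' T) \<odot> \<langle>\<phi>0 \<cdot> i, y1\<rangle>) \<cdot> g\<rangle>"
      by (simp add: p_def rj flip: i_def)
    have "((\<langle>\<a> T ?S \<I> \<cdot> \<pi>1 ((T \<odot> ?S) \<odot> \<I>) (\<J> \<odot> \<I>), \<pi>2 ((T \<odot> ?S) \<odot> \<I>) (\<J> \<odot> \<I>)\<rangle> \<odot> ?W) \<cdot> p g)
       = ((\<langle>\<a> T ?S \<I> \<cdot> \<pi>1 ((T \<odot> ?S) \<odot> \<I>) (\<J> \<odot> \<I>), \<pi>2 ((T \<odot> ?S) \<odot> \<I>) (\<J> \<odot> \<I>)\<rangle> \<odot> ?W) \<cdot> \<delta> (T \<odot> ?S) (\<J> \<odot> \<I>) \<I> ?W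
          \<cdot> \<langle>\<pi>1 T \<J> \<odot> \<pi>1 ?S (\<I> \<odot> (\<I>\<^sup>- ** ?W)), \<a>' \<J> \<I> (\<I>\<^sup>- ** ?W) \<cdot> (\<pi>2 T \<J> \<odot> \<pi>2 ?S (\<I> \<odot> (\<I>\<^sup>- ** ?W)))\<rangle>)
          \<cdot> ((\<langle>T, \<tau> T\<rangle> \<odot> y') \<cdot> g)"
      unfolding a4 using a1 a2 a3 by (simp del: tensor_comp')
    also have "\<dots> = (?k \<cdot> \<a>' (T ** \<J>) ((?S \<odot> \<I>) ** \<I>) ?W \<cdot> ((T ** \<J>) \<odot> \<delta> ?S \<I> \<I> ?W)) \<cdot> ((\<langle>T, \<tau> T\<rangle> \<odot> y') \<cdot> g)"
      by (simp only: R3)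
    also have "\<dots> = ?k \<cdot> \<a>' (T ** \<J>) ((?S \<odot> \<I>) ** \<I>) ?W \<cdot> (\<langle>T, \<tau> T\<rangle> \<odot> n) \<cdot> g"
      by (simp add: n_def)
    finally have "(\<pi>1 (T \<odot> (?S \<odot> \<I>)) (\<J> \<odot> \<I>) \<odot> ?W) \<cdot> (\<langle>\<a> T ?S \<I> \<cdot> \<pi>1 ((T \<odot> ?S) \<odot> \<I>) (\<J> \<odot> \<I>), \<pi>2 ((T \<odot> ?S) \<odot> \<I>) (\<J> \<odot> \<I>)\<rangle> \<odot> ?W) \<cdot> p g
       = (\<pi>1 (T \<odot> (?S \<odot> \<I>)) (\<J> \<odot> \<I>) \<odot> ?W) \<cdot> ?k \<cdot> \<a>' (T ** \<J>) ((?S \<odot> \<I>) ** \<I>) ?W \<cdot> (\<langle>T, \<tau> T\<rangle> \<odot> n) \<cdot> g"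
      by (simp only:)
    hence "?j \<cdot> p g = ((\<pi>1 T \<J> \<odot> \<pi>1 (?S \<odot> \<I>) \<I>) \<odot> ?W) \<cdot> \<a>' (T ** \<J>) ((?S \<odot> \<I>) ** \<I>) ?W \<cdot> (\<langle>T, \<tau> T\<rangle> \<odot> n) \<cdot> g"
      by simp
    also have "\<dots> = \<a>' T (?S \<odot> \<I>) ?W \<cdot> (\<pi>1 T \<J> \<odot> (\<pi>1 (?S \<odot> \<I>) \<I> \<odot> ?W)) \<cdot> (\<langle>T, \<tau> T\<rangle> \<odot> n) \<cdot> g"
      using ai_nat'[of "\<pi>1 T \<J>" "T ** \<J>" T "\<pi>1 (?S \<odot> \<I>) \<I>" "(?S \<odot> \<I>) ** \<I>" "?S \<odot> \<I>" ?W ?W ?W "(\<langle>T, \<tau> T\<rangle> \<odot> n) \<cdot> g" V]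
      by simp
    finally show ?thesis by (simp add: zz)
  qed
  have "p g = p h" unfolding p_def eq ..
  with p[OF gh(1)] have "(T \<odot> zz) \<cdot> \<a> T (?S \<odot> \<I>) ?W \<cdot> ?j \<cdot> p h = g" by (simp only:)
  with p[OF gh(2)] show ?thesis by (simp only:)
qed

subsection \<open>Hopf monoids\<close>

definition phi_tilde ("\<phi>\<^sup>~") where
  "\<phi>\<^sup>~ X Y = \<r> ((X \<odot> Y)\<^sup>-) \<cdot> (\<pi>2 \<J> ((X \<odot> Y)\<^sup>-) \<odot> \<I>) \<cdot> \<delta>\<^sup>~ \<J> \<I> X Y"

definition psi_tilde ("\<psi>\<^sup>~") where
  "\<psi>\<^sup>~ X Y = \<l> ((X \<odot> Y)\<^sup>-) \<cdot> (\<I> \<odot> \<pi>1 ((X \<odot> Y)\<^sup>-) \<J>) \<cdot> \<gamma>\<^sup>~ X Y \<I> \<J>"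

lemma phi_tilde_ty [simp]: "X \<in> Obj C \<Longrightarrow> Y \<in> Obj C \<Longrightarrow> \<phi>\<^sup>~ X Y \<^bold>: (\<J> \<odot> (\<I> ** X)) ** Y\<^sup>- \<rightarrow> (X \<odot> Y)\<^sup>-"
  and psi_tilde_ty [simp]: "X \<in> Obj C \<Longrightarrow> Y \<in> Obj C \<Longrightarrow> \<psi>\<^sup>~ X Y \<^bold>: X\<^sup>- ** ((Y ** \<I>) \<odot> \<J>) \<rightarrow> (X \<odot> Y)\<^sup>-"
  by (simp_all add: phi_tilde_def psi_tilde_def)

lemma phi_tilde_nat:
  assumes fg [simp]: "f \<^bold>: X \<rightarrow> X'" "g \<^bold>: Y \<rightarrow> Y'" and [simp]: "p \<^bold>: V \<rightarrow> \<J> \<odot> (\<I> ** X)" "z \<^bold>: V \<rightarrow> Y\<^sup>-"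
  shows "\<phi>\<^sup>~ X' Y' \<cdot> \<langle>(\<J> \<odot> \<langle>\<pi>1 \<I> X, f \<cdot> \<pi>2 \<I> X\<rangle>) \<cdot> p, g\<^sup>- \<cdot> z\<rangle> = (f \<odot> g)\<^sup>- \<cdot> \<phi>\<^sup>~ X Y \<cdot> \<langle>p, z\<rangle>"
proof -
  note [simp] = fg[THEN in_homD(4)] fg[THEN in_homD(5)]
  have "\<delta>\<^sup>~ \<J> \<I> X' Y' \<cdot> \<langle>(\<J> \<odot> \<langle>\<pi>1 \<I> X, f \<cdot> \<pi>2 \<I> X\<rangle>) \<cdot> p, g\<^sup>- \<cdot> z\<rangle>
    = (\<langle>\<pi>1 \<J> ((X \<odot> Y)\<^sup>-), (f \<odot> g)\<^sup>- \<cdot> \<pi>2 \<J> ((X \<odot> Y)\<^sup>-)\<rangle> \<odot> \<I>) \<cdot> \<delta>\<^sup>~ \<J> \<I> X Y \<cdot> \<langle>p, z\<rangle>"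
    using arg_cong[OF reversion.delta_tilde_natural[OF rev, of \<J> \<J> \<J> \<I> \<I> \<I> f X X' g Y Y'], of "\<lambda>h. h \<cdot> \<langle>p, z\<rangle>"]
    by (simp add: duo_simps)
  thus ?thesis by (simp add: phi_tilde_def ru_nat'[symmetric, of "(f \<odot> g)\<^sup>-" "(X \<odot> Y)\<^sup>-" "(X' \<odot> Y')\<^sup>-"])
qed

lemma psi_tilde_nat:
  assumes fg [simp]: "f \<^bold>: X \<rightarrow> X'" "g \<^bold>: Y \<rightarrow> Y'" and [simp]: "x \<^bold>: V \<rightarrow> X\<^sup>-" "p \<^bold>: V \<rightarrow> (Y ** \<I>) \<odot> \<J>"
  shows "\<psi>\<^sup>~ X' Y' \<cdot> \<langle>f\<^sup>- \<cdot> x, (\<langle>g \<cdot> \<pi>1 Y \<I>, \<pi>2 Y \<I>\<rangle> \<odot> \<J>) \<cdot> p\<rangle> = (f \<odot> g)\<^sup>- \<cdot> \<psi>\<^sup>~ X Y \<cdot> \<langle>x, p\<rangle>"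
proof -
  note [simp] = fg[THEN in_homD(4)] fg[THEN in_homD(5)]
  have "\<gamma>\<^sup>~ X' Y' \<I> \<J> \<cdot> \<langle>f\<^sup>- \<cdot> x, (\<langle>g \<cdot> \<pi>1 Y \<I>, \<pi>2 Y \<I>\<rangle> \<odot> \<J>) \<cdot> p\<rangle>
    = (\<I> \<odot> \<langle>(f \<odot> g)\<^sup>- \<cdot> \<pi>1 ((X \<odot> Y)\<^sup>-) \<J>, \<pi>2 ((X \<odot> Y)\<^sup>-) \<J>\<rangle>) \<cdot> \<gamma>\<^sup>~ X Y \<I> \<J> \<cdot> \<langle>x, p\<rangle>"
    using arg_cong[OF reversion.gamma_tilde_natural[OF rev, of f X X' g Y Y' \<I> \<I> \<I> \<J> \<J> \<J>], of "\<lambda>h. h \<cdot> \<langle>x, p\<rangle>"]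
    by (simp add: duo_simps)
  thus ?thesis by (simp add: psi_tilde_def lu_nat'[symmetric, of "(f \<odot> g)\<^sup>-" "(X \<odot> Y)\<^sup>-" "(X' \<odot> Y')\<^sup>-"])
qed

lemma psi_tilde_unit:
  assumes [simp]: "x \<^bold>: V \<rightarrow> X\<^sup>-" "p \<^bold>: V \<rightarrow> \<I> \<odot> \<J>" "X \<in> Obj C"
  shows "(\<r> X)\<^sup>- \<cdot> \<psi>\<^sup>~ X \<I> \<cdot> \<langle>x, (\<langle>\<I>, \<I>\<rangle> \<odot> \<J>) \<cdot> p\<rangle> = x"
  using arg_cong[OF reversion.R11[OF rev, of X], of "\<lambda>h. h \<cdot> \<langle>x, p\<rangle>"]
  by (simp add: duo_simps psi_tilde_def)

lemma phi_tilde_unit: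
  assumes [simp]: "z \<^bold>: V \<rightarrow> X\<^sup>-" "p \<^bold>: V \<rightarrow> \<J> \<odot> \<I>" "X \<in> Obj C"
  shows "(\<l> X)\<^sup>- \<cdot> \<phi>\<^sup>~ \<I> X \<cdot> \<langle>(\<J> \<odot> \<langle>\<I>, \<I>\<rangle>) \<cdot> p, z\<rangle> = z"
  using arg_cong[OF reversion.R12[OF rev, of X], of "\<lambda>h. h \<cdot> \<langle>p, z\<rangle>"]
  by (simp add: duo_simps phi_tilde_def)

lemma derived_reversion:
  assumes [simp]: "X \<in> Obj C" "Y \<in> Obj C"
  shows "reversion_data.psi C (cartesian_duoidal C M P) R X Y
      = \<gamma> \<J> X \<I> Y \<cdot> \<langle>(\<langle>\<tau> (X\<^sup>-), X\<^sup>-\<rangle> \<odot> \<I>) \<cdot> \<r>' (X\<^sup>-) \<cdot> \<pi>1 (X\<^sup>-) Y, \<pi>2 (X\<^sup>-) Y\<rangle>"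
    "reversion_data.phi C (cartesian_duoidal C M P) R X Y
      = \<delta> X \<I> Y \<J> \<cdot> \<langle>\<pi>1 X (Y\<^sup>-), (\<I> \<odot> \<langle>Y\<^sup>-, \<tau> (Y\<^sup>-)\<rangle>) \<cdot> \<l>' (Y\<^sup>-) \<cdot> \<pi>2 X (Y\<^sup>-)\<rangle>"
    "reversion_data.psi_tilde C (cartesian_duoidal C M P) R X Y = \<psi>\<^sup>~ X Y"
    "reversion_data.phi_tilde C (cartesian_duoidal C M P) R X Y = \<phi>\<^sup>~ X Y"
  unfolding reversion_data.psi_def reversion_data.phi_def reversion_data.phi_tilde_def
    reversion_data.psi_tilde_def phi_tilde_def psi_tilde_def duo_simps
  by (simp_all add: bul_unitor_inverses)

lemma phi_tilde_psi_tilde: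
  assumes xyz [simp]: "x \<^bold>: V \<rightarrow> X\<^sup>-" "y \<^bold>: V \<rightarrow> Y" "z \<^bold>: V \<rightarrow> Z\<^sup>-"
    and [simp]: "X \<in> Obj C" "Z \<in> Obj C"
  shows "(\<a> X Y Z)\<^sup>- \<cdot> \<phi>\<^sup>~ (X \<odot> Y) Z \<cdot> \<langle>\<gamma> \<J> X \<I> Y \<cdot> \<langle>(\<langle>\<tau> V, x\<rangle> \<odot> \<I>) \<cdot> \<r>' V, y\<rangle>, z\<rangle>
    = \<psi>\<^sup>~ X (Y \<odot> Z) \<cdot> \<langle>x, \<delta> Y \<I> Z \<J> \<cdot> \<langle>y, (\<I> \<odot> \<langle>z, \<tau> V\<rangle>) \<cdot> \<l>' V\<rangle>\<rangle>"
proof -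
  note [simp] = in_homD(4,5)[OF xyz(2)]
  have r: "\<r>' (X\<^sup>-) \<cdot> x = (x \<odot> \<I>) \<cdot> \<r>' V" by (rule ri_nat) simp
  have l: "\<l>' (Z\<^sup>-) \<cdot> z = (\<I> \<odot> z) \<cdot> \<l>' V" by (rule li_nat) simp
  show ?thesis
    using arg_cong[OF reversion.R10[OF rev, of X Y Z], of "\<lambda>h. h \<cdot> \<langle>\<langle>x, y\<rangle>, z\<rangle>"]
    by (simp add: duo_simps derived_reversion r l)
qed

section \<open>Monoids and the uniqueness of antipodes\<close>

definition monoid_obj where
  "monoid_obj G m u \<longleftrightarrow> G \<in> Obj C \<and> m \<^bold>: G \<odot> G \<rightarrow> G \<and> u \<^bold>: \<I> \<rightarrow> G \<and>
    m \<cdot> (m \<odot> G) = m \<cdot> (G \<odot> m) \<cdot> \<a> G G G \<and> m \<cdot> (u \<odot> G) = \<l> G \<and> m \<cdot> (G \<odot> u) = \<r> G"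

lemma monoid_objD:
  assumes "monoid_obj G m u"
  shows "G \<in> Obj C" "m \<^bold>: G \<odot> G \<rightarrow> G" "u \<^bold>: \<I> \<rightarrow> G"
    "m \<cdot> (m \<odot> G) = m \<cdot> (G \<odot> m) \<cdot> \<a> G G G" "m \<cdot> (u \<odot> G) = \<l> G" "m \<cdot> (G \<odot> u) = \<r> G"
  using assms by (simp_all add: monoid_obj_def)

text \<open>The usual argument \<open>s = s * (f * t) = (s * f) * t = t\<close>, with (R10) in the role of associativity and
  (R11), (R12) in the role of unitality.\<close>

lemma convolution_inverse_unique:
  assumes K: "monoid_obj K m u"
    and fs [simp]: "f \<^bold>: V \<rightarrow> K" "s \<^bold>: V \<rightarrow> K\<^sup>-" "t \<^bold>: V \<rightarrow> K\<^sup>-"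
    and pq [simp]: "p \<^bold>: V \<rightarrow> \<J> \<odot> \<I>" "q \<^bold>: V \<rightarrow> \<I> \<odot> \<J>"
    and s: "(\<J> \<odot> \<langle>\<pi>1 \<I> (K \<odot> K), m \<cdot> \<pi>2 \<I> (K \<odot> K)\<rangle>) \<cdot> \<gamma> \<J> K \<I> K \<cdot> \<langle>(\<langle>\<tau> V, s\<rangle> \<odot> \<I>) \<cdot> \<r>' V, f\<rangle> = (\<J> \<odot> \<langle>\<I>, u\<rangle>) \<cdot> p"
    and t: "(\<langle>m \<cdot> \<pi>1 (K \<odot> K) \<I>, \<pi>2 (K \<odot> K) \<I>\<rangle> \<odot> \<J>) \<cdot> \<delta> K \<I> K \<J> \<cdot> \<langle>f, (\<I> \<odot> \<langle>t, \<tau> V\<rangle>) \<cdot> \<l>' V\<rangle> = (\<langle>u, \<I>\<rangle> \<odot> \<J>) \<cdot> q"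
  shows "s = t"
proof -
  note [simp] = monoid_objD(1-3)[OF K] in_homD(4)[OF fs(1)]
  let ?p = "\<gamma> \<J> K \<I> K \<cdot> \<langle>(\<langle>\<tau> V, s\<rangle> \<odot> \<I>) \<cdot> \<r>' V, f\<rangle>"
  let ?q = "\<delta> K \<I> K \<J> \<cdot> \<langle>f, (\<I> \<odot> \<langle>t, \<tau> V\<rangle>) \<cdot> \<l>' V\<rangle>"
  have "m\<^sup>- \<cdot> (m \<odot> K)\<^sup>- \<cdot> \<phi>\<^sup>~ (K \<odot> K) K \<cdot> \<langle>?p, t\<rangle> = m\<^sup>- \<cdot> \<phi>\<^sup>~ K K \<cdot> \<langle>(\<J> \<odot> \<langle>\<pi>1 \<I> (K \<odot> K), m \<cdot> \<pi>2 \<I> (K \<odot> K)\<rangle>) \<cdot> ?p, t\<rangle>"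
    using phi_tilde_nat[of m "K \<odot> K" K K K K ?p V t] by simp
  also have "\<dots> = m\<^sup>- \<cdot> \<phi>\<^sup>~ K K \<cdot> \<langle>(\<J> \<odot> \<langle>\<I>, u\<rangle>) \<cdot> p, t\<rangle>" by (simp only: s)
  also have "\<dots> = m\<^sup>- \<cdot> (u \<odot> K)\<^sup>- \<cdot> \<phi>\<^sup>~ \<I> K \<cdot> \<langle>(\<J> \<odot> \<langle>\<I>, \<I>\<rangle>) \<cdot> p, t\<rangle>"
    using phi_tilde_nat[of u \<I> K K K K "(\<J> \<odot> \<langle>\<I>, \<I>\<rangle>) \<cdot> p" V t] by simp
  also have "\<dots> = (m \<cdot> (u \<odot> K))\<^sup>- \<cdot> \<phi>\<^sup>~ \<I> K \<cdot> \<langle>(\<J> \<odot> \<langle>\<I>, \<I>\<rangle>) \<cdot> p, t\<rangle>" by simp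
  also have "\<dots> = t" unfolding monoid_objD(5)[OF K] by (subst phi_tilde_unit) simp_all
  finally have 1: "m\<^sup>- \<cdot> (m \<odot> K)\<^sup>- \<cdot> \<phi>\<^sup>~ (K \<odot> K) K \<cdot> \<langle>?p, t\<rangle> = t" .
  \<comment> \<open>The arrow just computed as \<open>(s * f) * t = t\<close> is now rebracketed to
    \<open>s * (f * t)\<close>.\<close>
  have "m\<^sup>- \<cdot> (m \<odot> K)\<^sup>- \<cdot> \<phi>\<^sup>~ (K \<odot> K) K \<cdot> \<langle>?p, t\<rangle> = (m \<cdot> (m \<odot> K))\<^sup>- \<cdot> \<phi>\<^sup>~ (K \<odot> K) K \<cdot> \<langle>?p, t\<rangle>" by simp
  also have "\<dots> = m\<^sup>- \<cdot> (K \<odot> m)\<^sup>- \<cdot> (\<a> K K K)\<^sup>- \<cdot> \<phi>\<^sup>~ (K \<odot> K) K \<cdot> \<langle>?p, t\<rangle>" unfolding monoid_objD(4)[OF K] by simp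
  also have "\<dots> = m\<^sup>- \<cdot> (K \<odot> m)\<^sup>- \<cdot> \<psi>\<^sup>~ K (K \<odot> K) \<cdot> \<langle>s, ?q\<rangle>"
    by (subst phi_tilde_psi_tilde) simp_all
  also have "\<dots> = m\<^sup>- \<cdot> \<psi>\<^sup>~ K K \<cdot> \<langle>s, (\<langle>m \<cdot> \<pi>1 (K \<odot> K) \<I>, \<pi>2 (K \<odot> K) \<I>\<rangle> \<odot> \<J>) \<cdot> ?q\<rangle>"
    using psi_tilde_nat[of K K K m "K \<odot> K" K s V ?q] by simp
  also have "\<dots> = m\<^sup>- \<cdot> \<psi>\<^sup>~ K K \<cdot> \<langle>s, (\<langle>u, \<I>\<rangle> \<odot> \<J>) \<cdot> q\<rangle>" by (simp only: t)
  also have "\<dots> = m\<^sup>- \<cdot> (K \<odot> u)\<^sup>- \<cdot> \<psi>\<^sup>~ K \<I> \<cdot> \<langle>s, (\<langle>\<I>, \<I>\<rangle> \<odot> \<J>) \<cdot> q\<rangle>"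
    using psi_tilde_nat[of K K K u \<I> K s V "(\<langle>\<I>, \<I>\<rangle> \<odot> \<J>) \<cdot> q"] by simp
  also have "\<dots> = (m \<cdot> (K \<odot> u))\<^sup>- \<cdot> \<psi>\<^sup>~ K \<I> \<cdot> \<langle>s, (\<langle>\<I>, \<I>\<rangle> \<odot> \<J>) \<cdot> q\<rangle>" by simp
  also have "\<dots> = s" unfolding monoid_objD(6)[OF K] by (subst psi_tilde_unit) simp_all
  finally show ?thesis using 1 by simp
qed

text \<open>The antipode equations with the diagonal and the unique arrow to \<open>J\<close>
  already inserted, and with \<open>Delta R\<close> and \<open>Gamma R\<close> in place of the
  derived transformations; \<open>antipode_iff\<close> is the translation. Separate arguments
  instead of a record allow a structure to be assembled before a group exists.\<close>

definition hopf where
  "hopf G m u S \<longleftrightarrow> monoid_obj G m u \<and> S \<^bold>: G \<rightarrow> G\<^sup>- \<and>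
    (\<langle>m \<cdot> \<pi>1 (G \<odot> G) \<I>, \<pi>2 (G \<odot> G) \<I>\<rangle> \<odot> \<J>) \<cdot> \<delta> G \<I> G \<J> \<cdot> \<langle>G, (\<I> \<odot> \<langle>S, \<tau> G\<rangle>) \<cdot> \<l>' G\<rangle>
      = (\<langle>u, \<I>\<rangle> \<odot> \<tau> G) \<cdot> \<l>' G \<and>
    (\<J> \<odot> \<langle>\<pi>1 \<I> (G \<odot> G), m \<cdot> \<pi>2 \<I> (G \<odot> G)\<rangle>) \<cdot> \<gamma> \<J> G \<I> G \<cdot> \<langle>(\<langle>\<tau> G, S\<rangle> \<odot> \<I>) \<cdot> \<r>' G, G\<rangle>
      = (\<tau> G \<odot> \<langle>\<I>, u\<rangle>) \<cdot> \<r>' G"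

lemma hopfD:
  assumes "hopf G m u S"
  shows "monoid_obj G m u" "S \<^bold>: G \<rightarrow> G\<^sup>-" "G \<in> Obj C" "m \<^bold>: G \<odot> G \<rightarrow> G" "u \<^bold>: \<I> \<rightarrow> G"
  using assms monoid_objD[of G m u] by (auto simp: hopf_def)

lemma hopf_delta:
  assumes "hopf G m u S" and x [simp]: "x \<^bold>: V \<rightarrow> G"
  shows "(\<langle>m \<cdot> \<pi>1 (G \<odot> G) \<I>, \<pi>2 (G \<odot> G) \<I>\<rangle> \<odot> \<J>) \<cdot> \<delta> G \<I> G \<J> \<cdot> \<langle>x, (\<I> \<odot> \<langle>S \<cdot> x, \<tau> V\<rangle>) \<cdot> \<l>' V\<rangle>
      = (\<langle>u, \<I>\<rangle> \<odot> \<tau> V) \<cdot> \<l>' V"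
proof -
  note [simp] = hopfD(2-5)[OF assms(1)] in_homD(4)[OF x]
  have l: "\<l>' G \<cdot> x = (\<I> \<odot> x) \<cdot> \<l>' V" by (rule li_nat) simp
  have "(\<langle>m \<cdot> \<pi>1 (G \<odot> G) \<I>, \<pi>2 (G \<odot> G) \<I>\<rangle> \<odot> \<J>) \<cdot> \<delta> G \<I> G \<J> \<cdot> \<langle>G, (\<I> \<odot> \<langle>S, \<tau> G\<rangle>) \<cdot> \<l>' G\<rangle>
      = (\<langle>u, \<I>\<rangle> \<odot> \<tau> G) \<cdot> \<l>' G"
    using assms(1) by (simp only: hopf_def)
  from arg_cong[OF this, of "\<lambda>h. h \<cdot> x"] show ?thesis by (simp add: l)
qed

lemma hopf_gamma:
  assumes "hopf G m u S" and x [simp]: "x \<^bold>: V \<rightarrow> G"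
  shows "(\<J> \<odot> \<langle>\<pi>1 \<I> (G \<odot> G), m \<cdot> \<pi>2 \<I> (G \<odot> G)\<rangle>) \<cdot> \<gamma> \<J> G \<I> G \<cdot> \<langle>(\<langle>\<tau> V, S \<cdot> x\<rangle> \<odot> \<I>) \<cdot> \<r>' V, x\<rangle>
      = (\<tau> V \<odot> \<langle>\<I>, u\<rangle>) \<cdot> \<r>' V"
proof -
  note [simp] = hopfD(2-5)[OF assms(1)] in_homD(4)[OF x]
  have r: "\<r>' G \<cdot> x = (x \<odot> \<I>) \<cdot> \<r>' V" by (rule ri_nat) simp
  have "(\<J> \<odot> \<langle>\<pi>1 \<I> (G \<odot> G), m \<cdot> \<pi>2 \<I> (G \<odot> G)\<rangle>) \<cdot> \<gamma> \<J> G \<I> G \<cdot> \<langle>(\<langle>\<tau> G, S\<rangle> \<odot> \<I>) \<cdot> \<r>' G, G\<rangle>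
      = (\<tau> G \<odot> \<langle>\<I>, u\<rangle>) \<cdot> \<r>' G"
    using assms(1) by (simp only: hopf_def)
  from arg_cong[OF this, of "\<lambda>h. h \<cdot> x"] show ?thesis by (simp add: r)
qed

definition monoid_hom where
  "monoid_hom G m u f K m' u' \<longleftrightarrow> f \<^bold>: G \<rightarrow> K \<and> f \<cdot> m = m' \<cdot> (f \<odot> f) \<and> f \<cdot> u = u'"

text \<open>Both sides are convolution inverses of \<open>f\<close>: the left-hand side is a left
  inverse by naturality of \<open>Gamma R\<close> and the antipode equation of \<open>G\<close>, the
  right-hand side is a right inverse by the antipode equation of \<open>K\<close>.\<close>

lemma antipode_hom:
  assumes G: "hopf G m u S" and K: "hopf K m' u' S'" and f: "monoid_hom G m u f K m' u'"
  shows "f\<^sup>- \<cdot> S = S' \<cdot> f"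
proof -
  have fhom [simp]: "f \<^bold>: G \<rightarrow> K" and fm: "f \<cdot> m = m' \<cdot> (f \<odot> f)" and fu: "f \<cdot> u = u'"
    using f by (simp_all add: monoid_hom_def)
  note [simp] = hopfD(2-5)[OF G] hopfD(2-5)[OF K]
  show ?thesis
  proof (rule convolution_inverse_unique[OF hopfD(1)[OF K], of f G _ _ "(\<tau> G \<odot> \<I>) \<cdot> \<r>' G" "(\<I> \<odot> \<tau> G) \<cdot> \<l>' G"])
    have "(\<J> \<odot> \<langle>\<pi>1 \<I> (K \<odot> K), m' \<cdot> \<pi>2 \<I> (K \<odot> K)\<rangle>) \<cdot> \<gamma> \<J> K \<I> K \<cdot> \<langle>(\<langle>\<tau> G, f\<^sup>- \<cdot> S\<rangle> \<odot> \<I>) \<cdot> \<r>' G, f\<rangle>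
       = (\<J> \<odot> \<langle>\<pi>1 \<I> (G \<odot> G), (m' \<cdot> (f \<odot> f)) \<cdot> \<pi>2 \<I> (G \<odot> G)\<rangle>) \<cdot> \<gamma> \<J> G \<I> G \<cdot> \<langle>(\<langle>\<tau> G, S\<rangle> \<odot> \<I>) \<cdot> \<r>' G, G\<rangle>"
      using gamma_nat[of \<J> \<J> \<J> f G K \<I> \<I> \<I> f G K "\<tau> G" G S \<I> \<I> "\<r>' G" G G] by simp
    also have "\<dots> = (\<J> \<odot> \<langle>\<pi>1 \<I> G, f \<cdot> \<pi>2 \<I> G\<rangle>) \<cdot> ((\<J> \<odot> \<langle>\<pi>1 \<I> (G \<odot> G), m \<cdot> \<pi>2 \<I> (G \<odot> G)\<rangle>) \<cdot> \<gamma> \<J> G \<I> G \<cdot> \<langle>(\<langle>\<tau> G, S \<cdot> G\<rangle> \<odot> \<I>) \<cdot> \<r>' G, G\<rangle>)"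
      unfolding fm[symmetric] by simp
    also have "\<dots> = (\<J> \<odot> \<langle>\<I>, u'\<rangle>) \<cdot> (\<tau> G \<odot> \<I>) \<cdot> \<r>' G"
      by (subst hopf_gamma[OF G]) (simp_all add: fu)
    finally show "(\<J> \<odot> \<langle>\<pi>1 \<I> (K \<odot> K), m' \<cdot> \<pi>2 \<I> (K \<odot> K)\<rangle>) \<cdot> \<gamma> \<J> K \<I> K \<cdot> \<langle>(\<langle>\<tau> G, f\<^sup>- \<cdot> S\<rangle> \<odot> \<I>) \<cdot> \<r>' G, f\<rangle> = \<dots>" .
    show "(\<langle>m' \<cdot> \<pi>1 (K \<odot> K) \<I>, \<pi>2 (K \<odot> K) \<I>\<rangle> \<odot> \<J>) \<cdot> \<delta> K \<I> K \<J> \<cdot> \<langle>f, (\<I> \<odot> \<langle>S' \<cdot> f, \<tau> G\<rangle>) \<cdot> \<l>' G\<rangle>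
        = (\<langle>u', \<I>\<rangle> \<odot> \<J>) \<cdot> (\<I> \<odot> \<tau> G) \<cdot> \<l>' G"
      by (subst hopf_delta[OF K]) simp_all
  qed simp_all
qed

lemma phi_circ_ty [simp]: "X \<in> Obj C \<Longrightarrow> Y \<in> Obj C \<Longrightarrow> PhiCirc R X Y \<^bold>: X\<^sup>- \<odot> Y\<^sup>- \<rightarrow> (Y \<odot> X)\<^sup>-"
  using reversion.phi_circ_lax[OF rev]
  unfolding lax_monoidal_functor_def reverse_monoidal_def Hom_iff duo_simps by simp

lemma phi_circ_unit: "Y \<in> Obj C \<Longrightarrow> (\<l> Y)\<^sup>- \<cdot> PhiCirc R Y \<I> \<cdot> (Y\<^sup>- \<odot> \<phi>0) = \<r> (Y\<^sup>-)"
  using reversion.phi_circ_lax[OF rev]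
  unfolding lax_monoidal_functor_def reverse_monoidal_def duo_simps by simp

text \<open>(R9) with \<open>Z = I\<close>: the equality \<open>(x y\<inverse>) t = x (y\<inverse> t)\<close>, where the bracketing on the left is expressed by \<open>\<delta>\<close>
  and the inner one on the right by \<open>\<gamma>\<close>.\<close>

lemma delta_assoc:
  assumes xyt [simp]: "x \<^bold>: V \<rightarrow> X" "y \<^bold>: V \<rightarrow> Y\<^sup>-" "t \<^bold>: V \<rightarrow> U" and [simp]: "Y \<in> Obj C"
  shows "\<a> X Y U \<cdot> (\<pi>1 (X \<odot> Y) \<I> \<odot> U) \<cdot> \<delta> X \<I> Y U \<cdot> \<langle>x, (\<I> \<odot> \<langle>y, t\<rangle>) \<cdot> \<l>' V\<rangle>
    = ((\<r> X \<cdot> \<pi>1 (X \<odot> \<I>) (\<J> \<odot> \<J>)) \<odot> (Y \<odot> U)) \<cdot> \<delta> X (\<J> \<odot> \<J>) \<I> (Y \<odot> U)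
        \<cdot> \<langle>x, \<a>' \<J> \<J> (\<I>\<^sup>- ** (Y \<odot> U)) \<cdot> (\<tau> \<I> \<odot> ((\<J> \<odot> \<langle>\<phi>0 \<cdot> \<pi>1 \<I> (Y \<odot> U), \<pi>2 \<I> (Y \<odot> U)\<rangle>)
            \<cdot> \<gamma> \<J> Y \<I> U \<cdot> \<langle>(\<langle>\<tau> V, y\<rangle> \<odot> \<I>) \<cdot> \<r>' V, t\<rangle>)) \<cdot> \<l>' V\<rangle>"
proof -
  note [simp] = in_homD(4,5)[OF xyt(1)] in_homD(5)[OF xyt(3)]
  \<comment> \<open>The argument at which \<open>R9\<close> is evaluated. Since \<open>R9\<close>
    has \<open>J\<close> where the claim has \<open>I\<close>, it contains
    \<open>\<tau> \<I>\<close>; the facts \<open>d\<close> and \<open>d'\<close> lead back to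
    \<open>I\<close> and remove the unit coming from \<open>Z = I\<close>.\<close>
  let ?c = "(\<tau> \<I> \<odot> \<langle>(y \<odot> \<phi>0) \<cdot> \<r>' V, t\<rangle>) \<cdot> \<l>' V"
  let ?Q = "Y \<odot> U"
  have g: "(\<J> \<odot> \<langle>\<phi>0 \<cdot> \<pi>1 \<I> ?Q, \<pi>2 \<I> ?Q\<rangle>) \<cdot> \<gamma> \<J> Y \<I> U \<cdot> \<langle>(\<langle>\<tau> V, y\<rangle> \<odot> \<I>) \<cdot> \<r>' V, t\<rangle>
      = \<gamma> \<J> Y (\<I>\<^sup>-) U \<cdot> \<langle>(\<langle>\<tau> V, y\<rangle> \<odot> \<phi>0) \<cdot> \<r>' V, t\<rangle>"
    using gamma_nat[of \<J> \<J> \<J> Y Y Y \<phi>0 \<I> "\<I>\<^sup>-" U U U "\<tau> V" V y \<I> \<I> "\<r>' V" V t] by simp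
  have pc: "(\<l> Y)\<^sup>- \<cdot> PhiCirc R Y \<I> \<cdot> (y \<odot> \<phi>0) \<cdot> \<r>' V = y"
  proof -
    have "(\<l> Y)\<^sup>- \<cdot> PhiCirc R Y \<I> \<cdot> (y \<odot> \<phi>0) \<cdot> \<r>' V = ((\<l> Y)\<^sup>- \<cdot> PhiCirc R Y \<I> \<cdot> (Y\<^sup>- \<odot> \<phi>0)) \<cdot> (y \<odot> \<I>) \<cdot> \<r>' V"
      by simp
    also have "\<dots> = y" unfolding phi_circ_unit[OF \<open>Y \<in> Obj C\<close>] by (simp add: ru_nat')
    finally show ?thesis .
  qed
  have tri: "(\<r> X \<odot> Y) \<cdot> \<a>' X \<I> Y = X \<odot> \<l> Y"
    using arg_cong[OF triangle[of X Y], of "\<lambda>f. f \<cdot> \<a>' X \<I> Y"] by simp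
  let ?d = "\<delta> X \<J> (\<I> \<odot> Y) U \<cdot> \<langle>x, (\<tau> \<I> \<odot> \<langle>PhiCirc R Y \<I> \<cdot> (y \<odot> \<phi>0) \<cdot> \<r>' V, t\<rangle>) \<cdot> \<l>' V\<rangle>"
  have d: "(\<langle>(X \<odot> \<l> Y) \<cdot> \<pi>1 (X \<odot> (\<I> \<odot> Y)) \<J>, \<pi>2 (X \<odot> (\<I> \<odot> Y)) \<J>\<rangle> \<odot> U) \<cdot> ?d
      = \<delta> X \<J> Y U \<cdot> \<langle>x, (\<tau> \<I> \<odot> \<langle>y, t\<rangle>) \<cdot> \<l>' V\<rangle>"
    using delta_nat[of X X X \<J> \<J> \<J> "\<l> Y" "\<I> \<odot> Y" Y U U U x V "\<tau> \<I>" \<I> "PhiCirc R Y \<I> \<cdot> (y \<odot> \<phi>0) \<cdot> \<r>' V" V t "\<l>' V"]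
    by (simp add: pc)
  have d': "\<delta> X \<J> Y U \<cdot> \<langle>x, (\<tau> \<I> \<odot> \<langle>y, t\<rangle>) \<cdot> \<l>' V\<rangle>
      = (\<langle>\<pi>1 (X \<odot> Y) \<I>, \<tau> ((X \<odot> Y) ** \<I>)\<rangle> \<odot> U) \<cdot> \<delta> X \<I> Y U \<cdot> \<langle>x, (\<I> \<odot> \<langle>y, t\<rangle>) \<cdot> \<l>' V\<rangle>"
    using delta_nat[of X X X "\<tau> \<I>" \<I> \<J> Y Y Y U U U x V \<I> \<I> y V t "\<l>' V"] by simp
  let ?post = "(\<r> X \<cdot> \<pi>1 (X \<odot> \<I>) (\<J> \<odot> \<J>)) \<odot> ?Q"
  have "?post \<cdot> \<delta> X (\<J> \<odot> \<J>) \<I> ?Q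
        \<cdot> \<langle>x, \<a>' \<J> \<J> (\<I>\<^sup>- ** ?Q) \<cdot> (\<tau> \<I> \<odot> (\<gamma> \<J> Y (\<I>\<^sup>-) U \<cdot> \<langle>(\<langle>\<tau> V, y\<rangle> \<odot> \<phi>0) \<cdot> \<r>' V, t\<rangle>)) \<cdot> \<l>' V\<rangle>
      = (\<r> X \<odot> ?Q) \<cdot> \<a> (X \<odot> \<I>) Y U \<cdot> ((\<a>' X \<I> Y \<cdot> \<pi>1 (X \<odot> (\<I> \<odot> Y)) \<J>) \<odot> U) \<cdot> ?d"
    using arg_cong[OF reversion.R9[OF rev, of X Y \<I> U], of "\<lambda>f. ?post \<cdot> f \<cdot> \<langle>x, ?c\<rangle>"]
    by (simp add: duo_simps bul_unitor_inverses)
  also have "\<dots> = \<a> X Y U \<cdot> ((\<r> X \<odot> Y) \<odot> U) \<cdot> ((\<a>' X \<I> Y \<cdot> \<pi>1 (X \<odot> (\<I> \<odot> Y)) \<J>) \<odot> U) \<cdot> ?d"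
    by (subst as_nat'[of "\<r> X" "X \<odot> \<I>" X Y Y Y U U U _ V]) simp_all
  also have "\<dots> = \<a> X Y U \<cdot> ((((\<r> X \<odot> Y) \<cdot> \<a>' X \<I> Y) \<cdot> \<pi>1 (X \<odot> (\<I> \<odot> Y)) \<J>) \<odot> U) \<cdot> ?d"
    by simp
  also have "\<dots> = \<a> X Y U \<cdot> (\<pi>1 (X \<odot> Y) \<J> \<odot> U) \<cdot> (\<langle>(X \<odot> \<l> Y) \<cdot> \<pi>1 (X \<odot> (\<I> \<odot> Y)) \<J>, \<pi>2 (X \<odot> (\<I> \<odot> Y)) \<J>\<rangle> \<odot> U) \<cdot> ?d"
    unfolding tri by simp
  also have "\<dots> = \<a> X Y U \<cdot> (\<pi>1 (X \<odot> Y) \<I> \<odot> U) \<cdot> \<delta> X \<I> Y U \<cdot> \<langle>x, (\<I> \<odot> \<langle>y, t\<rangle>) \<cdot> \<l>' V\<rangle>"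
    unfolding d d' by simp
  finally show ?thesis unfolding g by (rule sym)
qed

text \<open>In spans, \<open>rdiv\<close> is \<open>(x y\<inverse>, t)\<close> for parallel \<open>x\<close>, \<open>y\<close>, \<open>t\<close>; here \<open>x y\<inverse>\<close> is a loop, which is recorded
  by the component in \<open>I\<close>.\<close>

definition rdiv where
  "rdiv G m S x y t = (\<langle>m \<cdot> \<pi>1 (G \<odot> G) \<I>, \<pi>2 (G \<odot> G) \<I>\<rangle> \<odot> Cod C t) \<cdot> \<delta> G \<I> G (Cod C t)
    \<cdot> \<langle>x, (\<I> \<odot> \<langle>S \<cdot> y, t\<rangle>) \<cdot> \<l>' (Dom C t)\<rangle>"

lemma rdiv_ty:
  assumes "hopf G m u S" "x \<^bold>: V \<rightarrow> G" "y \<^bold>: V \<rightarrow> G" "t \<^bold>: V \<rightarrow> T"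
  shows "rdiv G m S x y t \<^bold>: V \<rightarrow> (G ** \<I>) \<odot> T"
  using assms(2-) hopfD(2-)[OF assms(1)] in_homD(4,5)[OF assms(4)] by (simp add: rdiv_def)

lemma rdiv_comp:
  assumes "hopf G m u S" and [simp]: "x \<^bold>: V \<rightarrow> G" "y \<^bold>: V \<rightarrow> G" and t [simp]: "t \<^bold>: V \<rightarrow> T" and h [simp]: "h \<^bold>: W \<rightarrow> V"
  shows "rdiv G m S x y t \<cdot> h = rdiv G m S (x \<cdot> h) (y \<cdot> h) (t \<cdot> h)"
proof -
  note [simp] = hopfD(2-)[OF assms(1)] in_homD(4,5)[OF t] in_homD(4)[OF h]
  have l: "\<l>' V \<cdot> h = (\<I> \<odot> h) \<cdot> \<l>' W" by (rule li_nat) simp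
  show ?thesis by (simp add: rdiv_def l)
qed

lemma rdiv_post:
  assumes "hopf G m u S" and [simp]: "x \<^bold>: V \<rightarrow> G" "y \<^bold>: V \<rightarrow> G" and t [simp]: "t \<^bold>: V \<rightarrow> T" and k [simp]: "k \<^bold>: T \<rightarrow> T'"
  shows "((G ** \<I>) \<odot> k) \<cdot> rdiv G m S x y t = rdiv G m S x y (k \<cdot> t)"
proof -
  note [simp] = hopfD(2-)[OF assms(1)] in_homD(4,5)[OF t] in_homD(5)[OF k]
  show ?thesis 
    using delta_nat[of G G G \<I> \<I> \<I> G G G k T T' x V \<I> \<I> "S \<cdot> y" V t "\<l>' V"] by (simp add: rdiv_def)
qed

lemma rdiv_hom:
  assumes G: "hopf G m u S" and K: "hopf K m' u' S'" and f: "monoid_hom G m u f K m' u'"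
    and [simp]: "x \<^bold>: V \<rightarrow> G" and y [simp]: "y \<^bold>: V \<rightarrow> G" and t [simp]: "t \<^bold>: V \<rightarrow> T"
  shows "(\<langle>f \<cdot> \<pi>1 G \<I>, \<pi>2 G \<I>\<rangle> \<odot> T) \<cdot> rdiv G m S x y t = rdiv K m' S' (f \<cdot> x) (f \<cdot> y) t"
proof -
  note [simp] = hopfD(2-)[OF G] hopfD(2-)[OF K] in_homD(4,5)[OF t]
  have fhom [simp]: "f \<^bold>: G \<rightarrow> K" and fm: "f \<cdot> m = m' \<cdot> (f \<odot> f)"
    using f by (simp_all add: monoid_hom_def)
  have s: "S' \<cdot> f \<cdot> y = f\<^sup>- \<cdot> S \<cdot> y" 
    using arg_cong[OF antipode_hom[OF G K f], of "\<lambda>h. h \<cdot> y"] by simp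
  have "(\<langle>f \<cdot> \<pi>1 G \<I>, \<pi>2 G \<I>\<rangle> \<odot> T) \<cdot> rdiv G m S x y t
    = (\<langle>(f \<cdot> m) \<cdot> \<pi>1 (G \<odot> G) \<I>, \<pi>2 (G \<odot> G) \<I>\<rangle> \<odot> T) \<cdot> \<delta> G \<I> G T \<cdot> \<langle>x, (\<I> \<odot> \<langle>S \<cdot> y, t\<rangle>) \<cdot> \<l>' V\<rangle>"
    by (simp add: rdiv_def)
  also have "\<dots> = (\<langle>m' \<cdot> \<pi>1 (K \<odot> K) \<I>, \<pi>2 (K \<odot> K) \<I>\<rangle> \<odot> T)
      \<cdot> ((\<langle>(f \<odot> f) \<cdot> \<pi>1 (G \<odot> G) \<I>, \<pi>2 (G \<odot> G) \<I>\<rangle> \<odot> T) \<cdot> \<delta> G \<I> G T \<cdot> \<langle>x, (\<I> \<odot> \<langle>S \<cdot> y, t\<rangle>) \<cdot> \<l>' V\<rangle>)"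
    unfolding fm by simp
  also have "(\<langle>(f \<odot> f) \<cdot> \<pi>1 (G \<odot> G) \<I>, \<pi>2 (G \<odot> G) \<I>\<rangle> \<odot> T) \<cdot> \<delta> G \<I> G T \<cdot> \<langle>x, (\<I> \<odot> \<langle>S \<cdot> y, t\<rangle>) \<cdot> \<l>' V\<rangle>
      = \<delta> K \<I> K T \<cdot> \<langle>f \<cdot> x, (\<I> \<odot> \<langle>f\<^sup>- \<cdot> S \<cdot> y, t\<rangle>) \<cdot> \<l>' V\<rangle>"
    using delta_nat[of f G K \<I> \<I> \<I> f G K T T T x V \<I> \<I> "S \<cdot> y" V t "\<l>' V"] by simp
  finally show ?thesis by (simp add: rdiv_def s)
qed

lemma rdiv_proj:
  assumes "hopf G m u S" and [simp]: "x \<^bold>: V \<rightarrow> G" "y \<^bold>: V \<rightarrow> G" and t [simp]: "t \<^bold>: V \<rightarrow> T"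
  shows "(\<pi>2 G \<I> \<odot> T) \<cdot> rdiv G m S x y t = (\<I> \<odot> t) \<cdot> \<l>' V"
proof -
  note [simp] = hopfD(2-)[OF assms(1)] in_homD(4,5)[OF t]
  show ?thesis using delta_proj[of x V G \<I> \<I> \<I> "S \<cdot> y" V G t T "\<l>' V"] by (simp add: rdiv_def)
qed

lemma rdiv_self_terminal:
  assumes "hopf G m u S" and x [simp]: "x \<^bold>: V \<rightarrow> G"
  shows "rdiv G m S x x (\<tau> V) = (\<langle>u, \<I>\<rangle> \<odot> \<tau> V) \<cdot> \<l>' V"
  using hopf_delta[OF assms] in_homD(4)[OF x] by (simp add: rdiv_def)

text \<open>The antipode equation covers only \<open>T = J\<close>. For general \<open>T\<close> the
  result is separated into its component over \<open>J\<close>, which is that equation, and its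
  component that keeps \<open>T\<close> but forgets \<open>G\<close>, which \<open>rdiv_proj\<close>
  computes. Taking \<open>Z = J\<close> in \<open>separation_right\<close> says that these two
  suffice.\<close>

lemma rdiv_self:
  assumes G: "hopf G m u S" and x [simp]: "x \<^bold>: V \<rightarrow> G" and t [simp]: "t \<^bold>: V \<rightarrow> T"
  shows "rdiv G m S x x t = (\<langle>u, \<I>\<rangle> \<odot> t) \<cdot> \<l>' V"
proof (rule separation_right[where ?y1.0 = "G ** \<I>" and ?y2.0 = "\<langle>\<tau> (G ** \<I>), \<pi>2 G \<I>\<rangle>" and X = G and Z = \<J> and T = T
      and z = "\<pi>1 (G ** \<I>) (\<J> ** \<I>)"])
  note [simp] = hopfD(2-)[OF G] in_homD(4,5)[OF t] rdiv_ty[OF G]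
  show "((G ** \<I>) \<odot> \<tau> T) \<cdot> rdiv G m S x x t = ((G ** \<I>) \<odot> \<tau> T) \<cdot> (\<langle>u, \<I>\<rangle> \<odot> t) \<cdot> \<l>' V"
    using rdiv_post[OF G x x t, of "\<tau> T" \<J>] rdiv_self_terminal[OF G x] by simp
  have "(\<langle>\<tau> (G ** \<I>), \<pi>2 G \<I>\<rangle> \<odot> T) \<cdot> rdiv G m S x x t = (\<langle>\<tau> \<I>, \<I>\<rangle> \<odot> T) \<cdot> (\<pi>2 G \<I> \<odot> T) \<cdot> rdiv G m S x x t"
    by simp
  also have "\<dots> = (\<langle>\<tau> \<I>, \<I>\<rangle> \<odot> T) \<cdot> (\<I> \<odot> t) \<cdot> \<l>' V" by (simp only: rdiv_proj[OF G x x t])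
  finally show "(\<langle>\<tau> (G ** \<I>), \<pi>2 G \<I>\<rangle> \<odot> T) \<cdot> rdiv G m S x x t = (\<langle>\<tau> (G ** \<I>), \<pi>2 G \<I>\<rangle> \<odot> T) \<cdot> (\<langle>u, \<I>\<rangle> \<odot> t) \<cdot> \<l>' V"
    by simp
qed (use hopfD(2-)[OF G] in_homD(4,5)[OF t] rdiv_ty[OF G] in simp_all)

text \<open>\<open>(x y^-1) y = x (y^-1 y) = x\<close>: \<open>delta_assoc\<close> rebrackets,
  \<open>hopf_gamma\<close> evaluates the inner product, and \<open>delta_unit\<close> removes the
  resulting unit.\<close>

lemma rdiv_cancel:
  assumes G: "hopf G m u S" and x [simp]: "x \<^bold>: V \<rightarrow> G" and y [simp]: "y \<^bold>: V \<rightarrow> G"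
  shows "m \<cdot> (\<pi>1 G \<I> \<odot> G) \<cdot> rdiv G m S x y y = x"
proof -
  note [simp] = hopfD(2-)[OF G] in_homD(4)[OF x]
  note mon = monoid_objD[OF hopfD(1)[OF G]]
  let ?Q = "G \<odot> G" and ?JJ = "\<J> \<odot> \<J>"
  let ?p = "\<gamma> \<J> G \<I> G \<cdot> \<langle>(\<langle>\<tau> V, S \<cdot> y\<rangle> \<odot> \<I>) \<cdot> \<r>' V, y\<rangle>"
  let ?k = "\<langle>\<phi>0 \<cdot> \<pi>1 \<I> ?Q, \<pi>2 \<I> ?Q\<rangle>"
  define p where "p = ?p"
  have p [simp]: "p \<^bold>: V \<rightarrow> \<J> \<odot> (\<I> ** ?Q)" by (simp add: p_def)
  \<comment> \<open>After rebracketing, \<open>w\<close> is the argument of \<open>Delta R\<close>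
    before \<open>\<phi>0\<close> is applied, and \<open>w'\<close> is its value once
    \<open>y^-1 y\<close> has become the unit.\<close>
  define w where "w = \<a>' \<J> \<J> (\<I> ** ?Q) \<cdot> (\<tau> \<I> \<odot> p) \<cdot> \<l>' V"
  have w [simp]: "w \<^bold>: V \<rightarrow> ?JJ \<odot> (\<I> ** ?Q)" by (simp add: w_def)
  define w' where "w' = \<a>' \<J> \<J> \<I> \<cdot> (\<tau> \<I> \<odot> ((\<tau> V \<odot> \<I>) \<cdot> \<r>' V)) \<cdot> \<l>' V"
  have w' [simp]: "w' \<^bold>: V \<rightarrow> ?JJ \<odot> \<I>" by (simp add: w'_def)
  define j where "j = \<r> ?JJ \<cdot> w'"
  have j [simp]: "j \<^bold>: V \<rightarrow> ?JJ" by (simp add: j_def)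
  \<comment> \<open>Every arrow into a tensor product with \<open>I\<close> on the right has this
    form. It brings \<open>w'\<close> into the shape that \<open>delta_unit\<close>
    requires.\<close>
  have w'j: "w' = (j \<odot> \<I>) \<cdot> \<r>' V"
    using ri_nat[of j V ?JJ] by (simp add: j_def)
  have ww: "(?JJ \<odot> \<langle>\<pi>1 \<I> ?Q, m \<cdot> \<pi>2 \<I> ?Q\<rangle>) \<cdot> w = (?JJ \<odot> \<langle>\<I>, u\<rangle>) \<cdot> w'"
  proof -
    have "(?JJ \<odot> \<langle>\<pi>1 \<I> ?Q, m \<cdot> \<pi>2 \<I> ?Q\<rangle>) \<cdot> w
       = \<a>' \<J> \<J> (\<I> ** G) \<cdot> (\<J> \<odot> (\<J> \<odot> \<langle>\<pi>1 \<I> ?Q, m \<cdot> \<pi>2 \<I> ?Q\<rangle>)) \<cdot> (\<tau> \<I> \<odot> p) \<cdot> \<l>' V"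
      unfolding w_def using ai_nat'[of \<J> \<J> \<J> \<J> \<J> \<J> "\<langle>\<pi>1 \<I> ?Q, m \<cdot> \<pi>2 \<I> ?Q\<rangle>" "\<I> ** ?Q" "\<I> ** G" "(\<tau> \<I> \<odot> p) \<cdot> \<l>' V" V]
      by simp
    also have "\<dots> = \<a>' \<J> \<J> (\<I> ** G) \<cdot> (\<tau> \<I> \<odot> ((\<J> \<odot> \<langle>\<pi>1 \<I> ?Q, m \<cdot> \<pi>2 \<I> ?Q\<rangle>) \<cdot> p)) \<cdot> \<l>' V" by simp
    also have "\<dots> = \<a>' \<J> \<J> (\<I> ** G) \<cdot> (\<tau> \<I> \<odot> ((\<tau> V \<odot> \<langle>\<I>, u\<rangle>) \<cdot> \<r>' V)) \<cdot> \<l>' V"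
      unfolding p_def by (simp only: hopf_gamma[OF G y])
    also have "\<dots> = \<a>' \<J> \<J> (\<I> ** G) \<cdot> (\<J> \<odot> (\<J> \<odot> \<langle>\<I>, u\<rangle>)) \<cdot> (\<tau> \<I> \<odot> ((\<tau> V \<odot> \<I>) \<cdot> \<r>' V)) \<cdot> \<l>' V" by simp
    also have "\<dots> = (?JJ \<odot> \<langle>\<I>, u\<rangle>) \<cdot> w'"
      unfolding w'_def using ai_nat'[of \<J> \<J> \<J> \<J> \<J> \<J> "\<langle>\<I>, u\<rangle>" \<I> "\<I> ** G" "(\<tau> \<I> \<odot> ((\<tau> V \<odot> \<I>) \<cdot> \<r>' V)) \<cdot> \<l>' V" V]
      by simp
    finally show ?thesis .
  qed
  have "m \<cdot> (\<pi>1 G \<I> \<odot> G) \<cdot> rdiv G m S x y y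
      = (m \<cdot> (m \<odot> G)) \<cdot> (\<pi>1 ?Q \<I> \<odot> G) \<cdot> \<delta> G \<I> G G \<cdot> \<langle>x, (\<I> \<odot> \<langle>S \<cdot> y, y\<rangle>) \<cdot> \<l>' V\<rangle>"
    by (simp add: rdiv_def)
  also have "\<dots> = m \<cdot> (G \<odot> m) \<cdot> (\<a> G G G \<cdot> (\<pi>1 ?Q \<I> \<odot> G) \<cdot> \<delta> G \<I> G G \<cdot> \<langle>x, (\<I> \<odot> \<langle>S \<cdot> y, y\<rangle>) \<cdot> \<l>' V\<rangle>)"
    unfolding mon(4) by simp
  also have "\<dots> = m \<cdot> (G \<odot> m) \<cdot> ((\<r> G \<cdot> \<pi>1 (G \<odot> \<I>) ?JJ) \<odot> ?Q) \<cdot> \<delta> G ?JJ \<I> ?Q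
        \<cdot> \<langle>x, \<a>' \<J> \<J> (\<I>\<^sup>- ** ?Q) \<cdot> (\<tau> \<I> \<odot> ((\<J> \<odot> ?k) \<cdot> p)) \<cdot> \<l>' V\<rangle>"
    unfolding p_def by (subst delta_assoc) simp_all
  also have "\<a>' \<J> \<J> (\<I>\<^sup>- ** ?Q) \<cdot> (\<tau> \<I> \<odot> ((\<J> \<odot> ?k) \<cdot> p)) \<cdot> \<l>' V = (?JJ \<odot> ?k) \<cdot> w"
    unfolding w_def using ai_nat'[of \<J> \<J> \<J> \<J> \<J> \<J> ?k "\<I> ** ?Q" "\<I>\<^sup>- ** ?Q" "(\<tau> \<I> \<odot> p) \<cdot> \<l>' V" V]
    by simp
  also have "m \<cdot> (G \<odot> m) \<cdot> ((\<r> G \<cdot> \<pi>1 (G \<odot> \<I>) ?JJ) \<odot> ?Q) \<cdot> \<delta> G ?JJ \<I> ?Q \<cdot> \<langle>x, (?JJ \<odot> ?k) \<cdot> w\<rangle>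
      = m \<cdot> ((\<r> G \<cdot> \<pi>1 (G \<odot> \<I>) ?JJ) \<odot> G) \<cdot> (((G \<odot> \<I>) ** ?JJ) \<odot> m) \<cdot> \<delta> G ?JJ \<I> ?Q \<cdot> \<langle>x, (?JJ \<odot> ?k) \<cdot> w\<rangle>"
    by simp
  also have "(((G \<odot> \<I>) ** ?JJ) \<odot> m) \<cdot> \<delta> G ?JJ \<I> ?Q \<cdot> \<langle>x, (?JJ \<odot> ?k) \<cdot> w\<rangle>
      = \<delta> G ?JJ \<I> G \<cdot> \<langle>x, (?JJ \<odot> \<langle>\<phi>0 \<cdot> \<pi>1 \<I> G, \<pi>2 \<I> G\<rangle>) \<cdot> ((?JJ \<odot> \<langle>\<pi>1 \<I> ?Q, m \<cdot> \<pi>2 \<I> ?Q\<rangle>) \<cdot> w)\<rangle>"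
    using delta_nat[of G G G ?JJ ?JJ ?JJ \<I> \<I> \<I> m ?Q G x V ?JJ ?JJ "\<phi>0 \<cdot> \<pi>1 \<I> ?Q" "\<I> ** ?Q" "\<pi>2 \<I> ?Q" w]
    by simp
  also have "(?JJ \<odot> \<langle>\<phi>0 \<cdot> \<pi>1 \<I> G, \<pi>2 \<I> G\<rangle>) \<cdot> ((?JJ \<odot> \<langle>\<pi>1 \<I> ?Q, m \<cdot> \<pi>2 \<I> ?Q\<rangle>) \<cdot> w) = (j \<odot> \<langle>\<phi>0, u\<rangle>) \<cdot> \<r>' V"
    unfolding ww w'j by simp
  also have "\<delta> G ?JJ \<I> G \<cdot> \<langle>x, (j \<odot> \<langle>\<phi>0, u\<rangle>) \<cdot> \<r>' V\<rangle>
      = (((G \<odot> \<I>) ** ?JJ) \<odot> u) \<cdot> \<delta> G ?JJ \<I> \<I> \<cdot> \<langle>x, (j \<odot> \<langle>\<phi>0, \<I>\<rangle>) \<cdot> \<r>' V\<rangle>"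
    using delta_nat[of G G G ?JJ ?JJ ?JJ \<I> \<I> \<I> u \<I> G x V j V \<phi>0 \<I> \<I> "\<r>' V"] by simp
  also have "\<delta> G ?JJ \<I> \<I> \<cdot> \<langle>x, (j \<odot> \<langle>\<phi>0, \<I>\<rangle>) \<cdot> \<r>' V\<rangle> = (\<langle>(x \<odot> \<I>) \<cdot> \<r>' V, j\<rangle> \<odot> \<I>) \<cdot> \<r>' V"
    by (subst delta_unit) simp_all
  also have "m \<cdot> ((\<r> G \<cdot> \<pi>1 (G \<odot> \<I>) ?JJ) \<odot> G) \<cdot> (((G \<odot> \<I>) ** ?JJ) \<odot> u) \<cdot> (\<langle>(x \<odot> \<I>) \<cdot> \<r>' V, j\<rangle> \<odot> \<I>) \<cdot> \<r>' V
      = (m \<cdot> (G \<odot> u)) \<cdot> (x \<odot> \<I>) \<cdot> \<r>' V"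
    by (simp add: ru_nat')
  also have "\<dots> = x" unfolding mon(6) by (simp add: ru_nat')
  finally show ?thesis .
qed

section \<open>Structure reflected along multiplicative arrows\<close>

lemma monoid_homD:
  assumes "monoid_hom G m u f K m' u'"
  shows "f \<^bold>: G \<rightarrow> K" "f \<cdot> m = m' \<cdot> (f \<odot> f)" "f \<cdot> u = u'"
  using assms by (simp_all add: monoid_hom_def)

lemma monoid_hom_comp:
  assumes G: "monoid_obj G m u" and K: "monoid_obj K m' u'" and L: "monoid_obj L m'' u''"
    and f: "monoid_hom G m u f K m' u'" and g: "monoid_hom K m' u' g L m'' u''"
  shows "monoid_hom G m u (g \<cdot> f) L m'' u''"
proof -
  note [simp] = monoid_objD(1-3)[OF G] monoid_objD(1-3)[OF K] monoid_objD(1-3)[OF L] monoid_homD(1)[OF f] monoid_homD(1)[OF g]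
  have "(g \<cdot> f) \<cdot> m = g \<cdot> (f \<cdot> m)" by simp
  also have "\<dots> = (g \<cdot> m') \<cdot> (f \<odot> f)" by (simp add: monoid_homD(2)[OF f])
  also have "\<dots> = m'' \<cdot> ((g \<cdot> f) \<odot> (g \<cdot> f))" unfolding monoid_homD(2)[OF g] by simp
  finally show ?thesis using monoid_homD(3)[OF f] monoid_homD(3)[OF g] by (simp add: monoid_hom_def)
qed

text \<open>Here \<open>H\<close> carries operations that are not yet known to satisfy the laws. The
  laws of \<open>A\<close> give those of \<open>H\<close> up to composition with \<open>k\<close>;
  two such arrows that are jointly monic then give the laws themselves.\<close>

lemma monoid_law_image:
  assumes H [simp]: "H \<in> Obj C" "m \<^bold>: H \<odot> H \<rightarrow> H" "u \<^bold>: \<I> \<rightarrow> H"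
    and A: "monoid_obj A mA uA" and k: "monoid_hom H m u k A mA uA"
  shows "k \<cdot> (m \<cdot> (m \<odot> H)) = k \<cdot> (m \<cdot> (H \<odot> m) \<cdot> \<a> H H H)"
    "k \<cdot> (m \<cdot> (u \<odot> H)) = k \<cdot> \<l> H" "k \<cdot> (m \<cdot> (H \<odot> u)) = k \<cdot> \<r> H"
proof -
  note [simp] = monoid_objD(1-3)[OF A] monoid_homD(1)[OF k]
  note kk = monoid_homD(2,3)[OF k]
  have km: "k \<cdot> (m \<cdot> h) = mA \<cdot> ((k \<odot> k) \<cdot> h)" if [simp]: "h \<^bold>: V \<rightarrow> H \<odot> H" for h V
  proof -
    have "k \<cdot> (m \<cdot> h) = (k \<cdot> m) \<cdot> h" by simp
    thus ?thesis unfolding kk by simp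
  qed
  have "k \<cdot> (m \<cdot> (m \<odot> H)) = (mA \<cdot> (mA \<odot> A)) \<cdot> ((k \<odot> k) \<odot> k)" by (simp add: km kk)
  also have "\<dots> = mA \<cdot> (A \<odot> mA) \<cdot> (\<a> A A A \<cdot> ((k \<odot> k) \<odot> k))" unfolding monoid_objD(4)[OF A] by simp
  also have "\<a> A A A \<cdot> ((k \<odot> k) \<odot> k) = (k \<odot> (k \<odot> k)) \<cdot> \<a> H H H" by (rule as_nat) simp_all
  also have "mA \<cdot> (A \<odot> mA) \<cdot> (k \<odot> (k \<odot> k)) \<cdot> \<a> H H H = k \<cdot> (m \<cdot> (H \<odot> m) \<cdot> \<a> H H H)" by (simp add: km kk)
  finally show "k \<cdot> (m \<cdot> (m \<odot> H)) = k \<cdot> (m \<cdot> (H \<odot> m) \<cdot> \<a> H H H)" .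
  have "k \<cdot> (m \<cdot> (u \<odot> H)) = (mA \<cdot> (uA \<odot> A)) \<cdot> (\<I> \<odot> k)" by (simp add: km kk)
  also have "\<dots> = k \<cdot> \<l> H" unfolding monoid_objD(5)[OF A] by (rule lu_nat) simp
  finally show "k \<cdot> (m \<cdot> (u \<odot> H)) = k \<cdot> \<l> H" .
  have "k \<cdot> (m \<cdot> (H \<odot> u)) = (mA \<cdot> (A \<odot> uA)) \<cdot> (k \<odot> \<I>)" by (simp add: km kk)
  also have "\<dots> = k \<cdot> \<r> H" unfolding monoid_objD(6)[OF A] by (rule ru_nat) simp
  finally show "k \<cdot> (m \<cdot> (H \<odot> u)) = k \<cdot> \<r> H" .
qed

text \<open>The same for the antipode: naturality along \<open>k\<close> and compatibility of
  \<open>S\<close> with \<open>SA\<close> reduce the image of the equation to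
  \<open>hopf_delta\<close> for \<open>A\<close>.\<close>

lemma hopf_delta_image:
  assumes H [simp]: "H \<in> Obj C" "m \<^bold>: H \<odot> H \<rightarrow> H" "S \<^bold>: H \<rightarrow> H\<^sup>-"
    and A: "hopf A mA uA SA" and k: "monoid_hom H m u k A mA uA" and S: "k\<^sup>- \<cdot> S = SA \<cdot> k"
  shows "(\<langle>k \<cdot> \<pi>1 H \<I>, \<pi>2 H \<I>\<rangle> \<odot> \<J>) \<cdot> (\<langle>m \<cdot> \<pi>1 (H \<odot> H) \<I>, \<pi>2 (H \<odot> H) \<I>\<rangle> \<odot> \<J>) \<cdot> \<delta> H \<I> H \<J> \<cdot> \<langle>H, (\<I> \<odot> \<langle>S, \<tau> H\<rangle>) \<cdot> \<l>' H\<rangle>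
      = (\<langle>uA, \<I>\<rangle> \<odot> \<tau> H) \<cdot> \<l>' H" (is "?l = _")
proof -
  note [simp] = hopfD(2-)[OF A] monoid_homD(1)[OF k]
  have "?l = (\<langle>(k \<cdot> m) \<cdot> \<pi>1 (H \<odot> H) \<I>, \<pi>2 (H \<odot> H) \<I>\<rangle> \<odot> \<J>) \<cdot> \<delta> H \<I> H \<J> \<cdot> \<langle>H, (\<I> \<odot> \<langle>S, \<tau> H\<rangle>) \<cdot> \<l>' H\<rangle>" by simp
  also have "\<dots> = (\<langle>mA \<cdot> \<pi>1 (A \<odot> A) \<I>, \<pi>2 (A \<odot> A) \<I>\<rangle> \<odot> \<J>)
      \<cdot> (\<langle>(k \<odot> k) \<cdot> \<pi>1 (H \<odot> H) \<I>, \<pi>2 (H \<odot> H) \<I>\<rangle> \<odot> \<J>) \<cdot> \<delta> H \<I> H \<J> \<cdot> \<langle>H, (\<I> \<odot> \<langle>S, \<tau> H\<rangle>) \<cdot> \<l>' H\<rangle>"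
    unfolding monoid_homD(2)[OF k] by simp
  also have "\<dots> = (\<langle>mA \<cdot> \<pi>1 (A \<odot> A) \<I>, \<pi>2 (A \<odot> A) \<I>\<rangle> \<odot> \<J>) \<cdot> \<delta> A \<I> A \<J> \<cdot> \<langle>k, (\<I> \<odot> \<langle>SA \<cdot> k, \<tau> H\<rangle>) \<cdot> \<l>' H\<rangle>"
    using delta_nat[of k H A \<I> \<I> \<I> k H A \<J> \<J> \<J> H H \<I> \<I> S H "\<tau> H" "\<l>' H"] by (simp add: S)
  also have "\<dots> = (\<langle>uA, \<I>\<rangle> \<odot> \<tau> H) \<cdot> \<l>' H" by (rule hopf_delta[OF A]) simp
  finally show ?thesis .
qed

lemma hopf_gamma_image:
  assumes H [simp]: "H \<in> Obj C" "m \<^bold>: H \<odot> H \<rightarrow> H" "S \<^bold>: H \<rightarrow> H\<^sup>-"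
    and A: "hopf A mA uA SA" and k: "monoid_hom H m u k A mA uA" and S: "k\<^sup>- \<cdot> S = SA \<cdot> k"
  shows "(\<J> \<odot> \<langle>\<pi>1 \<I> H, k \<cdot> \<pi>2 \<I> H\<rangle>) \<cdot> (\<J> \<odot> \<langle>\<pi>1 \<I> (H \<odot> H), m \<cdot> \<pi>2 \<I> (H \<odot> H)\<rangle>) \<cdot> \<gamma> \<J> H \<I> H \<cdot> \<langle>(\<langle>\<tau> H, S\<rangle> \<odot> \<I>) \<cdot> \<r>' H, H\<rangle>
      = (\<tau> H \<odot> \<langle>\<I>, uA\<rangle>) \<cdot> \<r>' H" (is "?l = _")
proof -
  note [simp] = hopfD(2-)[OF A] monoid_homD(1)[OF k]
  have "?l = (\<J> \<odot> \<langle>\<pi>1 \<I> (H \<odot> H), (k \<cdot> m) \<cdot> \<pi>2 \<I> (H \<odot> H)\<rangle>) \<cdot> \<gamma> \<J> H \<I> H \<cdot> \<langle>(\<langle>\<tau> H, S\<rangle> \<odot> \<I>) \<cdot> \<r>' H, H\<rangle>" by simp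
  also have "\<dots> = (\<J> \<odot> \<langle>\<pi>1 \<I> (A \<odot> A), mA \<cdot> \<pi>2 \<I> (A \<odot> A)\<rangle>)
      \<cdot> (\<J> \<odot> \<langle>\<pi>1 \<I> (H \<odot> H), (k \<odot> k) \<cdot> \<pi>2 \<I> (H \<odot> H)\<rangle>) \<cdot> \<gamma> \<J> H \<I> H \<cdot> \<langle>(\<langle>\<tau> H, S\<rangle> \<odot> \<I>) \<cdot> \<r>' H, H\<rangle>"
    unfolding monoid_homD(2)[OF k] by simp
  also have "\<dots> = (\<J> \<odot> \<langle>\<pi>1 \<I> (A \<odot> A), mA \<cdot> \<pi>2 \<I> (A \<odot> A)\<rangle>) \<cdot> \<gamma> \<J> A \<I> A \<cdot> \<langle>(\<langle>\<tau> H, SA \<cdot> k\<rangle> \<odot> \<I>) \<cdot> \<r>' H, k\<rangle>"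
    using gamma_nat[of \<J> \<J> \<J> k H A \<I> \<I> \<I> k H A "\<tau> H" H S \<I> \<I> "\<r>' H" H H] by (simp add: S)
  also have "\<dots> = (\<tau> H \<odot> \<langle>\<I>, uA\<rangle>) \<cdot> \<r>' H" by (rule hopf_gamma[OF A]) simp
  finally show ?thesis .
qed

subsection \<open>Pullbacks of split epimorphisms\<close>

text \<open>The arrow \<open>z\<close> exhibits \<open>H\<close> as a retract of
  \<open>A ** E\<close> in \<open>C\<close> and is not a homomorphism. For the monoid laws it only
  makes \<open>k\<close> and \<open>q\<close> jointly monic; for the antipode equations it supplies
  the retractions that the separation lemmas ask for.\<close>

lemma hopf_subproduct:
  assumes H [simp]: "H \<in> Obj C" "m \<^bold>: H \<odot> H \<rightarrow> H" "u \<^bold>: \<I> \<rightarrow> H" "S \<^bold>: H \<rightarrow> H\<^sup>-"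
    and A: "hopf A mA uA SA" and k: "monoid_hom H m u k A mA uA" and Sk: "k\<^sup>- \<cdot> S = SA \<cdot> k"
    and E: "hopf E mE uE SE" and q: "monoid_hom H m u q E mE uE" and Sq: "q\<^sup>- \<cdot> S = SE \<cdot> q"
    and z [simp]: "z \<^bold>: A ** E \<rightarrow> H" and zkq: "z \<cdot> \<langle>k, q\<rangle> = H"
  shows "hopf H m u S"
proof -
  note [simp] = hopfD(2-)[OF A] hopfD(2-)[OF E] monoid_homD(1)[OF k] monoid_homD(1)[OF q]
  have joint: "f = g" if fg: "f \<^bold>: V \<rightarrow> H" "g \<^bold>: V \<rightarrow> H" "k \<cdot> f = k \<cdot> g" "q \<cdot> f = q \<cdot> g" for f g V
  proof (rule mono_cancel[where e = "\<langle>k, q\<rangle>" and e' = z])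
    show "\<langle>k, q\<rangle> \<cdot> f = \<langle>k, q\<rangle> \<cdot> g" using fg by simp
  qed (use fg zkq in simp_all)
  have mon: "monoid_obj H m u"
    unfolding monoid_obj_def
  proof (intro conjI)
    show "m \<cdot> (m \<odot> H) = m \<cdot> (H \<odot> m) \<cdot> \<a> H H H"
      by (rule joint[of _ "(H \<odot> H) \<odot> H"], simp, simp)
        (rule monoid_law_image[OF H(1-3) hopfD(1)[OF A] k] monoid_law_image[OF H(1-3) hopfD(1)[OF E] q])+
    show "m \<cdot> (u \<odot> H) = \<l> H"
      by (rule joint[of _ "\<I> \<odot> H"], simp, simp)
        (rule monoid_law_image[OF H(1-3) hopfD(1)[OF A] k] monoid_law_image[OF H(1-3) hopfD(1)[OF E] q])+
    show "m \<cdot> (H \<odot> u) = \<r> H"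
      by (rule joint[of _ "H \<odot> \<I>"], simp, simp)
        (rule monoid_law_image[OF H(1-3) hopfD(1)[OF A] k] monoid_law_image[OF H(1-3) hopfD(1)[OF E] q])+
  qed simp_all
  have zkq': "z \<cdot> \<langle>k \<cdot> f, q \<cdot> f\<rangle> = f" if [simp]: "f \<^bold>: V \<rightarrow> H" for f V
  proof -
    have "z \<cdot> \<langle>k \<cdot> f, q \<cdot> f\<rangle> = (z \<cdot> \<langle>k, q\<rangle>) \<cdot> f" by simp
    thus ?thesis unfolding zkq by simp
  qed
  \<comment> \<open>Both sides end in a tensor product with \<open>J\<close>, where joint monicity
    of \<open>k\<close> and \<open>q\<close> cannot be used directly.
    \<open>separation_right\<close> replaces it, applied to \<open>H ** \<I>\<close> as a retract of
    \<open>(A ** \<I>) ** (E ** \<I>)\<close>.\<close>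
  have 1: "(\<langle>m \<cdot> \<pi>1 (H \<odot> H) \<I>, \<pi>2 (H \<odot> H) \<I>\<rangle> \<odot> \<J>) \<cdot> \<delta> H \<I> H \<J> \<cdot> \<langle>H, (\<I> \<odot> \<langle>S, \<tau> H\<rangle>) \<cdot> \<l>' H\<rangle> = (\<langle>u, \<I>\<rangle> \<odot> \<tau> H) \<cdot> \<l>' H"
  proof (rule separation_right[where ?y1.0 = "\<langle>k \<cdot> \<pi>1 H \<I>, \<pi>2 H \<I>\<rangle>" and ?y2.0 = "\<langle>q \<cdot> \<pi>1 H \<I>, \<pi>2 H \<I>\<rangle>" and X = A and Z = E
        and T = \<J> and Y = "H ** \<I>"
        and z = "\<langle>z \<cdot> \<langle>\<pi>1 A \<I> \<cdot> \<pi>1 (A ** \<I>) (E ** \<I>), \<pi>1 E \<I> \<cdot> \<pi>2 (A ** \<I>) (E ** \<I>)\<rangle>, \<pi>2 A \<I> \<cdot> \<pi>1 (A ** \<I>) (E ** \<I>)\<rangle>"])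
    show "(\<langle>k \<cdot> \<pi>1 H \<I>, \<pi>2 H \<I>\<rangle> \<odot> \<tau> \<J>) \<cdot> (\<langle>m \<cdot> \<pi>1 (H \<odot> H) \<I>, \<pi>2 (H \<odot> H) \<I>\<rangle> \<odot> \<J>) \<cdot> \<delta> H \<I> H \<J> \<cdot> \<langle>H, (\<I> \<odot> \<langle>S, \<tau> H\<rangle>) \<cdot> \<l>' H\<rangle>
        = (\<langle>k \<cdot> \<pi>1 H \<I>, \<pi>2 H \<I>\<rangle> \<odot> \<tau> \<J>) \<cdot> (\<langle>u, \<I>\<rangle> \<odot> \<tau> H) \<cdot> \<l>' H"
      unfolding tau_terminal hopf_delta_image[OF H(1,2,4) A k Sk] by (simp add: monoid_homD(3)[OF k])
    show "(\<langle>q \<cdot> \<pi>1 H \<I>, \<pi>2 H \<I>\<rangle> \<odot> \<J>) \<cdot> (\<langle>m \<cdot> \<pi>1 (H \<odot> H) \<I>, \<pi>2 (H \<odot> H) \<I>\<rangle> \<odot> \<J>) \<cdot> \<delta> H \<I> H \<J> \<cdot> \<langle>H, (\<I> \<odot> \<langle>S, \<tau> H\<rangle>) \<cdot> \<l>' H\<rangle>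
        = (\<langle>q \<cdot> \<pi>1 H \<I>, \<pi>2 H \<I>\<rangle> \<odot> \<J>) \<cdot> (\<langle>u, \<I>\<rangle> \<odot> \<tau> H) \<cdot> \<l>' H"
      unfolding hopf_delta_image[OF H(1,2,4) E q Sq] by (simp add: monoid_homD(3)[OF q])
  qed (simp_all add: zkq')
  have 2: "(\<J> \<odot> \<langle>\<pi>1 \<I> (H \<odot> H), m \<cdot> \<pi>2 \<I> (H \<odot> H)\<rangle>) \<cdot> \<gamma> \<J> H \<I> H \<cdot> \<langle>(\<langle>\<tau> H, S\<rangle> \<odot> \<I>) \<cdot> \<r>' H, H\<rangle> = (\<tau> H \<odot> \<langle>\<I>, u\<rangle>) \<cdot> \<r>' H"
  proof (rule separation_left[where ?y1.0 = "\<langle>\<pi>1 \<I> H, k \<cdot> \<pi>2 \<I> H\<rangle>" and ?y2.0 = "\<langle>\<pi>1 \<I> H, q \<cdot> \<pi>2 \<I> H\<rangle>" and X = A and Z = E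
        and T = \<J> and Y = "\<I> ** H"
        and z = "\<langle>\<pi>1 \<I> A \<cdot> \<pi>1 (\<I> ** A) (\<I> ** E), z \<cdot> \<langle>\<pi>2 \<I> A \<cdot> \<pi>1 (\<I> ** A) (\<I> ** E), \<pi>2 \<I> E \<cdot> \<pi>2 (\<I> ** A) (\<I> ** E)\<rangle>\<rangle>"])
    show "(\<tau> \<J> \<odot> \<langle>\<pi>1 \<I> H, k \<cdot> \<pi>2 \<I> H\<rangle>) \<cdot> (\<J> \<odot> \<langle>\<pi>1 \<I> (H \<odot> H), m \<cdot> \<pi>2 \<I> (H \<odot> H)\<rangle>) \<cdot> \<gamma> \<J> H \<I> H \<cdot> \<langle>(\<langle>\<tau> H, S\<rangle> \<odot> \<I>) \<cdot> \<r>' H, H\<rangle>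
        = (\<tau> \<J> \<odot> \<langle>\<pi>1 \<I> H, k \<cdot> \<pi>2 \<I> H\<rangle>) \<cdot> (\<tau> H \<odot> \<langle>\<I>, u\<rangle>) \<cdot> \<r>' H"
      unfolding tau_terminal hopf_gamma_image[OF H(1,2,4) A k Sk] by (simp add: monoid_homD(3)[OF k])
    show "(\<J> \<odot> \<langle>\<pi>1 \<I> H, q \<cdot> \<pi>2 \<I> H\<rangle>) \<cdot> (\<J> \<odot> \<langle>\<pi>1 \<I> (H \<odot> H), m \<cdot> \<pi>2 \<I> (H \<odot> H)\<rangle>) \<cdot> \<gamma> \<J> H \<I> H \<cdot> \<langle>(\<langle>\<tau> H, S\<rangle> \<odot> \<I>) \<cdot> \<r>' H, H\<rangle>
        = (\<J> \<odot> \<langle>\<pi>1 \<I> H, q \<cdot> \<pi>2 \<I> H\<rangle>) \<cdot> (\<tau> H \<odot> \<langle>\<I>, u\<rangle>) \<cdot> \<r>' H"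
      unfolding hopf_gamma_image[OF H(1,2,4) E q Sq] by (simp add: monoid_homD(3)[OF q])
  qed (simp_all add: zkq')
  show ?thesis unfolding hopf_def using mon 1 2 by simp
qed

section \<open>Reversion of products\<close>

abbreviation phi_bul0 ("\<phi>\<^sup>\<bullet>\<^sub>0") where "\<phi>\<^sup>\<bullet>\<^sub>0 \<equiv> PhiBul0 R"
abbreviation phi_bul ("\<phi>\<^sup>\<bullet>") where "\<phi>\<^sup>\<bullet> \<equiv> PhiBul R"

lemma phi_bul_ty [simp]: "X \<in> Obj C \<Longrightarrow> Y \<in> Obj C \<Longrightarrow> \<phi>\<^sup>\<bullet> X Y \<^bold>: X\<^sup>- ** Y\<^sup>- \<rightarrow> (Y ** X)\<^sup>-"
  and phi_bul0_ty [simp]: "\<phi>\<^sup>\<bullet>\<^sub>0 \<^bold>: \<J> \<rightarrow> \<J>\<^sup>-"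
  using reversion.phi_bul_lax[OF rev]
  unfolding lax_monoidal_functor_def reverse_monoidal_def Hom_iff by (simp_all add: duo_simps)

lemma phi_bul_nat:
  assumes fg [simp]: "f \<^bold>: X \<rightarrow> X'" "g \<^bold>: Y \<rightarrow> Y'" and [simp]: "x \<^bold>: V \<rightarrow> X\<^sup>-" "y \<^bold>: V \<rightarrow> Y\<^sup>-"
  shows "\<phi>\<^sup>\<bullet> X' Y' \<cdot> \<langle>f\<^sup>- \<cdot> x, g\<^sup>- \<cdot> y\<rangle> = \<langle>g \<cdot> \<pi>1 Y X, f \<cdot> \<pi>2 Y X\<rangle>\<^sup>- \<cdot> \<phi>\<^sup>\<bullet> X Y \<cdot> \<langle>x, y\<rangle>"
proof -
  note [simp] = fg[THEN in_homD(4)] fg[THEN in_homD(5)]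
  have "\<phi>\<^sup>\<bullet> X' Y' \<cdot> \<langle>f\<^sup>- \<cdot> \<pi>1 (X\<^sup>-) (Y\<^sup>-), g\<^sup>- \<cdot> \<pi>2 (X\<^sup>-) (Y\<^sup>-)\<rangle> = \<langle>g \<cdot> \<pi>1 Y X, f \<cdot> \<pi>2 Y X\<rangle>\<^sup>- \<cdot> \<phi>\<^sup>\<bullet> X Y"
    using reversion.phi_bul_lax[OF rev] fg
    unfolding lax_monoidal_functor_def reverse_monoidal_def Hom_iff by (auto simp: duo_simps)
  from arg_cong[OF this, of "\<lambda>h. h \<cdot> \<langle>x, y\<rangle>"] show ?thesis by simp
qed

lemma phi_bul_unit:
  assumes [simp]: "X \<in> Obj C"
  shows "(\<pi>1 X \<J>)\<^sup>- \<cdot> \<phi>\<^sup>\<bullet> \<J> X \<cdot> \<langle>\<phi>\<^sup>\<bullet>\<^sub>0 \<cdot> \<pi>1 \<J> (X\<^sup>-), \<pi>2 \<J> (X\<^sup>-)\<rangle> = \<pi>2 \<J> (X\<^sup>-)"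
    "(\<pi>2 \<J> X)\<^sup>- \<cdot> \<phi>\<^sup>\<bullet> X \<J> \<cdot> \<langle>\<pi>1 (X\<^sup>-) \<J>, \<phi>\<^sup>\<bullet>\<^sub>0 \<cdot> \<pi>2 (X\<^sup>-) \<J>\<rangle> = \<pi>1 (X\<^sup>-) \<J>"
  using reversion.phi_bul_lax[OF rev] assms
  unfolding lax_monoidal_functor_def reverse_monoidal_def by (simp_all add: duo_simps)

text \<open>The premises are needed because \<open>J\<^sup>-\<close> need not be terminal.\<close>

lemma phi_bul_proj:
  assumes [simp]: "s \<^bold>: V \<rightarrow> X\<^sup>-" and t [simp]: "t \<^bold>: V \<rightarrow> Y\<^sup>-" and [simp]: "X \<in> Obj C" "Y \<in> Obj C"
  shows "(\<tau> X)\<^sup>- \<cdot> s = \<phi>\<^sup>\<bullet>\<^sub>0 \<cdot> \<tau> V \<Longrightarrow> (\<pi>1 Y X)\<^sup>- \<cdot> \<phi>\<^sup>\<bullet> X Y \<cdot> \<langle>s, t\<rangle> = t"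
    "(\<tau> Y)\<^sup>- \<cdot> t = \<phi>\<^sup>\<bullet>\<^sub>0 \<cdot> \<tau> V \<Longrightarrow> (\<pi>2 Y X)\<^sup>- \<cdot> \<phi>\<^sup>\<bullet> X Y \<cdot> \<langle>s, t\<rangle> = s"
proof -
  note [simp] = in_homD(4)[OF t]
  show "(\<pi>1 Y X)\<^sup>- \<cdot> \<phi>\<^sup>\<bullet> X Y \<cdot> \<langle>s, t\<rangle> = t" if s: "(\<tau> X)\<^sup>- \<cdot> s = \<phi>\<^sup>\<bullet>\<^sub>0 \<cdot> \<tau> V"
  proof -
    have "\<pi>1 Y X = \<pi>1 Y \<J> \<cdot> \<langle>Y \<cdot> \<pi>1 Y X, \<tau> X \<cdot> \<pi>2 Y X\<rangle>" by simp
    hence "(\<pi>1 Y X)\<^sup>- = (\<pi>1 Y \<J>)\<^sup>- \<cdot> \<langle>Y \<cdot> \<pi>1 Y X, \<tau> X \<cdot> \<pi>2 Y X\<rangle>\<^sup>-"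
      using rv_comp[of "\<langle>Y \<cdot> \<pi>1 Y X, \<tau> X \<cdot> \<pi>2 Y X\<rangle>" "Y ** X" "Y ** \<J>" "\<pi>1 Y \<J>" Y] by simp
    hence "(\<pi>1 Y X)\<^sup>- \<cdot> \<phi>\<^sup>\<bullet> X Y \<cdot> \<langle>s, t\<rangle> = (\<pi>1 Y \<J>)\<^sup>- \<cdot> \<langle>Y \<cdot> \<pi>1 Y X, \<tau> X \<cdot> \<pi>2 Y X\<rangle>\<^sup>- \<cdot> \<phi>\<^sup>\<bullet> X Y \<cdot> \<langle>s, t\<rangle>"
      by simp
    also have "\<dots> = (\<pi>1 Y \<J>)\<^sup>- \<cdot> \<phi>\<^sup>\<bullet> \<J> Y \<cdot> \<langle>(\<tau> X)\<^sup>- \<cdot> s, t\<rangle>"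
      using phi_bul_nat[of "\<tau> X" X \<J> Y Y Y s V t] by simp
    also have "\<dots> = t"
      using arg_cong[OF phi_bul_unit(1)[of Y], of "\<lambda>h. h \<cdot> \<langle>\<tau> V, t\<rangle>"] by (simp add: s)
    finally show ?thesis .
  qed
  show "(\<pi>2 Y X)\<^sup>- \<cdot> \<phi>\<^sup>\<bullet> X Y \<cdot> \<langle>s, t\<rangle> = s" if t: "(\<tau> Y)\<^sup>- \<cdot> t = \<phi>\<^sup>\<bullet>\<^sub>0 \<cdot> \<tau> V"
  proof -
    have "\<pi>2 Y X = \<pi>2 \<J> X \<cdot> \<langle>\<tau> Y \<cdot> \<pi>1 Y X, X \<cdot> \<pi>2 Y X\<rangle>" by simp
    hence "(\<pi>2 Y X)\<^sup>- = (\<pi>2 \<J> X)\<^sup>- \<cdot> \<langle>\<tau> Y \<cdot> \<pi>1 Y X, X \<cdot> \<pi>2 Y X\<rangle>\<^sup>-"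
      using rv_comp[of "\<langle>\<tau> Y \<cdot> \<pi>1 Y X, X \<cdot> \<pi>2 Y X\<rangle>" "Y ** X" "\<J> ** X" "\<pi>2 \<J> X" X] by simp
    hence "(\<pi>2 Y X)\<^sup>- \<cdot> \<phi>\<^sup>\<bullet> X Y \<cdot> \<langle>s, t\<rangle> = (\<pi>2 \<J> X)\<^sup>- \<cdot> \<langle>\<tau> Y \<cdot> \<pi>1 Y X, X \<cdot> \<pi>2 Y X\<rangle>\<^sup>- \<cdot> \<phi>\<^sup>\<bullet> X Y \<cdot> \<langle>s, t\<rangle>"
      by simp
    also have "\<dots> = (\<pi>2 \<J> X)\<^sup>- \<cdot> \<phi>\<^sup>\<bullet> X \<J> \<cdot> \<langle>s, (\<tau> Y)\<^sup>- \<cdot> t\<rangle>"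
      using phi_bul_nat[of X X X "\<tau> Y" Y \<J> s V \<open>t\<close>] by simp
    also have "\<dots> = s"
      using arg_cong[OF phi_bul_unit(2)[of X], of "\<lambda>h. h \<cdot> \<langle>s, \<tau> V\<rangle>"] by (simp add: t)
    finally show ?thesis .
  qed
qed

text \<open>The antipode equations hold because the objects in which they take place have a split
  monomorphism to \<open>J\<close>, so that parallel arrows into them coincide.\<close>

lemma hopf_terminal: "hopf \<J> (\<tau> (\<J> \<odot> \<J>)) (\<tau> \<I>) \<phi>\<^sup>\<bullet>\<^sub>0"
proof -
  have t: "\<tau> (\<J> ** \<I>) = \<pi>1 \<J> \<I>" "\<tau> (\<I> ** \<J>) = \<pi>2 \<I> \<J>" by (rule terminal_eqI; simp)+
  have r: "f = g" if fg: "f \<^bold>: V \<rightarrow> (\<J> ** \<I>) \<odot> \<J>" "g \<^bold>: V \<rightarrow> (\<J> ** \<I>) \<odot> \<J>" for f g V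
  proof (rule mono_cancel[where e = "\<l> \<J> \<cdot> (\<pi>2 \<J> \<I> \<odot> \<J>)" and e' = "(\<langle>\<tau> \<I>, \<I>\<rangle> \<odot> \<J>) \<cdot> \<l>' \<J>"])
    show "(\<l> \<J> \<cdot> (\<pi>2 \<J> \<I> \<odot> \<J>)) \<cdot> f = (\<l> \<J> \<cdot> (\<pi>2 \<J> \<I> \<odot> \<J>)) \<cdot> g"
      by (rule terminal_eqI[of _ V]) (use fg in simp_all)
  qed (use fg in \<open>simp_all add: t\<close>)
  have l: "f = g" if fg: "f \<^bold>: V \<rightarrow> \<J> \<odot> (\<I> ** \<J>)" "g \<^bold>: V \<rightarrow> \<J> \<odot> (\<I> ** \<J>)" for f g V
  proof (rule mono_cancel[where e = "\<r> \<J> \<cdot> (\<J> \<odot> \<pi>1 \<I> \<J>)" and e' = "(\<J> \<odot> \<langle>\<I>, \<tau> \<I>\<rangle>) \<cdot> \<r>' \<J>"])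
    show "(\<r> \<J> \<cdot> (\<J> \<odot> \<pi>1 \<I> \<J>)) \<cdot> f = (\<r> \<J> \<cdot> (\<J> \<odot> \<pi>1 \<I> \<J>)) \<cdot> g"
      by (rule terminal_eqI[of _ V]) (use fg in simp_all)
  qed (use fg in \<open>simp_all add: t\<close>)
  have "monoid_obj \<J> (\<tau> (\<J> \<odot> \<J>)) (\<tau> \<I>)"
    unfolding monoid_obj_def
    by (intro conjI; (simp; fail)?) (rule terminal_eqI, simp, simp)+
  moreover have "(\<langle>\<tau> (\<J> \<odot> \<J>) \<cdot> \<pi>1 (\<J> \<odot> \<J>) \<I>, \<pi>2 (\<J> \<odot> \<J>) \<I>\<rangle> \<odot> \<J>) \<cdot> \<delta> \<J> \<I> \<J> \<J> \<cdot> \<langle>\<J>, (\<I> \<odot> \<langle>\<phi>\<^sup>\<bullet>\<^sub>0, \<tau> \<J>\<rangle>) \<cdot> \<l>' \<J>\<rangle>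
      = (\<langle>\<tau> \<I>, \<I>\<rangle> \<odot> \<tau> \<J>) \<cdot> \<l>' \<J>"
    by (rule r[of _ \<J>]) simp_all
  moreover have "(\<J> \<odot> \<langle>\<pi>1 \<I> (\<J> \<odot> \<J>), \<tau> (\<J> \<odot> \<J>) \<cdot> \<pi>2 \<I> (\<J> \<odot> \<J>)\<rangle>) \<cdot> \<gamma> \<J> \<J> \<I> \<J> \<cdot> \<langle>(\<langle>\<tau> \<J>, \<phi>\<^sup>\<bullet>\<^sub>0\<rangle> \<odot> \<I>) \<cdot> \<r>' \<J>, \<J>\<rangle>
      = (\<tau> \<J> \<odot> \<langle>\<I>, \<tau> \<I>\<rangle>) \<cdot> \<r>' \<J>"
    by (rule l[of _ \<J>]) simp_all
  ultimately show ?thesis unfolding hopf_def by simp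
qed

text \<open>Supplies the premises of \<open>phi_bul_proj\<close>: antipodes are compatible with the
  homomorphism to the Hopf monoid \<open>\<J>\<close>.\<close>

lemma antipode_terminal:
  assumes G: "hopf G m u S" and x [simp]: "x \<^bold>: V \<rightarrow> G"
  shows "(\<tau> G)\<^sup>- \<cdot> S \<cdot> x = \<phi>\<^sup>\<bullet>\<^sub>0 \<cdot> \<tau> V"
proof -
  note [simp] = hopfD(2-)[OF G]
  have "monoid_hom G m u (\<tau> G) \<J> (\<tau> (\<J> \<odot> \<J>)) (\<tau> \<I>)" by (simp add: monoid_hom_def)
  from arg_cong[OF antipode_hom[OF G hopf_terminal this], of "\<lambda>h. h \<cdot> x"] show ?thesis by simp
qed

lemma monoid_hom_mult:
  assumes G: "monoid_obj G m u" and K: "monoid_obj K m' u'" and f: "monoid_hom G m u f K m' u'"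
    and h [simp]: "h \<^bold>: V \<rightarrow> G \<odot> G"
  shows "f \<cdot> (m \<cdot> h) = m' \<cdot> ((f \<odot> f) \<cdot> h)"
proof -
  note [simp] = monoid_objD(1-3)[OF G] monoid_objD(1-3)[OF K] monoid_homD(1)[OF f]
  have "f \<cdot> (m \<cdot> h) = (f \<cdot> m) \<cdot> h" by simp
  thus ?thesis unfolding monoid_homD(2)[OF f] by simp
qed

lemma monoid_hom_id: "monoid_obj G m u \<Longrightarrow> monoid_hom G m u G G m u"
  using monoid_objD[of G m u] by (simp add: monoid_hom_def)

text \<open>Since \<open>PhiBul R\<close> reverses the factors, the projections are swapped in the
  antipode. The second claim is what allows \<open>antipode_hom\<close> to be applied, in
  \<open>pullback_hopf\<close>, to the pair of the identity and \<open>s \<cdot> p\<close>.\<close>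

lemma hopf_square:
  assumes A: "hopf A m u S"
  defines "mm \<equiv> \<langle>m \<cdot> (\<pi>1 A A \<odot> \<pi>1 A A), m \<cdot> (\<pi>2 A A \<odot> \<pi>2 A A)\<rangle>"
  shows "hopf (A ** A) mm \<langle>u, u\<rangle> (\<phi>\<^sup>\<bullet> A A \<cdot> \<langle>S \<cdot> \<pi>2 A A, S \<cdot> \<pi>1 A A\<rangle>)"
    and "monoid_hom A m u f A m u \<Longrightarrow> monoid_hom A m u g A m u \<Longrightarrow> monoid_hom A m u \<langle>f, g\<rangle> (A ** A) mm \<langle>u, u\<rangle>"
proof -
  note [simp] = hopfD(2-)[OF A]
  have mm [simp]: "mm \<^bold>: (A ** A) \<odot> (A ** A) \<rightarrow> A ** A" by (simp add: mm_def)
  show "hopf (A ** A) mm \<langle>u, u\<rangle> (\<phi>\<^sup>\<bullet> A A \<cdot> \<langle>S \<cdot> \<pi>2 A A, S \<cdot> \<pi>1 A A\<rangle>)"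
  proof (rule hopf_subproduct[OF _ _ _ _ A _ _ A, where k = "\<pi>1 A A" and q = "\<pi>2 A A" and z = "A ** A"])
    show "monoid_hom (A ** A) mm \<langle>u, u\<rangle> (\<pi>1 A A) A m u" "monoid_hom (A ** A) mm \<langle>u, u\<rangle> (\<pi>2 A A) A m u"
      by (simp_all add: monoid_hom_def mm_def)
    show "(\<pi>1 A A)\<^sup>- \<cdot> (\<phi>\<^sup>\<bullet> A A \<cdot> \<langle>S \<cdot> \<pi>2 A A, S \<cdot> \<pi>1 A A\<rangle>) = S \<cdot> \<pi>1 A A"
      using antipode_terminal[OF A, of "\<pi>2 A A" "A ** A"] by (intro phi_bul_proj) simp_all
    show "(\<pi>2 A A)\<^sup>- \<cdot> (\<phi>\<^sup>\<bullet> A A \<cdot> \<langle>S \<cdot> \<pi>2 A A, S \<cdot> \<pi>1 A A\<rangle>) = S \<cdot> \<pi>2 A A"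
      using antipode_terminal[OF A, of "\<pi>1 A A" "A ** A"] by (intro phi_bul_proj) simp_all
  qed simp_all
  assume f: "monoid_hom A m u f A m u" and g: "monoid_hom A m u g A m u"
  note fg = monoid_homD[OF f] monoid_homD[OF g] and [simp] = monoid_homD(1)[OF f] monoid_homD(1)[OF g]
  show "monoid_hom A m u \<langle>f, g\<rangle> (A ** A) mm \<langle>u, u\<rangle>"
    by (simp add: monoid_hom_def mm_def fg)
qed

text \<open>Multiplication and unit come from the universal property of \<open>Q\<close>. The
  antipode does not, because reversion is not assumed to preserve pullbacks and an arrow into the
  reversed \<open>Q\<close> cannot be given by components. Instead it is pushed forward along the
  reversed retraction \<open>\<rho>\<close>.\<close>

lemma pullback_hopf:
  assumes A: "hopf A mA uA SA" and B: "hopf B mB uB SB" and E: "hopf E mE uE SE"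
    and p: "monoid_hom A mA uA p B mB uB" and s: "monoid_hom B mB uB s A mA uA" and ps: "p \<cdot> s = B"
    and v: "monoid_hom E mE uE v B mB uB" and pb: "pullback C p v k q" "Dom C k = Q"
  obtains m u S where "hopf Q m u S" "monoid_hom Q m u k A mA uA" "monoid_hom Q m u q E mE uE"
proof -
  note monA = hopfD(1)[OF A] and monB = hopfD(1)[OF B] and monE = hopfD(1)[OF E]
  note [simp] = hopfD(2-)[OF A] hopfD(2-)[OF B] hopfD(2-)[OF E] monoid_homD(1)[OF p] monoid_homD(1)[OF s] monoid_homD(1)[OF v]
  note P = pullbackD[OF pb monoid_homD(1)[OF p] monoid_homD(1)[OF v]]
  note [simp] = P(1,2,4)
  have pk: "p \<cdot> (k \<cdot> h) = v \<cdot> (q \<cdot> h)" if [simp]: "h \<^bold>: V \<rightarrow> Q" for h V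
    using arg_cong[OF P(3), of "\<lambda>f. f \<cdot> h"] by simp
  have ps': "p \<cdot> (s \<cdot> h) = h" if [simp]: "h \<^bold>: V \<rightarrow> B" for h V
    using arg_cong[OF ps, of "\<lambda>f. f \<cdot> h"] by simp
  have "p \<cdot> (mA \<cdot> (k \<odot> k)) = v \<cdot> (mE \<cdot> (q \<odot> q))"
    by (simp add: monoid_hom_mult[OF monA monB p] monoid_hom_mult[OF monE monB v] P(3))
  then obtain m where m [simp]: "m \<^bold>: Q \<odot> Q \<rightarrow> Q" and km: "k \<cdot> m = mA \<cdot> (k \<odot> k)" and qm: "q \<cdot> m = mE \<cdot> (q \<odot> q)"
    using P(5)[of "mA \<cdot> (k \<odot> k)" "Q \<odot> Q" "mE \<cdot> (q \<odot> q)"] by auto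
  have "p \<cdot> uA = v \<cdot> uE" by (simp add: monoid_homD(3)[OF p] monoid_homD(3)[OF v])
  then obtain u where u [simp]: "u \<^bold>: \<I> \<rightarrow> Q" and ku: "k \<cdot> u = uA" and qu: "q \<cdot> u = uE"
    using P(5)[of uA \<I> uE] by auto
  have k: "monoid_hom Q m u k A mA uA" and q: "monoid_hom Q m u q E mE uE"
    by (simp_all add: monoid_hom_def km qm ku qu)
  \<comment> \<open>On elements, \<open>\<rho>'\<close> sends \<open>(x, y)\<close> to
    \<open>x s(p x)^-1 y\<close>.\<close>
  define \<rho>' where "\<rho>' = mA \<cdot> (\<pi>1 A \<I> \<odot> A) \<cdot> rdiv A mA SA (\<pi>1 A A) (s \<cdot> p \<cdot> \<pi>1 A A) (\<pi>2 A A)"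
  have dvA: "rdiv A mA SA x y t \<^bold>: V \<rightarrow> (A ** \<I>) \<odot> T" 
    if "x \<^bold>: V \<rightarrow> A" "y \<^bold>: V \<rightarrow> A" "t \<^bold>: V \<rightarrow> T" for x y t V T using rdiv_ty[OF A that] .
  have dvB: "rdiv B mB SB x y t \<^bold>: V \<rightarrow> (B ** \<I>) \<odot> T" 
    if "x \<^bold>: V \<rightarrow> B" "y \<^bold>: V \<rightarrow> B" "t \<^bold>: V \<rightarrow> T" for x y t V T using rdiv_ty[OF B that] .
  note [simp] = dvA dvB
  have \<rho>'_ty [simp]: "\<rho>' \<^bold>: A ** A \<rightarrow> A" by (simp add: \<rho>'_def)
  have \<rho>': "\<rho>' \<cdot> \<langle>x, y\<rangle> = mA \<cdot> (\<pi>1 A \<I> \<odot> A) \<cdot> rdiv A mA SA x (s \<cdot> p \<cdot> x) y"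
    if [simp]: "x \<^bold>: V \<rightarrow> A" "y \<^bold>: V \<rightarrow> A" for x y V
    by (simp add: \<rho>'_def rdiv_comp[OF A, of _ "A ** A" _ _ A _ V])
  \<comment> \<open>The arrow \<open>p\<close> sends \<open>x s(p x)^-1\<close> to
    \<open>(p x) (p x)^-1\<close>, which \<open>rdiv_self\<close> turns into the unit, leaving
    \<open>p y\<close>.\<close>
  have p\<rho>': "p \<cdot> (\<rho>' \<cdot> \<langle>x, y\<rangle>) = p \<cdot> y" if x [simp]: "x \<^bold>: V \<rightarrow> A" and y [simp]: "y \<^bold>: V \<rightarrow> A" for x y V
  proof -
    have [simp]: "V \<in> Obj C" using in_homD(4)[OF x] .
    have "p \<cdot> (\<rho>' \<cdot> \<langle>x, y\<rangle>) = mB \<cdot> (\<pi>1 B \<I> \<odot> B) \<cdot> ((B ** \<I>) \<odot> p) \<cdot> (\<langle>p \<cdot> \<pi>1 A \<I>, \<pi>2 A \<I>\<rangle> \<odot> A) \<cdot> rdiv A mA SA x (s \<cdot> p \<cdot> x) y"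
      by (simp add: \<rho>' monoid_hom_mult[OF monA monB p, of _ V])
    also have "(\<langle>p \<cdot> \<pi>1 A \<I>, \<pi>2 A \<I>\<rangle> \<odot> A) \<cdot> rdiv A mA SA x (s \<cdot> p \<cdot> x) y = rdiv B mB SB (p \<cdot> x) (p \<cdot> x) y"
      by (subst rdiv_hom[OF A B p, of _ V]) (simp_all add: ps')
    also have "((B ** \<I>) \<odot> p) \<cdot> rdiv B mB SB (p \<cdot> x) (p \<cdot> x) y = rdiv B mB SB (p \<cdot> x) (p \<cdot> x) (p \<cdot> y)"
      by (rule rdiv_post[OF B]) simp_all
    also have "\<dots> = (\<langle>uB, \<I>\<rangle> \<odot> (p \<cdot> y)) \<cdot> \<l>' V"
      by (rule rdiv_self[OF B, where T = B]) simp_all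
    also have "mB \<cdot> (\<pi>1 B \<I> \<odot> B) \<cdot> (\<langle>uB, \<I>\<rangle> \<odot> (p \<cdot> y)) \<cdot> \<l>' V = (mB \<cdot> (uB \<odot> B)) \<cdot> (\<I> \<odot> (p \<cdot> y)) \<cdot> \<l>' V" by simp
    also have "\<dots> = p \<cdot> y" unfolding monoid_objD(5)[OF monB] by (simp add: lu_nat')
    finally show ?thesis .
  qed
  have "p \<cdot> (\<rho>' \<cdot> \<langle>\<pi>1 A E, s \<cdot> v \<cdot> \<pi>2 A E\<rangle>) = v \<cdot> \<pi>2 A E"
    by (subst p\<rho>'[of _ "A ** E"]) (simp_all add: ps')
  then obtain \<rho> where \<rho> [simp]: "\<rho> \<^bold>: A ** E \<rightarrow> Q" and k\<rho>: "k \<cdot> \<rho> = \<rho>' \<cdot> \<langle>\<pi>1 A E, s \<cdot> v \<cdot> \<pi>2 A E\<rangle>" and q\<rho>: "q \<cdot> \<rho> = \<pi>2 A E"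
    using P(5)[of "\<rho>' \<cdot> \<langle>\<pi>1 A E, s \<cdot> v \<cdot> \<pi>2 A E\<rangle>" "A ** E" "\<pi>2 A E"] by auto
  have \<rho>'_fix: "\<rho>' \<cdot> \<langle>x, s \<cdot> p \<cdot> x\<rangle> = x" if [simp]: "x \<^bold>: V \<rightarrow> A" for x V
    by (subst \<rho>') (simp_all add: rdiv_cancel[OF A, of x V])
  have "k \<cdot> (\<rho> \<cdot> \<langle>k, q\<rangle>) = (k \<cdot> \<rho>) \<cdot> \<langle>k, q\<rangle>" by simp
  also have "\<dots> = \<rho>' \<cdot> \<langle>k, s \<cdot> p \<cdot> k\<rangle>" unfolding k\<rho> by (simp add: P(3))
  also have "\<dots> = k \<cdot> Q" by (subst \<rho>'_fix[of _ Q]) simp_all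
  finally have 1: "k \<cdot> (\<rho> \<cdot> \<langle>k, q\<rangle>) = k \<cdot> Q" .
  have "q \<cdot> (\<rho> \<cdot> \<langle>k, q\<rangle>) = (q \<cdot> \<rho>) \<cdot> \<langle>k, q\<rangle>" by simp
  also have "\<dots> = q \<cdot> Q" unfolding q\<rho> by simp
  finally have 2: "q \<cdot> (\<rho> \<cdot> \<langle>k, q\<rangle>) = q \<cdot> Q" .
  have \<rho>kq: "\<rho> \<cdot> \<langle>k, q\<rangle> = Q" by (rule P(6)[OF _ _ 1 2]) simp_all
  \<comment> \<open>The antipodes of the two factors are applied to the components of
    \<open>Q\<close>, combined by \<open>PhiBul R\<close>, which exchanges the factors, and brought
    back by the reversed \<open>\<rho>\<close>.\<close>
  define S where "S = \<rho>\<^sup>- \<cdot> \<phi>\<^sup>\<bullet> E A \<cdot> \<langle>SE \<cdot> q, SA \<cdot> k\<rangle>"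
  have S [simp]: "S \<^bold>: Q \<rightarrow> Q\<^sup>-" by (simp add: S_def)
  have "q\<^sup>- \<cdot> S = (q \<cdot> \<rho>)\<^sup>- \<cdot> \<phi>\<^sup>\<bullet> E A \<cdot> \<langle>SE \<cdot> q, SA \<cdot> k\<rangle>" by (simp add: S_def)
  also have "\<dots> = SE \<cdot> q" unfolding q\<rho>
    by (rule phi_bul_proj) (simp_all add: antipode_terminal[OF A])
  finally have Sq: "q\<^sup>- \<cdot> S = SE \<cdot> q" .
  have sv: "monoid_hom E mE uE (s \<cdot> v) A mA uA" by (rule monoid_hom_comp[OF monE monB monA v s])
  have sp: "monoid_hom A mA uA (s \<cdot> p) A mA uA" by (rule monoid_hom_comp[OF monA monB monA p s])
  note sq = hopf_square[OF A]
  let ?S2 = "\<phi>\<^sup>\<bullet> A A \<cdot> \<langle>SA \<cdot> \<pi>2 A A, SA \<cdot> \<pi>1 A A\<rangle>"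
  have g: "\<langle>A, s \<cdot> p\<rangle>\<^sup>- \<cdot> SA = ?S2 \<cdot> \<langle>A, s \<cdot> p\<rangle>"
    by (rule antipode_hom[OF A sq(1)]) (rule sq(2)[OF monoid_hom_id[OF monA] sp])
  have e: "(s \<cdot> v)\<^sup>- \<cdot> SE = SA \<cdot> (s \<cdot> v)" by (rule antipode_hom[OF E A sv])
  \<comment> \<open>As \<open>\<rho>'\<close> is not a homomorphism, antipodes cannot be moved
    across it. But on \<open>Q\<close> one has \<open>s v q = s p k\<close>, so its argument factors
    through the homomorphism given by the identity and \<open>s \<cdot> p\<close>. The antipode of
    the square is moved across that one, and \<open>\<rho>'\<close> after it is the identity by
    \<open>\<rho>'_fix\<close>.\<close>
  have "k\<^sup>- \<cdot> S = (k \<cdot> \<rho>)\<^sup>- \<cdot> \<phi>\<^sup>\<bullet> E A \<cdot> \<langle>SE \<cdot> q, SA \<cdot> k\<rangle>" by (simp add: S_def)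
  also have "\<dots> = \<rho>'\<^sup>- \<cdot> \<langle>\<pi>1 A E, s \<cdot> v \<cdot> \<pi>2 A E\<rangle>\<^sup>- \<cdot> \<phi>\<^sup>\<bullet> E A \<cdot> \<langle>SE \<cdot> q, SA \<cdot> k\<rangle>" unfolding k\<rho>
    by (subst rv_comp[of _ "A ** E" "A ** A" _ A]) simp_all
  also have "\<langle>\<pi>1 A E, s \<cdot> v \<cdot> \<pi>2 A E\<rangle>\<^sup>- \<cdot> \<phi>\<^sup>\<bullet> E A \<cdot> \<langle>SE \<cdot> q, SA \<cdot> k\<rangle> = \<phi>\<^sup>\<bullet> A A \<cdot> \<langle>((s \<cdot> v)\<^sup>- \<cdot> SE) \<cdot> q, SA \<cdot> k\<rangle>"
    using phi_bul_nat[of "s \<cdot> v" E A A A A "SE \<cdot> q" Q "SA \<cdot> k"] by simp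
  also have "\<dots> = (?S2 \<cdot> \<langle>A, s \<cdot> p\<rangle>) \<cdot> k" unfolding e by (simp add: P(3))
  also have "\<dots> = \<langle>A, s \<cdot> p\<rangle>\<^sup>- \<cdot> SA \<cdot> k" unfolding g[symmetric] by simp
  finally have "k\<^sup>- \<cdot> S = \<rho>'\<^sup>- \<cdot> \<langle>A, s \<cdot> p\<rangle>\<^sup>- \<cdot> SA \<cdot> k" .
  also have "\<dots> = (\<rho>' \<cdot> \<langle>A, s \<cdot> p\<rangle>)\<^sup>- \<cdot> SA \<cdot> k"
    by (subst rv_comp[of "\<langle>A, s \<cdot> p\<rangle>" A "A ** A" \<rho>' A]) simp_all
  also have "\<rho>' \<cdot> \<langle>A, s \<cdot> p\<rangle> = A" using \<rho>'_fix[of A A] by simp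
  finally have Sk: "k\<^sup>- \<cdot> S = SA \<cdot> k" by simp
  have "hopf Q m u S"
    by (rule hopf_subproduct[OF _ m u S A k Sk E q Sq \<rho> \<rho>kq]) simp
  thus ?thesis using that k q by blast
qed

subsection \<open>Morphisms of points\<close>

text \<open>The quotient \<open>x y^-1\<close> as an arrow of its own: the spectator
  \<open>t\<close> of \<open>rdiv\<close> is an arrow \<open>i\<close> to the unit, which the unit
  constraint then absorbs. In spans, \<open>i\<close> says that \<open>x\<close> and
  \<open>y\<close> are loops.\<close>

definition quot where
  "quot G m S x y i = \<pi>1 G \<I> \<cdot> \<r> (G ** \<I>) \<cdot> rdiv G m S x y i"

lemma quot_ty:
  assumes "hopf G m u S" "x \<^bold>: V \<rightarrow> G" "y \<^bold>: V \<rightarrow> G" "i \<^bold>: V \<rightarrow> \<I>"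
  shows "quot G m S x y i \<^bold>: V \<rightarrow> G"
  using rdiv_ty[OF assms] hopfD(3)[OF assms(1)] by (simp add: quot_def)

lemma quot_comp:
  assumes G: "hopf G m u S" and xyi: "x \<^bold>: V \<rightarrow> G" "y \<^bold>: V \<rightarrow> G" "i \<^bold>: V \<rightarrow> \<I>" and h: "h \<^bold>: W \<rightarrow> V"
  shows "quot G m S x y i \<cdot> h = quot G m S (x \<cdot> h) (y \<cdot> h) (i \<cdot> h)"
  using rdiv_ty[OF G xyi] hopfD(3)[OF G] rdiv_comp[OF G xyi h] h by (simp add: quot_def)

lemma quot_hom:
  assumes G: "hopf G m u S" and K: "hopf K m' u' S'" and f: "monoid_hom G m u f K m' u'"
    and xyi: "x \<^bold>: V \<rightarrow> G" "y \<^bold>: V \<rightarrow> G" "i \<^bold>: V \<rightarrow> \<I>"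
  shows "f \<cdot> quot G m S x y i = quot K m' S' (f \<cdot> x) (f \<cdot> y) i"
proof -
  note [simp] = hopfD(3)[OF G] hopfD(3)[OF K] monoid_homD(1)[OF f] xyi rdiv_ty[OF G xyi]
  have "quot K m' S' (f \<cdot> x) (f \<cdot> y) i
      = \<pi>1 K \<I> \<cdot> \<r> (K ** \<I>) \<cdot> (\<langle>f \<cdot> \<pi>1 G \<I>, \<pi>2 G \<I>\<rangle> \<odot> \<I>) \<cdot> rdiv G m S x y i"
    unfolding quot_def rdiv_hom[OF G K f xyi, symmetric] ..
  also have "\<dots> = f \<cdot> quot G m S x y i" by (simp add: ru_nat' quot_def)
  finally show ?thesis by (rule sym)
qed

lemma quot_self:
  assumes G: "hopf G m u S" and x: "x \<^bold>: V \<rightarrow> G" and i [simp]: "i \<^bold>: V \<rightarrow> \<I>"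
  shows "quot G m S x x i = u \<cdot> i"
proof -
  note [simp] = hopfD(3-)[OF G] in_homD(4)[OF i]
  have "(\<langle>u, \<I>\<rangle> \<odot> i) \<cdot> \<l>' V = ((\<langle>u, \<I>\<rangle> \<cdot> i) \<odot> \<I>) \<cdot> \<r>' V"
    using unit_swap[of i V "\<langle>u, \<I>\<rangle>" "G ** \<I>" \<I> \<I>] by simp
  thus ?thesis by (simp add: quot_def rdiv_self[OF G x i] ru_nat')
qed

text \<open>\<open>rdiv_cancel\<close> gives \<open>(x 1^-1) 1 = x\<close>, and the outer factor
  \<open>1\<close> disappears by the right unit law.\<close>

lemma quot_unit:
  assumes G: "hopf G m u S" and x: "x \<^bold>: V \<rightarrow> G" and i: "i \<^bold>: V \<rightarrow> \<I>"
  shows "quot G m S x (u \<cdot> i) i = x"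
proof -
  note [simp] = hopfD(3-)[OF G] x i
  note mon = monoid_objD[OF hopfD(1)[OF G]]
  have ui: "u \<cdot> i \<^bold>: V \<rightarrow> G" by simp
  note d [simp] = rdiv_ty[OF G x ui i]
  have "x = m \<cdot> (\<pi>1 G \<I> \<odot> G) \<cdot> rdiv G m S x (u \<cdot> i) (u \<cdot> i)"
    by (rule rdiv_cancel[OF G x ui, symmetric])
  also have "\<dots> = (m \<cdot> (G \<odot> u)) \<cdot> (\<pi>1 G \<I> \<odot> \<I>) \<cdot> rdiv G m S x (u \<cdot> i) i"
    unfolding rdiv_post[OF G x ui i hopfD(5)[OF G], symmetric] by simp
  also have "\<dots> = quot G m S x (u \<cdot> i) i" unfolding mon(6) by (simp add: quot_def ru_nat')
  finally show ?thesis by (rule sym)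
qed

text \<open>The first factor \<open>c = a s(p a)^-1\<close> exists only inside a tensor product, so
  it cannot be lifted to a pullback directly. The map \<open>c \<mapsto> c s(p c)^-1\<close>, in
  contrast, is defined on all of \<open>A ** \<I>\<close> and lies over the unit of
  \<open>B\<close>. Applying it to \<open>c\<close> changes nothing since \<open>s(p c)\<close> is
  the unit, and the remaining product is \<open>rdiv_cancel\<close>.\<close>

lemma point_decomposition:
  assumes A: "hopf A m u S" and B: "hopf B mB uB SB"
    and p: "monoid_hom A m u p B mB uB" and s: "monoid_hom B mB uB s A m u" and ps: "p \<cdot> s = B"
  shows "m \<cdot> (quot A m S (\<pi>1 A \<I>) (s \<cdot> p \<cdot> \<pi>1 A \<I>) (\<pi>2 A \<I>) \<odot> s) \<cdot> rdiv A m S A (s \<cdot> p) p = A"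
proof -
  note [simp] = hopfD(2-)[OF A] hopfD(2-)[OF B] monoid_homD(1)[OF p] monoid_homD(1)[OF s]
  have sp: "monoid_hom A m u (s \<cdot> p) A m u"
    by (rule monoid_hom_comp[OF hopfD(1)[OF A] hopfD(1)[OF B] hopfD(1)[OF A] p s])
  have ps': "p \<cdot> (s \<cdot> h) = h" if [simp]: "h \<^bold>: V \<rightarrow> B" for h V
    using arg_cong[OF ps, of "\<lambda>f. f \<cdot> h"] by simp
  let ?a = "rdiv A m S A (s \<cdot> p) p"
  have a [simp]: "?a \<^bold>: A \<rightarrow> (A ** \<I>) \<odot> B" by (rule rdiv_ty[OF A]) simp_all
  let ?Y = "(A ** A) ** \<I>"
  let ?d0 = "\<langle>\<langle>\<pi>1 A \<I>, s \<cdot> p \<cdot> \<pi>1 A \<I>\<rangle>, \<pi>2 A \<I>\<rangle>"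
  let ?d1 = "\<langle>\<langle>\<pi>1 A \<I>, u \<cdot> \<pi>2 A \<I>\<rangle>, \<pi>2 A \<I>\<rangle>"
  \<comment> \<open>Expresses \<open>s(p c) = 1\<close> inside the tensor product. The component
    with the second entry follows from \<open>rdiv_hom\<close> and \<open>rdiv_self\<close>; the
    component with the first entry is \<open>c\<close> on both sides.\<close>
  have d: "(?d0 \<odot> B) \<cdot> ?a = (?d1 \<odot> B) \<cdot> ?a"
  proof (rule separation_right[where ?y1.0 = "\<langle>\<pi>2 A A \<cdot> \<pi>1 (A ** A) \<I>, \<pi>2 (A ** A) \<I>\<rangle>"
        and ?y2.0 = "\<langle>\<pi>1 A A \<cdot> \<pi>1 (A ** A) \<I>, \<pi>2 (A ** A) \<I>\<rangle>" and X = A and Z = A and T = B and Y = ?Y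
        and z = "\<langle>\<langle>\<pi>1 A \<I> \<cdot> \<pi>2 (A ** \<I>) (A ** \<I>), \<pi>1 A \<I> \<cdot> \<pi>1 (A ** \<I>) (A ** \<I>)\<rangle>, \<pi>2 A \<I> \<cdot> \<pi>1 (A ** \<I>) (A ** \<I>)\<rangle>"])
    have "(\<langle>\<pi>2 A A \<cdot> \<pi>1 (A ** A) \<I>, \<pi>2 (A ** A) \<I>\<rangle> \<odot> \<tau> B) \<cdot> (?d0 \<odot> B) \<cdot> ?a
        = ((A ** \<I>) \<odot> \<tau> B) \<cdot> (\<langle>(s \<cdot> p) \<cdot> \<pi>1 A \<I>, \<pi>2 A \<I>\<rangle> \<odot> B) \<cdot> ?a" by simp
    also have "(\<langle>(s \<cdot> p) \<cdot> \<pi>1 A \<I>, \<pi>2 A \<I>\<rangle> \<odot> B) \<cdot> ?a = rdiv A m S (s \<cdot> p) (s \<cdot> p) p"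
      by (subst rdiv_hom[OF A A sp, of _ A]) (simp_all add: ps')
    also have "\<dots> = (\<langle>u, \<I>\<rangle> \<odot> p) \<cdot> \<l>' A" by (rule rdiv_self[OF A]) simp_all
    also have "((A ** \<I>) \<odot> \<tau> B) \<cdot> (\<langle>u, \<I>\<rangle> \<odot> p) \<cdot> \<l>' A = (\<langle>u, \<I>\<rangle> \<odot> \<tau> B) \<cdot> (\<I> \<odot> p) \<cdot> \<l>' A" by simp
    also have "\<dots> = (\<langle>u, \<I>\<rangle> \<odot> \<tau> B) \<cdot> ((\<pi>2 A \<I> \<odot> B) \<cdot> ?a)" 
      by (subst rdiv_proj[OF A, of _ A]) simp_all
    also have "\<dots> = (\<langle>\<pi>2 A A \<cdot> \<pi>1 (A ** A) \<I>, \<pi>2 (A ** A) \<I>\<rangle> \<odot> \<tau> B) \<cdot> (?d1 \<odot> B) \<cdot> ?a" by simp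
    finally show "(\<langle>\<pi>2 A A \<cdot> \<pi>1 (A ** A) \<I>, \<pi>2 (A ** A) \<I>\<rangle> \<odot> \<tau> B) \<cdot> (?d0 \<odot> B) \<cdot> ?a = \<dots>" .
  qed (simp_all add: pair_eta)
  \<comment> \<open>The quotient of the two entries: along \<open>?d0\<close> it is
    \<open>c s(p c)^-1\<close>, and along \<open>?d1\<close> it is
    \<open>c 1^-1 = c\<close>.\<close>
  let ?w = "quot A m S (\<pi>1 A A \<cdot> \<pi>1 (A ** A) \<I>) (\<pi>2 A A \<cdot> \<pi>1 (A ** A) \<I>) (\<pi>2 (A ** A) \<I>)"
  have w [simp]: "?w \<^bold>: ?Y \<rightarrow> A" by (rule quot_ty[OF A]) simp_all
  have wd0: "?w \<cdot> ?d0 = quot A m S (\<pi>1 A \<I>) (s \<cdot> p \<cdot> \<pi>1 A \<I>) (\<pi>2 A \<I>)"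
    by (subst quot_comp[OF A, of _ ?Y]) simp_all
  have wd1: "?w \<cdot> ?d1 = \<pi>1 A \<I>"
    by (subst quot_comp[OF A, of _ ?Y]) (simp_all add: quot_unit[OF A, of _ "A ** \<I>"])
  have "m \<cdot> (quot A m S (\<pi>1 A \<I>) (s \<cdot> p \<cdot> \<pi>1 A \<I>) (\<pi>2 A \<I>) \<odot> s) \<cdot> ?a = m \<cdot> (?w \<odot> s) \<cdot> ((?d0 \<odot> B) \<cdot> ?a)"
    unfolding wd0[symmetric] by simp
  also have "\<dots> = m \<cdot> ((?w \<cdot> ?d1) \<odot> s) \<cdot> ?a" unfolding d by simp
  also have "\<dots> = m \<cdot> (\<pi>1 A \<I> \<odot> A) \<cdot> ((A ** \<I>) \<odot> s) \<cdot> ?a" unfolding wd1 by simp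
  also have "((A ** \<I>) \<odot> s) \<cdot> ?a = rdiv A m S A (s \<cdot> p) (s \<cdot> p)"
    by (rule rdiv_post[OF A]) simp_all
  also have "m \<cdot> (\<pi>1 A \<I> \<odot> A) \<cdot> rdiv A m S A (s \<cdot> p) (s \<cdot> p) = A"
    by (rule rdiv_cancel[OF A]) simp_all
  finally show ?thesis .
qed

text \<open>The pairs \<open>\<Phi>\<close>, \<open>\<Phi>'\<close> and \<open>\<Psi>\<close>,
  \<open>\<Psi>'\<close> form commutative squares from \<open>f\<close> to
  \<open>g \<odot> B\<close> and back with composite the identity. So inverting \<open>g\<close> in
  the middle yields the inverse of \<open>f\<close>.\<close>

lemma point_morphism_iso:
  assumes A: "hopf A m u S" and A': "hopf A' m' u' S'" and B: "hopf B mB uB SB" and E: "hopf E mE uE SE"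
    and p: "monoid_hom A m u p B mB uB" and s: "monoid_hom B mB uB s A m u" and ps: "p \<cdot> s = B"
    and p': "monoid_hom A' m' u' p' B mB uB" and s': "monoid_hom B mB uB s' A' m' u'" and ps': "p' \<cdot> s' = B"
    and v: "monoid_hom E mE uE v B mB uB"
    and f: "monoid_hom A m u f A' m' u'" and fp: "p' \<cdot> f = p" and fs: "f \<cdot> s = s'"
    and pb: "pullback C p v k q" "Dom C k = Q" and pb': "pullback C p' v k' q'" "Dom C k' = Q'"
    and g: "g \<^bold>: Q \<rightarrow> Q'" "k' \<cdot> g = f \<cdot> k" "q' \<cdot> g = q"
    and gi: "gi \<^bold>: Q' \<rightarrow> Q" "gi \<cdot> g = Q" "g \<cdot> gi = Q'"
  obtains h where "h \<^bold>: A' \<rightarrow> A" "h \<cdot> f = A" "f \<cdot> h = A'"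
proof -
  note [simp] = hopfD(2-)[OF A] hopfD(2-)[OF A'] hopfD(2-)[OF B] hopfD(2-)[OF E] monoid_homD(1)[OF p] monoid_homD(1)[OF s]
    monoid_homD(1)[OF p'] monoid_homD(1)[OF s'] monoid_homD(1)[OF v] monoid_homD(1)[OF f] g(1) gi(1)
  note P = pullbackD[OF pb monoid_homD(1)[OF p] monoid_homD(1)[OF v]]
  note P' = pullbackD[OF pb' monoid_homD(1)[OF p'] monoid_homD(1)[OF v]]
  note [simp] = P(1,2,4) P'(1,2,4)
  \<comment> \<open>The quotient \<open>c s(p c)^-1\<close> lies over the unit of \<open>B\<close>,
    hence over the image of the unit of \<open>E\<close> under \<open>v\<close>. Together with that
    unit it determines an arrow to the pullback.\<close>
  have lift: "\<exists>\<epsilon>. \<epsilon> \<^bold>: A ** \<I> \<rightarrow> Q \<and> k \<cdot> \<epsilon> = quot A m S (\<pi>1 A \<I>) (s \<cdot> p \<cdot> \<pi>1 A \<I>) (\<pi>2 A \<I>) \<and> q \<cdot> \<epsilon> = uE \<cdot> \<pi>2 A \<I>"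
    if A: "hopf A m u S" and p: "monoid_hom A m u p B mB uB" and s: "monoid_hom B mB uB s A m u" and ps: "p \<cdot> s = B"
      and pb: "pullback C p v k q" "Dom C k = Q" for A m u S p s k q Q
  proof -
    note [simp] = hopfD(2-)[OF A] monoid_homD(1)[OF p] monoid_homD(1)[OF s]
    have ps': "p \<cdot> (s \<cdot> h) = h" if [simp]: "h \<^bold>: V \<rightarrow> B" for h V
      using arg_cong[OF ps, of "\<lambda>f. f \<cdot> h"] by simp
    let ?e = "quot A m S (\<pi>1 A \<I>) (s \<cdot> p \<cdot> \<pi>1 A \<I>) (\<pi>2 A \<I>)"
    have e: "?e \<^bold>: A ** \<I> \<rightarrow> A" by (rule quot_ty[OF A]) simp_all
    have "p \<cdot> ?e = quot B mB SB (p \<cdot> \<pi>1 A \<I>) (p \<cdot> \<pi>1 A \<I>) (\<pi>2 A \<I>)"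
      by (subst quot_hom[OF A B p, of _ "A ** \<I>"]) (simp_all add: ps')
    also have "\<dots> = uB \<cdot> \<pi>2 A \<I>" by (rule quot_self[OF B]) simp_all
    also have "\<dots> = v \<cdot> (uE \<cdot> \<pi>2 A \<I>)" unfolding monoid_homD(3)[OF v, symmetric] by simp
    finally show ?thesis
      by (intro pullbackD(5)[OF pb monoid_homD(1)[OF p] monoid_homD(1)[OF v]] e) simp_all
  qed
  obtain \<epsilon> where \<epsilon> [simp]: "\<epsilon> \<^bold>: A ** \<I> \<rightarrow> Q" and k\<epsilon>: "k \<cdot> \<epsilon> = quot A m S (\<pi>1 A \<I>) (s \<cdot> p \<cdot> \<pi>1 A \<I>) (\<pi>2 A \<I>)"
    and q\<epsilon>: "q \<cdot> \<epsilon> = uE \<cdot> \<pi>2 A \<I>"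
    using lift[OF A p s ps pb] by blast
  obtain \<epsilon>' where \<epsilon>' [simp]: "\<epsilon>' \<^bold>: A' ** \<I> \<rightarrow> Q'" and k\<epsilon>': "k' \<cdot> \<epsilon>' = quot A' m' S' (\<pi>1 A' \<I>) (s' \<cdot> p' \<cdot> \<pi>1 A' \<I>) (\<pi>2 A' \<I>)"
    and q\<epsilon>': "q' \<cdot> \<epsilon>' = uE \<cdot> \<pi>2 A' \<I>"
    using lift[OF A' p' s' ps' pb'] by blast
  let ?a = "rdiv A m S A (s \<cdot> p) p" and ?a' = "rdiv A' m' S' A' (s' \<cdot> p') p'"
  have a [simp]: "?a \<^bold>: A \<rightarrow> (A ** \<I>) \<odot> B" by (rule rdiv_ty[OF A]) simp_all
  have a' [simp]: "?a' \<^bold>: A' \<rightarrow> (A' ** \<I>) \<odot> B" by (rule rdiv_ty[OF A']) simp_all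
  define \<Phi> where "\<Phi> = (\<epsilon> \<odot> B) \<cdot> ?a"
  define \<Psi> where "\<Psi> = m \<cdot> (k \<odot> s)"
  define \<Phi>' where "\<Phi>' = (\<epsilon>' \<odot> B) \<cdot> ?a'"
  define \<Psi>' where "\<Psi>' = m' \<cdot> (k' \<odot> s')"
  have [simp]: "\<Phi> \<^bold>: A \<rightarrow> Q \<odot> B" "\<Psi> \<^bold>: Q \<odot> B \<rightarrow> A" "\<Phi>' \<^bold>: A' \<rightarrow> Q' \<odot> B" "\<Psi>' \<^bold>: Q' \<odot> B \<rightarrow> A'"
    by (simp_all add: \<Phi>_def \<Psi>_def \<Phi>'_def \<Psi>'_def)
  have \<Psi>\<Phi>: "\<Psi> \<cdot> \<Phi> = A"
    using point_decomposition[OF A B p s ps] by (simp add: \<Phi>_def \<Psi>_def k\<epsilon>)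
  have \<Psi>\<Phi>': "\<Psi>' \<cdot> \<Phi>' = A'"
    using point_decomposition[OF A' B p' s' ps'] by (simp add: \<Phi>'_def \<Psi>'_def k\<epsilon>')
  have f\<Psi>: "f \<cdot> \<Psi> = \<Psi>' \<cdot> (g \<odot> B)"
    by (simp add: \<Psi>_def \<Psi>'_def monoid_hom_mult[OF hopfD(1)[OF A] hopfD(1)[OF A'] f] g(2) fs)
  let ?f = "\<langle>f \<cdot> \<pi>1 A \<I>, \<pi>2 A \<I>\<rangle>"
  have fsp: "f \<cdot> (s \<cdot> p \<cdot> h) = s' \<cdot> p' \<cdot> f \<cdot> h" if [simp]: "h \<^bold>: V \<rightarrow> A" for h V
    using arg_cong[OF fs, of "\<lambda>x. x \<cdot> p \<cdot> h"] arg_cong[OF fp, of "\<lambda>x. x \<cdot> h"] by simp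
  \<comment> \<open>Naturality of the lifts, checked on both projections of \<open>Q'\<close>;
    homomorphisms preserve quotients by \<open>quot_hom\<close>.\<close>
  have g\<epsilon>: "g \<cdot> \<epsilon> = \<epsilon>' \<cdot> ?f"
  proof (rule P'(6))
    have "k' \<cdot> (g \<cdot> \<epsilon>) = (k' \<cdot> g) \<cdot> \<epsilon>" by simp
    also have "\<dots> = f \<cdot> quot A m S (\<pi>1 A \<I>) (s \<cdot> p \<cdot> \<pi>1 A \<I>) (\<pi>2 A \<I>)" unfolding g(2) by (simp add: k\<epsilon>)
    also have "\<dots> = quot A' m' S' (f \<cdot> \<pi>1 A \<I>) (s' \<cdot> p' \<cdot> f \<cdot> \<pi>1 A \<I>) (\<pi>2 A \<I>)"
      by (subst quot_hom[OF A A' f, of _ "A ** \<I>"]) (simp_all add: fsp)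
    also have "\<dots> = quot A' m' S' (\<pi>1 A' \<I>) (s' \<cdot> p' \<cdot> \<pi>1 A' \<I>) (\<pi>2 A' \<I>) \<cdot> ?f"
      by (subst quot_comp[OF A', of _ "A' ** \<I>"]) simp_all
    also have "\<dots> = k' \<cdot> (\<epsilon>' \<cdot> ?f)" unfolding k\<epsilon>'[symmetric] by simp
    finally show "k' \<cdot> (g \<cdot> \<epsilon>) = k' \<cdot> (\<epsilon>' \<cdot> ?f)" .
    have "q' \<cdot> (g \<cdot> \<epsilon>) = (q' \<cdot> g) \<cdot> \<epsilon>" by simp
    also have "\<dots> = uE \<cdot> \<pi>2 A \<I>" unfolding g(3) by (rule q\<epsilon>)
    also have "\<dots> = (q' \<cdot> \<epsilon>') \<cdot> ?f" unfolding q\<epsilon>' by simp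
    also have "\<dots> = q' \<cdot> (\<epsilon>' \<cdot> ?f)" by simp
    finally show "q' \<cdot> (g \<cdot> \<epsilon>) = q' \<cdot> (\<epsilon>' \<cdot> ?f)" .
  qed simp_all
  have fa: "(?f \<odot> B) \<cdot> ?a = ?a' \<cdot> f"
  proof -
    have "(?f \<odot> B) \<cdot> ?a = rdiv A' m' S' f (s' \<cdot> p' \<cdot> f) p"
      using fsp[of A A] by (subst rdiv_hom[OF A A' f, of _ A]) simp_all
    also have "\<dots> = ?a' \<cdot> f" by (subst rdiv_comp[OF A', of _ A' _ _ B _ A]) (simp_all add: fp)
    finally show ?thesis .
  qed
  have "(g \<odot> B) \<cdot> \<Phi> = (\<epsilon>' \<odot> B) \<cdot> ((?f \<odot> B) \<cdot> ?a)" by (simp add: \<Phi>_def g\<epsilon>)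
  also have "\<dots> = \<Phi>' \<cdot> f" unfolding fa by (simp add: \<Phi>'_def)
  finally have g\<Phi>: "(g \<odot> B) \<cdot> \<Phi> = \<Phi>' \<cdot> f" .
  show ?thesis
  proof
    show "\<Psi> \<cdot> (gi \<odot> B) \<cdot> \<Phi>' \<^bold>: A' \<rightarrow> A" by simp
    have "(\<Psi> \<cdot> (gi \<odot> B) \<cdot> \<Phi>') \<cdot> f = \<Psi> \<cdot> (gi \<odot> B) \<cdot> (g \<odot> B) \<cdot> \<Phi>" unfolding g\<Phi> by simp
    also have "\<dots> = A" using \<Psi>\<Phi> by (simp add: gi(2))
    finally show "(\<Psi> \<cdot> (gi \<odot> B) \<cdot> \<Phi>') \<cdot> f = A" .
    have "f \<cdot> (\<Psi> \<cdot> (gi \<odot> B) \<cdot> \<Phi>') = (f \<cdot> \<Psi>) \<cdot> (gi \<odot> B) \<cdot> \<Phi>'" by simp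
    also have "\<dots> = A'" unfolding f\<Psi> using \<Psi>\<Phi>' by (simp add: gi(3))
    finally show "f \<cdot> (\<Psi> \<cdot> (gi \<odot> B) \<cdot> \<Phi>') = A'" .
  qed
qed

subsection \<open>The category of internal groups\<close>

lemma is_monoid_iff: "is_monoid C M G m u \<longleftrightarrow> monoid_obj G m u"
  by (simp add: is_monoid_def monoid_obj_def)

lemma is_comonoid_iff:
  assumes [simp]: "G \<in> Obj C"
  shows "is_comonoid C (cartesian_monoidal C P) G d e \<longleftrightarrow> d = \<langle>G, G\<rangle> \<and> e = \<tau> G"
proof
  assume *: "is_comonoid C (cartesian_monoidal C P) G d e"
  have d [simp]: "d \<^bold>: G \<rightarrow> G ** G" and e [simp]: "e \<^bold>: G \<rightarrow> \<J>"
    using * by (simp_all add: is_comonoid_def duo_simps)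
  have "\<pi>2 G G \<cdot> d = G" "\<pi>1 G G \<cdot> d = G"
    using * by (simp_all add: is_comonoid_def duo_simps)
  hence "d = \<langle>G, G\<rangle>" using pair_eta[OF d] by simp
  moreover have "e = \<tau> G" by (rule terminal_eqI) simp_all
  ultimately show "d = \<langle>G, G\<rangle> \<and> e = \<tau> G" by blast
next
  assume "d = \<langle>G, G\<rangle> \<and> e = \<tau> G"
  thus "is_comonoid C (cartesian_monoidal C P) G d e"
    by (simp add: is_comonoid_def duo_simps)
qed

text \<open>Every arrow commutes with diagonals and with the arrows to \<open>J\<close>, so the
  compatibility conditions hold automatically once the comonoid is the only possible one.\<close>

lemma bimonoid_iff:
  "duoidal_data.bimonoid C (cartesian_duoidal C M P) H \<longleftrightarrow>
    monoid_obj (Under H) (Mult H) (One H) \<and> Comult H = \<langle>Under H, Under H\<rangle> \<and> Counit H = \<tau> (Under H)"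
proof -
  have "duoidal_data.bimonoid C (cartesian_duoidal C M P) H"
    if mon: "monoid_obj (Under H) (Mult H) (One H)" and c: "Comult H = \<langle>Under H, Under H\<rangle>" "Counit H = \<tau> (Under H)"
  proof -
    note [simp] = monoid_objD(1-3)[OF mon]
    show ?thesis unfolding duoidal_data.bimonoid_def using mon
      by (simp add: duo_simps is_monoid_iff is_comonoid_iff c)
  qed
  thus ?thesis
    unfolding duoidal_data.bimonoid_def duo_simps is_monoid_iff
    using is_comonoid_iff[OF monoid_objD(1)] by blast
qed

lemma antipode_iff:
  assumes mon: "monoid_obj (Under H) (Mult H) (One H)"
    and c: "Comult H = \<langle>Under H, Under H\<rangle>" "Counit H = \<tau> (Under H)"
  shows "reversion_data.antipode C (cartesian_duoidal C M P) R H S \<longleftrightarrow> hopf (Under H) (Mult H) (One H) S"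
proof (cases "S \<^bold>: Under H \<rightarrow> (Under H)\<^sup>-")
  case [simp]: True
  note [simp] = monoid_objD(1-3)[OF mon]
  let ?G = "Under H"
  have l: "\<l>' \<J> \<cdot> \<tau> ?G = (\<I> \<odot> \<tau> ?G) \<cdot> \<l>' ?G" by (rule li_nat) simp
  have r: "\<r>' \<J> \<cdot> \<tau> ?G = (\<tau> ?G \<odot> \<I>) \<cdot> \<r>' ?G" by (rule ri_nat) simp
  have ls: "\<l>' (?G\<^sup>-) \<cdot> S = (\<I> \<odot> S) \<cdot> \<l>' ?G" by (rule li_nat) simp
  have rs: "\<r>' (?G\<^sup>-) \<cdot> S = (S \<odot> \<I>) \<cdot> \<r>' ?G" by (rule ri_nat) simp
  show ?thesis unfolding reversion_data.antipode_def hopf_def duo_simps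
    using mon by (simp add: derived_reversion c l r ls rs)
next
  case False
  thus ?thesis by (simp add: reversion_data.antipode_def hopf_def)
qed

definition group :: "'a bimonoid \<Rightarrow> bool" where
  "group H \<longleftrightarrow> (\<exists>S. hopf (Under H) (Mult H) (One H) S) \<and>
    Comult H = \<langle>Under H, Under H\<rangle> \<and> Counit H = \<tau> (Under H) \<and> monic C (One H)"

abbreviation group_hom :: "'a bimonoid \<Rightarrow> 'a \<Rightarrow> 'a bimonoid \<Rightarrow> bool" where
  "group_hom H f K \<equiv> monoid_hom (Under H) (Mult H) (One H) f (Under K) (Mult K) (One K)"

lemma groupD:
  assumes "group H"
  shows "monoid_obj (Under H) (Mult H) (One H)" "Under H \<in> Obj C"
    "Mult H \<^bold>: Under H \<odot> Under H \<rightarrow> Under H" "One H \<^bold>: \<I> \<rightarrow> Under H"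
  using assms hopfD unfolding group_def by blast+

abbreviation groups ("\<G>") where "\<G> \<equiv> Grp_m C M P R"

lemma Grp_m_Arr:
  "x \<in> Arr \<G> \<longleftrightarrow> (\<exists>H f K. x = (H, f, K) \<and> group H \<and> group K \<and> group_hom H f K)"
proof -
  have h: "reversion_data.hopf_monoid C (cartesian_duoidal C M P) R H \<and> monic C (One H) \<longleftrightarrow> group H" for H
    unfolding reversion_data.hopf_monoid_def bimonoid_iff group_def using antipode_iff[of H] hopfD(1) by blast
  have m: "duoidal_data.bimonoid_morphism C (cartesian_duoidal C M P) H f K \<longleftrightarrow> group_hom H f K"
    if "group H" "group K" for H f K
  proof (cases "f \<^bold>: Under H \<rightarrow> Under K")
    case [simp]: True
    note [simp] = groupD(2-)[OF that(1)] groupD(2-)[OF that(2)]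
    show ?thesis using that
      by (simp add: duoidal_data.bimonoid_morphism_def monoid_hom_def duo_simps group_def)
  next
    case False
    thus ?thesis by (simp add: duoidal_data.bimonoid_morphism_def monoid_hom_def)
  qed
  have "x \<in> Arr \<G> \<longleftrightarrow> (\<exists>H f K. x = (H, f, K) \<and>
      (reversion_data.hopf_monoid C (cartesian_duoidal C M P) R H \<and> monic C (One H)) \<and>
      (reversion_data.hopf_monoid C (cartesian_duoidal C M P) R K \<and> monic C (One K)) \<and>
      duoidal_data.bimonoid_morphism C (cartesian_duoidal C M P) H f K)"
    by (auto simp: Grp_m_def Grp_def full_subcategory_def reversion_data.hopf_category_def)
  also have "\<dots> \<longleftrightarrow> (\<exists>H f K. x = (H, f, K) \<and> group H \<and> group K \<and> group_hom H f K)"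
    unfolding h using m by blast
  finally show ?thesis .
qed

lemma Grp_m_simps [simp]:
  "Dom \<G> (H, f, K) = (H, Under H, H)"
  "Cod \<G> (H, f, K) = (K, Under K, K)"
  "Comp \<G> (K', g, L) (H, f, K) = (H, g \<cdot> f, L)"
  by (simp_all add: Grp_m_def Grp_def full_subcategory_def reversion_data.hopf_category_def)

lemma Grp_m_Hom:
  "x \<in> Hom \<G> X Y \<longleftrightarrow> (\<exists>H f K. x = (H, f, K) \<and> X = (H, Under H, H) \<and> Y = (K, Under K, K) \<and>
    group H \<and> group K \<and> group_hom H f K)"
  unfolding Hom_def using Grp_m_Arr by auto

lemma category_Grp_m: "category \<G>"
proof
  fix f assume "f \<in> Arr \<G>"
  then obtain H f' K where f: "f = (H, f', K)" and HK: "group H" "group K" "group_hom H f' K"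
    unfolding Grp_m_Arr by blast
  note [simp] = groupD(2)[OF HK(1)] groupD(2)[OF HK(2)] monoid_homD(1)[OF HK(3)]
  show "Dom \<G> f \<in> Arr \<G>" "Cod \<G> f \<in> Arr \<G>"
    using HK monoid_hom_id[OF groupD(1)] unfolding Grp_m_Arr f by auto
  show "Dom \<G> (Dom \<G> f) = Dom \<G> f"
    "Cod \<G> (Dom \<G> f) = Dom \<G> f"
    "Dom \<G> (Cod \<G> f) = Cod \<G> f"
    "Cod \<G> (Cod \<G> f) = Cod \<G> f"
    "Comp \<G> f (Dom \<G> f) = f"
    "Comp \<G> (Cod \<G> f) f = f"
    by (simp_all add: f)
next
  fix f g X Y Z assume "f \<in> Hom \<G> X Y" "g \<in> Hom \<G> Y Z"
  then obtain H f' K g' L where "f = (H, f', K)" "g = (K, g', L)" "X = (H, Under H, H)" "Z = (L, Under L, L)"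
    and "group H" "group K" "group L" "group_hom H f' K" "group_hom K g' L"
    unfolding Grp_m_Hom by blast
  thus "Comp \<G> g f \<in> Hom \<G> X Z"
    unfolding Grp_m_Hom using monoid_hom_comp[OF groupD(1) groupD(1) groupD(1)] by auto
next
  fix f g h W X Y Z
  assume "f \<in> Hom \<G> W X" "g \<in> Hom \<G> X Y" "h \<in> Hom \<G> Y Z"
  then obtain H f' K g' L h' N where fgh: "f = (H, f', K)" "g = (K, g', L)" "h = (L, h', N)"
    and homs: "group_hom H f' K" "group_hom K g' L" "group_hom L h' N"
    unfolding Grp_m_Hom by blast
  show "Comp \<G> (Comp \<G> h g) f = Comp \<G> h (Comp \<G> g f)"
    using homs[THEN monoid_homD(1)] by (simp add: fgh)
qed

text \<open>For the unit of a pullback: its composite with the projection \<open>k\<close> is the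
  monic unit of \<open>A\<close>, so it is monic itself and the pullback stays in the full
  subcategory.\<close>

lemma monic_factor:
  assumes "monic C w" "w = k \<cdot> u" "u \<^bold>: X \<rightarrow> Y" "k \<^bold>: Y \<rightarrow> Z"
  shows "monic C u"
proof -
  note [simp] = assms(3,4)
  have "g = h" if gh: "g \<^bold>: V \<rightarrow> X" "h \<^bold>: V \<rightarrow> X" "u \<cdot> g = u \<cdot> h" for V g h
  proof -
    have "w \<cdot> g = w \<cdot> h" using gh by (simp add: assms(2))
    thus ?thesis using assms(1) gh by (simp add: monic_def assms(2))
  qed
  thus ?thesis by (simp add: monic_def)
qed

text \<open>The mediating arrow of \<open>C\<close> is a homomorphism because \<open>k\<close> and
  \<open>q\<close> are homomorphisms and jointly monic.\<close>

lemma Grp_m_pullback: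
  assumes H: "group A" "group B" "group E" "group Q"
    and homs: "group_hom A p B" "group_hom E v B" "group_hom Q k A" "group_hom Q q E"
    and pb: "pullback C p v k q"
  shows "pullback \<G> (A, p, B) (E, v, B) (Q, k, A) (Q, q, E)"
proof -
  note [simp] = H[THEN groupD(2)] homs[THEN monoid_homD(1)]
  have dk: "Dom C k = Under Q" by simp
  note U = pullbackD[OF pb dk monoid_homD(1)[OF homs(1)] monoid_homD(1)[OF homs(2)]]
  have uni: "\<exists>!h. h \<in> Hom \<G> X (Q, Under Q, Q) \<and> Comp \<G> (Q, k, A) h = a \<and>
      Comp \<G> (Q, q, E) h = b"
    if ab: "a \<in> Hom \<G> X (A, Under A, A)" "b \<in> Hom \<G> X (E, Under E, E)"
      "Comp \<G> (A, p, B) a = Comp \<G> (E, v, B) b" for X a b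
  proof -
    obtain L a' b' where X: "X = (L, Under L, L)" and a: "a = (L, a', A)" and b: "b = (L, b', E)"
      and L: "group L" and ab': "group_hom L a' A" "group_hom L b' E"
      using ab(1,2) unfolding Grp_m_Hom by blast
    note [simp] = groupD(2-)[OF L] ab'[THEN monoid_homD(1)]
    have "p \<cdot> a' = v \<cdot> b'" using ab(3) by (simp add: a b)
    then obtain h where h [simp]: "h \<^bold>: Under L \<rightarrow> Under Q" and kh: "k \<cdot> h = a'" and qh: "q \<cdot> h = b'"
      using U(5)[of a' "Under L" b'] by auto
    note [simp] = groupD(2-)[OF H(4)]
    have hm: "h \<cdot> Mult L = Mult Q \<cdot> (h \<odot> h)"
    proof (rule U(6)[of _ "Under L \<odot> Under L"])
      have "k \<cdot> (h \<cdot> Mult L) = (k \<cdot> h) \<cdot> Mult L" by simp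
      also have "\<dots> = k \<cdot> (Mult Q \<cdot> (h \<odot> h))" unfolding kh
        by (simp add: monoid_homD(2)[OF ab'(1)] monoid_hom_mult[OF groupD(1)[OF H(4)] groupD(1)[OF H(1)] homs(3)] kh)
      finally show "k \<cdot> (h \<cdot> Mult L) = k \<cdot> (Mult Q \<cdot> (h \<odot> h))" .
      have "q \<cdot> (h \<cdot> Mult L) = (q \<cdot> h) \<cdot> Mult L" by simp
      also have "\<dots> = q \<cdot> (Mult Q \<cdot> (h \<odot> h))" unfolding qh
        by (simp add: monoid_homD(2)[OF ab'(2)] monoid_hom_mult[OF groupD(1)[OF H(4)] groupD(1)[OF H(3)] homs(4)] qh)
      finally show "q \<cdot> (h \<cdot> Mult L) = q \<cdot> (Mult Q \<cdot> (h \<odot> h))" .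
    qed simp_all
    have hu: "h \<cdot> One L = One Q"
    proof (rule U(6)[of _ \<I>])
      have "k \<cdot> (h \<cdot> One L) = (k \<cdot> h) \<cdot> One L" "q \<cdot> (h \<cdot> One L) = (q \<cdot> h) \<cdot> One L" by simp_all
      thus "k \<cdot> (h \<cdot> One L) = k \<cdot> One Q" "q \<cdot> (h \<cdot> One L) = q \<cdot> One Q"
        unfolding kh qh by (simp_all only: monoid_homD(3)[OF ab'(1)] monoid_homD(3)[OF ab'(2)] monoid_homD(3)[OF homs(3)] monoid_homD(3)[OF homs(4)])
    qed simp_all
    have hh: "group_hom L h Q" by (simp add: monoid_hom_def hm hu)
    show ?thesis
    proof (rule ex1I[of _ "(L, h, Q)"])
      show "(L, h, Q) \<in> Hom \<G> X (Q, Under Q, Q) \<and> Comp \<G> (Q, k, A) (L, h, Q) = a \<and>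
          Comp \<G> (Q, q, E) (L, h, Q) = b"
        unfolding Grp_m_Hom X a b using L H(4) hh kh qh by simp
      fix g assume g: "g \<in> Hom \<G> X (Q, Under Q, Q) \<and> Comp \<G> (Q, k, A) g = a \<and>
          Comp \<G> (Q, q, E) g = b"
      then obtain g' where g': "g = (L, g', Q)" "group_hom L g' Q" unfolding Grp_m_Hom X by blast
      have "k \<cdot> g' = a'" "q \<cdot> g' = b'" using g by (simp_all add: g' a b)
      hence "g' = h" using monoid_homD(1)[OF g'(2)] by - (rule U(6)[of _ "Under L"], simp_all add: kh qh)
      thus "g = (L, h, Q)" by (simp add: g')
    qed
  qed
  have arr: "(A, p, B) \<in> Arr \<G>" "(E, v, B) \<in> Arr \<G>"
    "(Q, k, A) \<in> Hom \<G> (Q, Under Q, Q) (A, Under A, A)"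
    "(Q, q, E) \<in> Hom \<G> (Q, Under Q, Q) (E, Under E, E)"
    unfolding Grp_m_Arr Grp_m_Hom using H homs by blast+
  show ?thesis
    unfolding pullback_def Grp_m_simps using arr uni U(3) by simp
qed

lemma Grp_m_pullback_exists:
  assumes fc: "finitely_complete C" and H: "group A" "group B" "group E"
    and homs: "group_hom A p B" "group_hom B s A" "group_hom E v B" and ps: "p \<cdot> s = Under B"
  obtains Q k q where "group Q" "group_hom Q k A" "group_hom Q q E" "pullback C p v k q"
proof -
  note ty = homs[THEN monoid_homD(1)]
  obtain SA SB SE where S: "hopf (Under A) (Mult A) (One A) SA" "hopf (Under B) (Mult B) (One B) SB"
    "hopf (Under E) (Mult E) (One E) SE"
    using H unfolding group_def by blast
  obtain k q where pb: "pullback C p v k q" using finitely_complete_pullback[OF fc ty(1,3)] by blast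
  define X where "X = Dom C k"
  obtain m u SX where X: "hopf X m u SX" and k: "monoid_hom X m u k (Under A) (Mult A) (One A)"
    and q: "monoid_hom X m u q (Under E) (Mult E) (One E)"
    using pullback_hopf[OF S homs(1,2) ps homs(3) pb X_def[symmetric]] by blast
  define Q where "Q = \<lparr>Under = X, Mult = m, One = u, Comult = \<langle>X, X\<rangle>, Counit = \<tau> X\<rparr>"
  have "monic C u"
    by (rule monic_factor[of "One A" k u \<I> X "Under A"])
      (use H(1) monoid_homD[OF k] hopfD(5)[OF X] in \<open>simp_all add: group_def\<close>)
  hence Q: "group Q" using X by (auto simp: group_def Q_def)
  have "group_hom Q k A" "group_hom Q q E" using k q by (simp_all add: Q_def)
  from that[OF Q this pb] show ?thesis .
qed

text \<open>An inverse image functor comes with arbitrary pullbacks of groups, whereas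
  \<open>point_morphism_iso\<close> needs pullbacks in \<open>C\<close>. The given one is isomorphic
  to one that was built in \<open>C\<close>, and this isomorphism carries the pullback property
  back.\<close>

lemma Grp_m_pullbackD:
  assumes fc: "finitely_complete C" and H: "group A" "group B" "group E"
    and homs: "group_hom A p B" "group_hom B s A" "group_hom E v B" and ps: "p \<cdot> s = Under B"
    and pb: "pullback \<G> (A, p, B) (E, v, B) x y"
  obtains Q k q where "x = (Q, k, A)" "y = (Q, q, E)" "group Q" "group_hom Q k A" "group_hom Q q E"
    "pullback C p v k q"
proof -
  have xy: "x \<in> Hom \<G> (Dom \<G> x) (A, Under A, A)"
    "y \<in> Hom \<G> (Dom \<G> x) (E, Under E, E)"
    using pb unfolding pullback_def Grp_m_simps by blast+
  from xy(1) obtain Q k where x: "x = (Q, k, A)" and Q: "group Q" and k: "group_hom Q k A"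
    unfolding Grp_m_Hom by auto
  from xy(2) obtain q where y: "y = (Q, q, E)" and q: "group_hom Q q E"
    unfolding Grp_m_Hom x by auto
  note kq = k q
  interpret G: category \<G> by (rule category_Grp_m)
  obtain Q' k' q' where Q': "group Q'" and kq': "group_hom Q' k' A" "group_hom Q' q' E" and pb': "pullback C p v k' q'"
    using Grp_m_pullback_exists[OF fc H homs ps] .
  have G': "pullback \<G> (A, p, B) (E, v, B) (Q', k', A) (Q', q', E)"
    by (rule Grp_m_pullback[OF H Q' homs(1,3) kq' pb'])
  have d: "Dom \<G> (Q', k', A) = (Q', Under Q', Q')" "Dom \<G> (Q, k, A) = (Q, Under Q, Q)"
    by simp_all
  have pv: "(A, p, B) \<in> Hom \<G> (A, Under A, A) (B, Under B, B)"
    "(E, v, B) \<in> Hom \<G> (E, Under E, E) (B, Under B, B)"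
    unfolding Grp_m_Hom using H homs by blast+
  obtain i j where "i \<in> Hom \<G> (Q, Under Q, Q) (Q', Under Q', Q')"
    "j \<in> Hom \<G> (Q', Under Q', Q') (Q, Under Q, Q)"
    and ij: "Comp \<G> i j = (Q', Under Q', Q')" "Comp \<G> j i = (Q, Under Q, Q)"
    "Comp \<G> (Q', k', A) i = (Q, k, A)" "Comp \<G> (Q', q', E) i = (Q, q, E)"
    using G.pullback_compare[OF G' d(1) pb[unfolded x y] d(2) pv[unfolded G.Hom_iff], folded G.Hom_iff] .
  then obtain i' j' where i: "i = (Q, i', Q')" and j: "j = (Q', j', Q)" and h: "group_hom Q i' Q'" "group_hom Q' j' Q"
    unfolding Grp_m_Hom by blast
  have eq: "i' \<cdot> j' = Under Q'" "j' \<cdot> i' = Under Q" "k' \<cdot> i' = k" "q' \<cdot> i' = q"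
    using ij by (simp_all add: i j)
  have "Dom C k' = Under Q'" using monoid_homD(1)[OF kq'(1)] by simp
  from pullback_iso[OF pb' this homs(1,3)[THEN monoid_homD(1)] h[THEN monoid_homD(1)] eq(1,2)]
  have "pullback C p v k q" unfolding eq .
  thus ?thesis by (rule that[OF x y Q kq])
qed

theorem protomodular_Grp_m:
  assumes fc: "finitely_complete C"
  shows "protomodular \<G>"
proof -
  interpret G: category \<G> by (rule category_Grp_m)
  have pt: "\<exists>A B p' s'. p = (A, p', B) \<and> s = (B, s', A) \<and> X = (B, Under B, B) \<and> group A \<and> group B \<and>
      group_hom A p' B \<and> group_hom B s' A \<and> p' \<cdot> s' = Under B" if "(p, s) \<in> points \<G> X" for p s X
  proof -
    obtain Y where p: "p \<in> Hom \<G> Y X" and s: "s \<in> Hom \<G> X Y" and ps: "Comp \<G> p s = X"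
      using \<open>(p, s) \<in> points \<G> X\<close> unfolding points_def by blast
    from p obtain A p' B where p': "p = (A, p', B)" "Y = (A, Under A, A)" "X = (B, Under B, B)" "group A" "group B" "group_hom A p' B"
      unfolding Grp_m_Hom by blast
    from s obtain s' where s': "s = (B, s', A)" "group_hom B s' A"
      unfolding Grp_m_Hom p' by blast
    have "p' \<cdot> s' = Under B" using ps by (simp add: p' s')
    thus ?thesis using p' s' by blast
  qed
  have ex: "\<exists>k q. pullback \<G> p v k q" if v: "v \<in> Arr \<G>" and ps: "(p, s) \<in> points \<G> (Cod \<G> v)" for v p s
  proof -
    obtain E v' B where v': "v = (E, v', B)" "group E" "group B" "group_hom E v' B"
      using v unfolding Grp_m_Arr by blast
    obtain A p' s' where p': "p = (A, p', B)" "group A" "group_hom A p' B" "group_hom B s' A" "p' \<cdot> s' = Under B"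
      using pt[OF ps] unfolding v' Grp_m_simps by auto
    obtain Q k q where "group Q" "group_hom Q k A" "group_hom Q q E" "pullback C p' v' k q"
      using Grp_m_pullback_exists[OF fc p'(2) v'(3,2) p'(3,4) v'(4) p'(5)] .
    from Grp_m_pullback[OF p'(2) v'(3,2) this(1) p'(3) v'(4) this(2-4)] show ?thesis unfolding v' p' by blast
  qed
  have refl: "is_iso (Pt \<G> (Cod \<G> v)) f"
    if v: "v \<in> Arr \<G>" and F: "inverse_image_functor \<G> v F" and f: "f \<in> Arr (Pt \<G> (Cod \<G> v))"
      and iso: "is_iso (Pt \<G> (Dom \<G> v)) (F f)" for v F f
  proof -
    obtain E v' B where v': "v = (E, v', B)" and EB: "group E" "group B" "group_hom E v' B"
      using v unfolding Grp_m_Arr by blast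
    obtain p s f1 p' s' where f_eq: "f = ((p, s), f1, (p', s'))" and ps: "(p, s) \<in> points \<G> (Cod \<G> v)"
      and ps': "(p', s') \<in> points \<G> (Cod \<G> v)" and f1: "f1 \<in> Hom \<G> (Dom \<G> p) (Dom \<G> p')"
      and pf: "Comp \<G> p' f1 = p" and fs: "Comp \<G> f1 s = s'"
      using f unfolding Pt_def by auto
    obtain A p0 s0 where p: "p = (A, p0, B)" "s = (B, s0, A)" and A: "group A" and p0: "group_hom A p0 B" "group_hom B s0 A" "p0 \<cdot> s0 = Under B"
      using pt[OF ps] unfolding v' Grp_m_simps by auto
    obtain A' p0' s0' where p': "p' = (A', p0', B)" "s' = (B, s0', A')" and A': "group A'" and p0': "group_hom A' p0' B" "group_hom B s0' A'" "p0' \<cdot> s0' = Under B"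
      using pt[OF ps'] unfolding v' Grp_m_simps by auto
    obtain f0 where f1_eq: "f1 = (A, f0, A')" and f0: "group_hom A f0 A'"
      using f1 unfolding p p' Grp_m_simps Grp_m_Hom by blast
    note [simp] = groupD(2)[OF A] groupD(2)[OF A'] groupD(2)[OF EB(2)] p0(1,2)[THEN monoid_homD(1)] p0'(1,2)[THEN monoid_homD(1)] monoid_homD(1)[OF f0]
    have pf0: "p0' \<cdot> f0 = p0" and fs0: "f0 \<cdot> s0 = s0'" using pf fs by (simp_all add: p p' f1_eq)
    \<comment> \<open>The clause on \<open>\<kappa>\<close> yields a pullback square only for the
      source of an arrow of points. Applied to the identity of the target, it yields the square for
      \<open>p'\<close> too.\<close>
    let ?c = "((p', s'), (A', Under A', A'), (p', s'))"
    have c: "?c \<in> Arr (Pt \<G> (Cod \<G> v))" "Cod (Pt \<G> (Cod \<G> v)) f = ?c"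
      using ps' A' monoid_hom_id[OF groupD(1)[OF A']] by (simp_all add: Pt_def f_eq f1_eq p' Grp_m_Hom del: G.Hom_iff)
    obtain \<kappa> where \<kappa>: "\<forall>p s f p' s' q t g q' t'. ((p, s), f, (p', s')) \<in> Arr (Pt \<G> (Cod \<G> v)) \<and>
        F ((p, s), f, (p', s')) = ((q, t), g, (q', t')) \<longrightarrow>
          pullback \<G> p v (\<kappa> (p, s)) q \<and> Comp \<G> (\<kappa> (p, s)) t = Comp \<G> s v \<and>
          Comp \<G> (\<kappa> (p', s')) g = Comp \<G> f (\<kappa> (p, s))"
      using F unfolding inverse_image_functor_def by (elim conjE exE)
    note \<kappa> = \<kappa>[rule_format, OF conjI]
    obtain q t g q' t' where Ff: "F f = ((q, t), g, (q', t'))" by (metis prod.collapse)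
    have "Cod (Pt \<G> (Dom \<G> v)) (F f) = F ?c" "F f \<in> Arr (Pt \<G> (Dom \<G> v))"
      using F f c(2) unfolding inverse_image_functor_def is_functor_def by auto
    hence Fc: "F ?c = ((q', t'), Cod \<G> g, (q', t'))" and g: "g \<in> Hom \<G> (Dom \<G> q) (Dom \<G> q')" "Comp \<G> q' g = q"
      by (simp_all add: Ff Pt_def del: G.Hom_iff)
    have k: "pullback \<G> p v (\<kappa> (p, s)) q" "Comp \<G> (\<kappa> (p', s')) g = Comp \<G> f1 (\<kappa> (p, s))"
      using \<kappa>[OF f[unfolded f_eq] Ff[unfolded f_eq]] by blast+
    have k': "pullback \<G> p' v (\<kappa> (p', s')) q'" using \<kappa>[OF c(1) Fc] by blast
    obtain Q k0 q0 where Q: "\<kappa> (p, s) = (Q, k0, A)" "q = (Q, q0, E)" "group Q" "group_hom Q k0 A" "group_hom Q q0 E" and pb: "pullback C p0 v' k0 q0"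
      by (rule Grp_m_pullbackD[OF fc A EB(2,1) p0(1,2) EB(3) p0(3) k(1)[unfolded v' p(1)]])
        (simp only: p)
    obtain Q' k0' q0' where Q': "\<kappa> (p', s') = (Q', k0', A')" "q' = (Q', q0', E)" "group Q'" "group_hom Q' k0' A'" "group_hom Q' q0' E" and pb': "pullback C p0' v' k0' q0'"
      by (rule Grp_m_pullbackD[OF fc A' EB(2,1) p0'(1,2) EB(3) p0'(3) k'[unfolded v' p'(1)]])
        (simp only: p')
    obtain g0 where g_eq: "g = (Q, g0, Q')" and g0: "group_hom Q g0 Q'"
      using g(1) unfolding Q(2) Q'(2) Grp_m_simps Grp_m_Hom by blast
    have kg: "k0' \<cdot> g0 = f0 \<cdot> k0" "q0' \<cdot> g0 = q0"
      using k(2) g(2) by (simp_all add: g_eq f1_eq Q Q')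
    obtain j where j: "inverse_arrows (Pt \<G> (Dom \<G> v)) (F f) j" using iso unfolding is_iso_def by blast
    obtain a gi b where j_eq: "j = (a, gi, b)" by (metis prod.collapse)
    have "gi \<in> Hom \<G> (Q', Under Q', Q') (Q, Under Q, Q)" "Comp \<G> gi g = (Q, Under Q, Q)" "Comp \<G> g gi = (Q', Under Q', Q')"
      using j by (auto simp: inverse_arrows_def Ff j_eq Pt_def Hom_def Q Q' g_eq simp del: G.Hom_iff)
    then obtain gi0 where gi: "group_hom Q' gi0 Q" "gi0 \<cdot> g0 = Under Q" "g0 \<cdot> gi0 = Under Q'"
      unfolding Grp_m_Hom by (auto simp: g_eq)
    obtain SA SA' SB SE where S: "hopf (Under A) (Mult A) (One A) SA" "hopf (Under A') (Mult A') (One A') SA'"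
        "hopf (Under B) (Mult B) (One B) SB" "hopf (Under E) (Mult E) (One E) SE"
      using A A' EB(1,2) unfolding group_def by blast
    have dk: "Dom C k0 = Under Q" "Dom C k0' = Under Q'"
      using monoid_homD(1)[OF Q(4)] monoid_homD(1)[OF Q'(4)] by simp_all
    obtain h where h [simp]: "h \<^bold>: Under A' \<rightarrow> Under A" and hf: "h \<cdot> f0 = Under A" "f0 \<cdot> h = Under A'"
      by (rule point_morphism_iso[OF S p0 p0' EB(3) f0 pf0 fs0 pb dk(1) pb' dk(2) monoid_homD(1)[OF g0] kg
            monoid_homD(1)[OF gi(1)] gi(2,3)])
    \<comment> \<open>So far \<open>h\<close> is only an arrow of \<open>C\<close>. As the inverse
      of a homomorphism it preserves multiplication and unit.\<close>
    have hh: "group_hom A' h A"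
    proof -
      note [simp] = groupD(2-)[OF A] groupD(2-)[OF A']
      have "h \<cdot> Mult A' = h \<cdot> Mult A' \<cdot> ((f0 \<cdot> h) \<odot> (f0 \<cdot> h))" unfolding hf by simp
      also have "\<dots> = h \<cdot> (Mult A' \<cdot> (f0 \<odot> f0)) \<cdot> (h \<odot> h)" by simp
      also have "\<dots> = (h \<cdot> f0) \<cdot> Mult A \<cdot> (h \<odot> h)" unfolding monoid_homD(2)[OF f0, symmetric] by simp
      also have "\<dots> = Mult A \<cdot> (h \<odot> h)" unfolding hf by simp
      finally have 1: "h \<cdot> Mult A' = Mult A \<cdot> (h \<odot> h)" .
      have "h \<cdot> One A' = (h \<cdot> f0) \<cdot> One A" unfolding monoid_homD(3)[OF f0, symmetric] by simp
      also have "\<dots> = One A" unfolding hf by simp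
      finally show ?thesis using 1 by (simp add: monoid_hom_def)
    qed
    have ph: "p0 \<cdot> h = p0'" unfolding pf0[symmetric] by (simp add: hf)
    have "h \<cdot> (f0 \<cdot> s0) = (h \<cdot> f0) \<cdot> s0" by simp
    hence hs: "h \<cdot> s0' = s0" unfolding fs0 hf by simp
    have "inverse_arrows (Pt \<G> (Cod \<G> v)) f ((p', s'), (A', h, A), (p, s))"
      using ps ps' f A A' hh
      by (simp add: inverse_arrows_def f_eq f1_eq Pt_def Hom_def p p' ph hs hf Grp_m_Arr del: G.Hom_iff)
    thus ?thesis unfolding is_iso_def by blast
  qed
  show ?thesis
    unfolding protomodular_def reflects_isos_def using ex refl G.category_axioms by blast
qed

end

theorem corollary4p9:
  fixes C :: "'a cat" and M :: "'a monoidal" and P :: "'a products" and R :: "'a reversion"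
  assumes "monoidal_category C M"
    and "finitely_complete C"
    and "finite_products C P"
    and "reversion C (cartesian_duoidal C M P) R"
  shows "protomodular (Grp_m C M P R)"
proof (rule cartesian_reversion.protomodular_Grp_m)
  show "cartesian_reversion C M P R"
    by (intro cartesian_reversion.intro cartesian_reversion_axioms.intro assms)
qed (rule assms)

end
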